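(* Let $A=\{A_\alpha\}_{\alpha\in\pi}$ be a Hopf $\pi$-coalgebra and $I$ an index set. Let $(f_{ij})_{i,j\in I}$ be a family of functionals on $A$, i.e. each $f_{ij}$ consists of linear functionals $A_\alpha\to k$ ($\alpha\in\pi$), all denoted $f_{ij}$, such that for all $\alpha\in\pi$, $a,b\in A_\alpha$ and $i,j\in I$, $$f_{ij}(ab)=\sum_{k}f_{ik}(a)f_{kj}(b),\qquad f_{ij}(1_\alpha)=\delta_{ij}.$$ For each $\alpha\in\pi$ let $(R^\alpha_{ij})_{i,j\in I}$ be a family of elements of $A_\alpha$ such that $$\Delta_{\alpha,\beta}(R^{\alpha\beta}_{ji})=\sum_h R^\alpha_{jh}\otimes R^\beta_{hi}\quad(\alpha,\beta\in\pi),\qquad \varepsilon(R^1_{ji})=\delta_{ji},$$ $$\sum_i R^\alpha_{ij}\,(a*f_{ih})=\sum_i (f_{ji}*a)\,R^\alpha_{hi}\qquad(\alpha\in\pi,\ a\in A_\alpha,\ j,h\in I).$$ Assume all sums occurring here and below have only finitely many non-zero terms (for each $i$, only finitely many $R^\alpha_{ji}$, $j\in I$, are non-zero, and for each $i$ and each $b\in A_\alpha$ only finitely many $f_{ij}(b)$, $j\in I$, are non-zero). For each $\alpha$ let $\Gamma_\alpha$ be the free left $A_\alpha$-module with basis $(\omega_i^\alpha)_{i\in I}$, and define a right multiplication by elements of $A$ and left and right actions of $A$ on $\Gamma=\{\Gamma_\alpha\}_{\alpha\in\pi}$ by $$\Big(\sum_i a_i\omega_i^\alpha\Big)b=\sum_{i,j}a_i(f_{ij}*b)\,\omega_j^\alpha\quad(a_i,b\in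 A_\alpha),$$ $$\Delta^l_{\alpha,\beta}\Big(\sum_i a_i\omega_i^{\alpha\beta}\Big)=\sum_i\Delta_{\alpha,\beta}(a_i)(1_\alpha\otimes\omega_i^\beta),\qquad \Delta^r_{\alpha,\beta}\Big(\sum_i a_i\omega_i^{\alpha\beta}\Big)=\sum_{i,j}\Delta_{\alpha,\beta}(a_i)(\omega_j^\alpha\otimes R^\beta_{ji})\quad(a_i\in A_{\alpha\beta}).$$ Then $\Gamma=(\{\Gamma_\alpha\}_{\alpha\in\pi},\Delta^l,\Delta^r)$ is a $\pi$-graded bicovariant bimodule over $A$.
   Context: Let $k$ be a field and $\pi$ a group with identity $1$; $\otimes=\otimes_k$. A Hopf $\pi$-coalgebra (Hopf group coalgebra) is a family $A=\{A_\alpha\}_{\alpha\in\pi}$ of unital associative $k$-algebras (multiplication $m_\alpha$, unit $1_\alpha$) with algebra maps $\Delta_{\alpha,\beta}:A_{\alpha\beta}\to A_\alpha\otimes A_\beta$, $\varepsilon:A_1\to k$ and linear maps $S_\alpha:A_\alpha\to A_{\alpha^{-1}}$ such that $(\Delta_{\alpha,\beta}\otimes id)\Delta_{\alpha\beta,\gamma}=(id\otimes\Delta_{\beta,\gamma})\Delta_{\alpha,\beta\gamma}$, $(id\otimes\varepsilon)\Delta_{\alpha,1}=id=(\varepsilon\otimes id)\Delta_{1,\alpha}$, and $m_\alpha(S_{\alpha^{-1}}\otimes id)\Delta_{\alpha^{-1},\alpha}=\varepsilon(\cdot)1_\alpha=m_\alpha(id\otimes S_{\alpha^{-1}})\Delta_{\alpha,\alpha^{-1}}$.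 For $f$ a functional on $A$ and $a\in A_\alpha$: $f*a=(id\otimes f)\Delta_{\alpha,1}(a)\in A_\alpha$ and $a*f=(f\otimes id)\Delta_{1,\alpha}(a)\in A_\alpha$ (only the restriction of $f$ to $A_1$ enters). A $\pi$-graded bimodule over $A$ is a family $\Gamma=\{\Gamma_\alpha\}$ with $\Gamma_\alpha$ a (unital) $A_\alpha$-bimodule. It is a $\pi$-graded left covariant bimodule with linear maps $\Delta^l_{\alpha,\beta}:\Gamma_{\alpha\beta}\to A_\alpha\otimes\Gamma_\beta$ if $\Delta^l_{\alpha,\beta}(a\rho)=\Delta_{\alpha,\beta}(a)\Delta^l_{\alpha,\beta}(\rho)$, $\Delta^l_{\alpha,\beta}(\rho a)=\Delta^l_{\alpha,\beta}(\rho)\Delta_{\alpha,\beta}(a)$ for $a\in A_{\alpha\beta},\rho\in\Gamma_{\alpha\beta}$, $(\Delta_{\alpha,\beta}\otimes id)\Delta^l_{\alpha\beta,\gamma}=(id\otimes\Delta^l_{\beta,\gamma})\Delta^l_{\alpha,\beta\gamma}$, and $(\varepsilon\otimes id)\Delta^l_{1,\alpha}=id$. It is right covariant with linear maps $\Delta^r_{\alpha,\beta}:\Gamma_{\alpha\beta}\to\Gamma_\alpha\otimes A_\beta$ if $\Delta^r_{\alpha,\beta}(a\rho)=\Delta_{\alpha,\beta}(a)\Delta^r_{\alpha,\beta}(\rho)$, $\Delta^r_{\alpha,\beta}(\rho a)=\Delta^r_{\alpha,\beta}(\rho)\Delta_{\alpha,\beta}(a)$, $(id\otimes\Delta_{\beta,\gamma})\Delta^r_{\alpha,\beta\gamma}=(\Delta^r_{\alpha,\beta}\otimes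 id)\Delta^r_{\alpha\beta,\gamma}$, and $(id\otimes\varepsilon)\Delta^r_{\alpha,1}=id$. It is bicovariant if it is left covariant, right covariant, and $(\Delta^l_{\alpha,\beta}\otimes id)\Delta^r_{\alpha\beta,\gamma}=(id\otimes\Delta^r_{\beta,\gamma})\Delta^l_{\alpha,\beta\gamma}$ for all $\alpha,\beta,\gamma\in\pi$. *)

theory Defs
  imports "HOL-Algebra.Module" "HOL-Algebra.AbelCoset"
begin

section \<open>Sums with finitely many non-zero terms\<close>

text \<open>\<open>finsum\<close> over an infinite index set is \<open>\<zero>\<close> by convention, so a sum over a possibly infinite
  index set with only finitely many non-zero terms has to be taken over its support.\<close>

definition fin_supp_sum :: "('a, 'm) ring_scheme \<Rightarrow> 'i set \<Rightarrow> ('i \<Rightarrow> 'a) \<Rightarrow> 'a" where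
  "fin_supp_sum M I t = finsum M t {i \<in> I. t i \<noteq> \<zero>\<^bsub>M\<^esub>}"


section \<open>Linear maps, algebras, free modules\<close>

text \<open>Vector spaces over \<open>K\<close> are \<^locale>\<open>module\<close>s over the field \<open>K\<close>; the fields \<open>mult\<close> and \<open>one\<close> of
  the record are meaningless unless the object is an algebra.\<close>

definition linear_map ::
  "('k, 'r) ring_scheme \<Rightarrow> ('k, 'a, 'm) module_scheme \<Rightarrow> ('k, 'b, 'n) module_scheme \<Rightarrow> ('a \<Rightarrow> 'b) \<Rightarrow> bool"
  where "linear_map K V W f \<longleftrightarrow>
    f \<in> carrier V \<rightarrow> carrier W \<and>
    (\<forall>x \<in> carrier V. \<forall>y \<in> carrier V. f (x \<oplus>\<^bsub>V\<^esub> y) = f x \<oplus>\<^bsub>W\<^esub> f y) \<and>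
    (\<forall>c \<in> carrier K. \<forall>x \<in> carrier V. f (c \<odot>\<^bsub>V\<^esub> x) = c \<odot>\<^bsub>W\<^esub> f x)"

text \<open>A unital associative algebra, not necessarily commutative (unlike \<^locale>\<open>algebra\<close>).\<close>

locale assoc_algebra = module K B + B: ring B for K (structure) and B (structure) +
  assumes smult_mult_left:
      "\<lbrakk>c \<in> carrier K; x \<in> carrier B; y \<in> carrier B\<rbrakk> \<Longrightarrow>
        (c \<odot>\<^bsub>B\<^esub> x) \<otimes>\<^bsub>B\<^esub> y = c \<odot>\<^bsub>B\<^esub> (x \<otimes>\<^bsub>B\<^esub> y)"
    and smult_mult_right:
      "\<lbrakk>c \<in> carrier K; x \<in> carrier B; y \<in> carrier B\<rbrakk> \<Longrightarrow>
        x \<otimes>\<^bsub>B\<^esub> (c \<odot>\<^bsub>B\<^esub> y) = c \<odot>\<^bsub>B\<^esub> (x \<otimes>\<^bsub>B\<^esub> y)"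

definition algebra_map ::
  "('k, 'r) ring_scheme \<Rightarrow> ('k, 'a, 'm) module_scheme \<Rightarrow> ('k, 'b, 'n) module_scheme \<Rightarrow> ('a \<Rightarrow> 'b) \<Rightarrow> bool"
  where "algebra_map K B C f \<longleftrightarrow> f \<in> ring_hom B C \<and> linear_map K B C f"

definition ground :: "('k, 'r) ring_scheme \<Rightarrow> ('k, 'k) module" where
  "ground K = \<lparr>carrier = carrier K, mult = mult K, one = \<one>\<^bsub>K\<^esub>, zero = \<zero>\<^bsub>K\<^esub>, add = add K,
     smult = mult K\<rparr>"

definition free_module :: "('r, 'm) ring_scheme \<Rightarrow> 's set \<Rightarrow> ('r, 's \<Rightarrow> 'r) module" where
  "free_module R X =
    \<lparr>carrier = {x \<in> X \<rightarrow>\<^sub>E carrier R. finite {s \<in> X. x s \<noteq> \<zero>\<^bsub>R\<^esub>}},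
     mult = undefined, one = undefined,
     zero = (\<lambda>s\<in>X. \<zero>\<^bsub>R\<^esub>),
     add = (\<lambda>x y. \<lambda>s\<in>X. x s \<oplus>\<^bsub>R\<^esub> y s),
     smult = (\<lambda>r x. \<lambda>s\<in>X. r \<otimes>\<^bsub>R\<^esub> x s)\<rparr>"

definition free_basis :: "('r, 'm) ring_scheme \<Rightarrow> 's set \<Rightarrow> 's \<Rightarrow> 's \<Rightarrow> 'r" where
  "free_basis R X s = (\<lambda>t\<in>X. if t = s then \<one>\<^bsub>R\<^esub> else \<zero>\<^bsub>R\<^esub>)"


section \<open>Tensor products over the ground field\<close>

text \<open>The tensor product is the free \<open>K\<close>-module on pairs modulo the submodule generated by the
  bilinearity relations; its elements are the cosets of that submodule.\<close>

abbreviation pair_module ::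
  "('k, 'r) ring_scheme \<Rightarrow> ('k, 'a, 'm) module_scheme \<Rightarrow> ('k, 'b, 'n) module_scheme
    \<Rightarrow> ('k, 'a \<times> 'b \<Rightarrow> 'k) module"
  where "pair_module K V W \<equiv> free_module K (carrier V \<times> carrier W)"

abbreviation pair_basis ::
  "('k, 'r) ring_scheme \<Rightarrow> ('k, 'a, 'm) module_scheme \<Rightarrow> ('k, 'b, 'n) module_scheme
    \<Rightarrow> 'a \<Rightarrow> 'b \<Rightarrow> 'a \<times> 'b \<Rightarrow> 'k"
  where "pair_basis K V W v w \<equiv> free_basis K (carrier V \<times> carrier W) (v, w)"

definition bilinear_relations ::
  "('k, 'r) ring_scheme \<Rightarrow> ('k, 'a, 'm) module_scheme \<Rightarrow> ('k, 'b, 'n) module_scheme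
    \<Rightarrow> ('a \<times> 'b \<Rightarrow> 'k) set"
  where "bilinear_relations K V W =
    (let F = pair_module K V W; e = pair_basis K V W in
      {e (v \<oplus>\<^bsub>V\<^esub> v') w \<ominus>\<^bsub>F\<^esub> (e v w \<oplus>\<^bsub>F\<^esub> e v' w) | v v' w.
         v \<in> carrier V \<and> v' \<in> carrier V \<and> w \<in> carrier W} \<union>
      {e v (w \<oplus>\<^bsub>W\<^esub> w') \<ominus>\<^bsub>F\<^esub> (e v w \<oplus>\<^bsub>F\<^esub> e v w') | v w w'.
         v \<in> carrier V \<and> w \<in> carrier W \<and> w' \<in> carrier W} \<union>
      {e (c \<odot>\<^bsub>V\<^esub> v) w \<ominus>\<^bsub>F\<^esub> c \<odot>\<^bsub>F\<^esub> e v w | c v w.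
         c \<in> carrier K \<and> v \<in> carrier V \<and> w \<in> carrier W} \<union>
      {e v (c \<odot>\<^bsub>W\<^esub> w) \<ominus>\<^bsub>F\<^esub> c \<odot>\<^bsub>F\<^esub> e v w | c v w.
         c \<in> carrier K \<and> v \<in> carrier V \<and> w \<in> carrier W})"

definition bilinear_submodule ::
  "('k, 'r) ring_scheme \<Rightarrow> ('k, 'a, 'm) module_scheme \<Rightarrow> ('k, 'b, 'n) module_scheme
    \<Rightarrow> ('a \<times> 'b \<Rightarrow> 'k) set"
  where "bilinear_submodule K V W =
    \<Inter>{N. submodule N K (pair_module K V W) \<and> bilinear_relations K V W \<subseteq> N}"

definition pure_tensor ::
  "('k, 'r) ring_scheme \<Rightarrow> ('k, 'a, 'm) module_scheme \<Rightarrow> ('k, 'b, 'n) module_scheme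
    \<Rightarrow> 'a \<Rightarrow> 'b \<Rightarrow> ('a \<times> 'b \<Rightarrow> 'k) set"
  where "pure_tensor K V W v w =
    bilinear_submodule K V W +>\<^bsub>pair_module K V W\<^esub> pair_basis K V W v w"

definition tensor ::
  "('k, 'r) ring_scheme \<Rightarrow> ('k, 'a, 'm) module_scheme \<Rightarrow> ('k, 'b, 'n) module_scheme
    \<Rightarrow> ('k, ('a \<times> 'b \<Rightarrow> 'k) set) module"
  where "tensor K V W =
    (let F = pair_module K V W; N = bilinear_submodule K V W in
      \<lparr>carrier = a_rcosets\<^bsub>F\<^esub> N, mult = undefined, one = undefined,
       zero = N,
       add = set_add F,
       smult = (\<lambda>c X. \<Union>x\<in>X. N +>\<^bsub>F\<^esub> (c \<odot>\<^bsub>F\<^esub> x))\<rparr>)"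

text \<open>The linear map \<open>V \<otimes> W \<rightarrow> U\<close> induced by a bilinear map \<open>\<phi>\<close>: evaluate \<open>\<phi>\<close> on any representative
  of the coset. The image set below is a singleton when \<open>\<phi>\<close> is bilinear.\<close>

definition tensor_lift ::
  "('k, 'r) ring_scheme \<Rightarrow> ('k, 'a, 'm) module_scheme \<Rightarrow> ('k, 'b, 'n) module_scheme
    \<Rightarrow> ('k, 'c, 'l) module_scheme \<Rightarrow> ('a \<Rightarrow> 'b \<Rightarrow> 'c) \<Rightarrow> ('a \<times> 'b \<Rightarrow> 'k) set \<Rightarrow> 'c"
  where "tensor_lift K V W U \<phi> X =
    the_elem ((\<lambda>x. finsum U (\<lambda>p. x p \<odot>\<^bsub>U\<^esub> \<phi> (fst p) (snd p))
                 {p \<in> carrier V \<times> carrier W. x p \<noteq> \<zero>\<^bsub>K\<^esub>}) ` X)"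

text \<open>\<open>f \<otimes> g : V \<otimes> W \<rightarrow> V' \<otimes> W'\<close>\<close>

definition tensor_map ::
  "('k, 'r) ring_scheme \<Rightarrow> ('k, 'a, 'm) module_scheme \<Rightarrow> ('k, 'b, 'n) module_scheme
    \<Rightarrow> ('k, 'c, 'o) module_scheme \<Rightarrow> ('k, 'd, 'p) module_scheme
    \<Rightarrow> ('a \<Rightarrow> 'c) \<Rightarrow> ('b \<Rightarrow> 'd) \<Rightarrow> ('a \<times> 'b \<Rightarrow> 'k) set \<Rightarrow> ('c \<times> 'd \<Rightarrow> 'k) set"
  where "tensor_map K V W V' W' f g =
    tensor_lift K V W (tensor K V' W') (\<lambda>v w. pure_tensor K V' W' (f v) (g w))"

text \<open>The canonical isomorphism \<open>(U \<otimes> V) \<otimes> W \<rightarrow> U \<otimes> (V \<otimes> W)\<close>\<close>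

definition tensor_assoc ::
  "('k, 'r) ring_scheme \<Rightarrow> ('k, 'a, 'm) module_scheme \<Rightarrow> ('k, 'b, 'n) module_scheme
    \<Rightarrow> ('k, 'c, 'o) module_scheme
    \<Rightarrow> (('a \<times> 'b \<Rightarrow> 'k) set \<times> 'c \<Rightarrow> 'k) set \<Rightarrow> ('a \<times> ('b \<times> 'c \<Rightarrow> 'k) set \<Rightarrow> 'k) set"
  where "tensor_assoc K U V W =
    (let T = tensor K U (tensor K V W) in
      tensor_lift K (tensor K U V) W T (\<lambda>x w.
        tensor_lift K U V T (\<lambda>u v. pure_tensor K U (tensor K V W) u (pure_tensor K V W v w)) x))"

text \<open>\<open>id \<otimes> g\<close> and \<open>g \<otimes> id\<close> for a functional \<open>g\<close>, with the identifications \<open>V \<otimes> k = V\<close> and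
  \<open>k \<otimes> W = W\<close>\<close>

definition id_tensor_fun ::
  "('k, 'r) ring_scheme \<Rightarrow> ('k, 'a, 'm) module_scheme \<Rightarrow> ('k, 'b, 'n) module_scheme
    \<Rightarrow> ('b \<Rightarrow> 'k) \<Rightarrow> ('a \<times> 'b \<Rightarrow> 'k) set \<Rightarrow> 'a"
  where "id_tensor_fun K V W g = tensor_lift K V W V (\<lambda>v w. g w \<odot>\<^bsub>V\<^esub> v)"

definition fun_tensor_id ::
  "('k, 'r) ring_scheme \<Rightarrow> ('k, 'a, 'm) module_scheme \<Rightarrow> ('k, 'b, 'n) module_scheme
    \<Rightarrow> ('a \<Rightarrow> 'k) \<Rightarrow> ('a \<times> 'b \<Rightarrow> 'k) set \<Rightarrow> 'b"
  where "fun_tensor_id K V W g = tensor_lift K V W W (\<lambda>v w. g v \<odot>\<^bsub>W\<^esub> w)"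

text \<open>The bilinear map \<open>(V \<otimes> W) \<times> (V' \<otimes> W') \<rightarrow> V'' \<otimes> W''\<close> given by
  \<open>(v \<otimes> w, v' \<otimes> w') \<mapsto> p v v' \<otimes> q w w'\<close>, for bilinear \<open>p : V \<times> V' \<rightarrow> V''\<close> and
  \<open>q : W \<times> W' \<rightarrow> W''\<close>\<close>

definition tensor_bilinear ::
  "('k, 'r) ring_scheme
    \<Rightarrow> ('k, 'a, 'm1) module_scheme \<Rightarrow> ('k, 'b, 'n1) module_scheme
    \<Rightarrow> ('k, 'c, 'm2) module_scheme \<Rightarrow> ('k, 'd, 'n2) module_scheme
    \<Rightarrow> ('k, 'e, 'm3) module_scheme \<Rightarrow> ('k, 'f, 'n3) module_scheme
    \<Rightarrow> ('a \<Rightarrow> 'c \<Rightarrow> 'e) \<Rightarrow> ('b \<Rightarrow> 'd \<Rightarrow> 'f)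
    \<Rightarrow> ('a \<times> 'b \<Rightarrow> 'k) set \<Rightarrow> ('c \<times> 'd \<Rightarrow> 'k) set \<Rightarrow> ('e \<times> 'f \<Rightarrow> 'k) set"
  where "tensor_bilinear K V W V' W' V'' W'' p q X Y =
    (let T = tensor K V'' W'' in
      tensor_lift K V W T (\<lambda>v w.
        tensor_lift K V' W' T (\<lambda>v' w'. pure_tensor K V'' W'' (p v v') (q w w')) Y) X)"

definition tensor_algebra ::
  "('k, 'r) ring_scheme \<Rightarrow> ('k, 'a, 'm) module_scheme \<Rightarrow> ('k, 'b, 'n) module_scheme
    \<Rightarrow> ('k, ('a \<times> 'b \<Rightarrow> 'k) set) module"
  where "tensor_algebra K B C =
    (tensor K B C)\<lparr>mult := tensor_bilinear K B C B C B C (mult B) (mult C),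
                   one := pure_tensor K B C \<one>\<^bsub>B\<^esub> \<one>\<^bsub>C\<^esub>\<rparr>"

definition mult_map ::
  "('k, 'r) ring_scheme \<Rightarrow> ('k, 'a, 'm) module_scheme \<Rightarrow> ('a \<times> 'a \<Rightarrow> 'k) set \<Rightarrow> 'a"
  where "mult_map K B = tensor_lift K B B B (mult B)"


section \<open>Hopf group coalgebras\<close>

locale hopf_group_coalgebra = K: field K + G: group G
  for K :: "'k ring" and G :: "'g monoid" +
  fixes A :: "'g \<Rightarrow> ('k, 'a) module"
    and \<Delta> :: "'g \<Rightarrow> 'g \<Rightarrow> 'a \<Rightarrow> ('a \<times> 'a \<Rightarrow> 'k) set"
    and \<epsilon> :: "'a \<Rightarrow> 'k"
    and S :: "'g \<Rightarrow> 'a \<Rightarrow> 'a"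
  assumes alg: "\<alpha> \<in> carrier G \<Longrightarrow> assoc_algebra K (A \<alpha>)"
    and comult_algebra_map:
      "\<lbrakk>\<alpha> \<in> carrier G; \<beta> \<in> carrier G\<rbrakk> \<Longrightarrow>
        algebra_map K (A (\<alpha> \<otimes>\<^bsub>G\<^esub> \<beta>)) (tensor_algebra K (A \<alpha>) (A \<beta>)) (\<Delta> \<alpha> \<beta>)"
    and counit_algebra_map: "algebra_map K (A \<one>\<^bsub>G\<^esub>) (ground K) \<epsilon>"
    and antipode_linear:
      "\<alpha> \<in> carrier G \<Longrightarrow> linear_map K (A \<alpha>) (A (inv\<^bsub>G\<^esub> \<alpha>)) (S \<alpha>)"
    and coassoc:
      "\<lbrakk>\<alpha> \<in> carrier G; \<beta> \<in> carrier G; \<gamma> \<in> carrier G;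
        a \<in> carrier (A (\<alpha> \<otimes>\<^bsub>G\<^esub> \<beta> \<otimes>\<^bsub>G\<^esub> \<gamma>))\<rbrakk> \<Longrightarrow>
        tensor_assoc K (A \<alpha>) (A \<beta>) (A \<gamma>)
          (tensor_map K (A (\<alpha> \<otimes>\<^bsub>G\<^esub> \<beta>)) (A \<gamma>) (tensor K (A \<alpha>) (A \<beta>)) (A \<gamma>) (\<Delta> \<alpha> \<beta>) (\<lambda>x. x)
            (\<Delta> (\<alpha> \<otimes>\<^bsub>G\<^esub> \<beta>) \<gamma> a)) =
        tensor_map K (A \<alpha>) (A (\<beta> \<otimes>\<^bsub>G\<^esub> \<gamma>)) (A \<alpha>) (tensor K (A \<beta>) (A \<gamma>)) (\<lambda>x. x) (\<Delta> \<beta> \<gamma>)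
          (\<Delta> \<alpha> (\<beta> \<otimes>\<^bsub>G\<^esub> \<gamma>) a)"
    and counit_right:
      "\<lbrakk>\<alpha> \<in> carrier G; a \<in> carrier (A \<alpha>)\<rbrakk> \<Longrightarrow>
        id_tensor_fun K (A \<alpha>) (A \<one>\<^bsub>G\<^esub>) \<epsilon> (\<Delta> \<alpha> \<one>\<^bsub>G\<^esub> a) = a"
    and counit_left:
      "\<lbrakk>\<alpha> \<in> carrier G; a \<in> carrier (A \<alpha>)\<rbrakk> \<Longrightarrow>
        fun_tensor_id K (A \<one>\<^bsub>G\<^esub>) (A \<alpha>) \<epsilon> (\<Delta> \<one>\<^bsub>G\<^esub> \<alpha> a) = a"
    and antipode_left:
      "\<lbrakk>\<alpha> \<in> carrier G; a \<in> carrier (A \<one>\<^bsub>G\<^esub>)\<rbrakk> \<Longrightarrow>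
        mult_map K (A \<alpha>)
          (tensor_map K (A (inv\<^bsub>G\<^esub> \<alpha>)) (A \<alpha>) (A \<alpha>) (A \<alpha>) (S (inv\<^bsub>G\<^esub> \<alpha>)) (\<lambda>x. x)
            (\<Delta> (inv\<^bsub>G\<^esub> \<alpha>) \<alpha> a)) = \<epsilon> a \<odot>\<^bsub>A \<alpha>\<^esub> \<one>\<^bsub>A \<alpha>\<^esub>"
    and antipode_right:
      "\<lbrakk>\<alpha> \<in> carrier G; a \<in> carrier (A \<one>\<^bsub>G\<^esub>)\<rbrakk> \<Longrightarrow>
        mult_map K (A \<alpha>)
          (tensor_map K (A \<alpha>) (A (inv\<^bsub>G\<^esub> \<alpha>)) (A \<alpha>) (A \<alpha>) (\<lambda>x. x) (S (inv\<^bsub>G\<^esub> \<alpha>))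
            (\<Delta> \<alpha> (inv\<^bsub>G\<^esub> \<alpha>) a)) = \<epsilon> a \<odot>\<^bsub>A \<alpha>\<^esub> \<one>\<^bsub>A \<alpha>\<^esub>"

text \<open>\<open>f * a\<close> and \<open>a * f\<close> for \<open>a\<close> of degree \<open>\<alpha>\<close>; a functional on the family \<open>A\<close> is itself a family
  indexed by the group, of which only the component at the identity is used.\<close>

definition fun_conv ::
  "'k ring \<Rightarrow> 'g monoid \<Rightarrow> ('g \<Rightarrow> ('k, 'a) module) \<Rightarrow> ('g \<Rightarrow> 'g \<Rightarrow> 'a \<Rightarrow> ('a \<times> 'a \<Rightarrow> 'k) set)
    \<Rightarrow> 'g \<Rightarrow> ('g \<Rightarrow> 'a \<Rightarrow> 'k) \<Rightarrow> 'a \<Rightarrow> 'a"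
  where "fun_conv K G A \<Delta> \<alpha> f a = id_tensor_fun K (A \<alpha>) (A \<one>\<^bsub>G\<^esub>) (f \<one>\<^bsub>G\<^esub>) (\<Delta> \<alpha> \<one>\<^bsub>G\<^esub> a)"

definition conv_fun ::
  "'k ring \<Rightarrow> 'g monoid \<Rightarrow> ('g \<Rightarrow> ('k, 'a) module) \<Rightarrow> ('g \<Rightarrow> 'g \<Rightarrow> 'a \<Rightarrow> ('a \<times> 'a \<Rightarrow> 'k) set)
    \<Rightarrow> 'g \<Rightarrow> 'a \<Rightarrow> ('g \<Rightarrow> 'a \<Rightarrow> 'k) \<Rightarrow> 'a"
  where "conv_fun K G A \<Delta> \<alpha> a f = fun_tensor_id K (A \<one>\<^bsub>G\<^esub>) (A \<alpha>) (f \<one>\<^bsub>G\<^esub>) (\<Delta> \<one>\<^bsub>G\<^esub> \<alpha> a)"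


section \<open>Graded bicovariant bimodules\<close>

record ('k, 'a, 'v) bimodule = "('k, 'v) module" +
  lact :: "'a \<Rightarrow> 'v \<Rightarrow> 'v"
  ract :: "'v \<Rightarrow> 'a \<Rightarrow> 'v"

text \<open>Unital bimodules over a \<open>K\<close>-algebra \<open>B\<close>, with both actions \<open>K\<close>-bilinear.\<close>

locale bimodule = B: assoc_algebra K B + M: module K M
  for K :: "'k ring" and B :: "('k, 'a) module" and M :: "('k, 'a, 'v) bimodule" +
  assumes lact_closed:
      "\<lbrakk>b \<in> carrier B; x \<in> carrier M\<rbrakk> \<Longrightarrow> lact M b x \<in> carrier M"
    and lact_add_left:
      "\<lbrakk>b \<in> carrier B; b' \<in> carrier B; x \<in> carrier M\<rbrakk> \<Longrightarrow>
        lact M (b \<oplus>\<^bsub>B\<^esub> b') x = lact M b x \<oplus>\<^bsub>M\<^esub> lact M b' x"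
    and lact_add_right:
      "\<lbrakk>b \<in> carrier B; x \<in> carrier M; y \<in> carrier M\<rbrakk> \<Longrightarrow>
        lact M b (x \<oplus>\<^bsub>M\<^esub> y) = lact M b x \<oplus>\<^bsub>M\<^esub> lact M b y"
    and lact_smult_left:
      "\<lbrakk>c \<in> carrier K; b \<in> carrier B; x \<in> carrier M\<rbrakk> \<Longrightarrow>
        lact M (c \<odot>\<^bsub>B\<^esub> b) x = c \<odot>\<^bsub>M\<^esub> lact M b x"
    and lact_smult_right:
      "\<lbrakk>c \<in> carrier K; b \<in> carrier B; x \<in> carrier M\<rbrakk> \<Longrightarrow>
        lact M b (c \<odot>\<^bsub>M\<^esub> x) = c \<odot>\<^bsub>M\<^esub> lact M b x"
    and lact_mult:
      "\<lbrakk>b \<in> carrier B; b' \<in> carrier B; x \<in> carrier M\<rbrakk> \<Longrightarrow>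
        lact M (b \<otimes>\<^bsub>B\<^esub> b') x = lact M b (lact M b' x)"
    and lact_one: "x \<in> carrier M \<Longrightarrow> lact M \<one>\<^bsub>B\<^esub> x = x"
    and ract_closed:
      "\<lbrakk>b \<in> carrier B; x \<in> carrier M\<rbrakk> \<Longrightarrow> ract M x b \<in> carrier M"
    and ract_add_right:
      "\<lbrakk>b \<in> carrier B; b' \<in> carrier B; x \<in> carrier M\<rbrakk> \<Longrightarrow>
        ract M x (b \<oplus>\<^bsub>B\<^esub> b') = ract M x b \<oplus>\<^bsub>M\<^esub> ract M x b'"
    and ract_add_left:
      "\<lbrakk>b \<in> carrier B; x \<in> carrier M; y \<in> carrier M\<rbrakk> \<Longrightarrow>
        ract M (x \<oplus>\<^bsub>M\<^esub> y) b = ract M x b \<oplus>\<^bsub>M\<^esub> ract M y b"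
    and ract_smult_right:
      "\<lbrakk>c \<in> carrier K; b \<in> carrier B; x \<in> carrier M\<rbrakk> \<Longrightarrow>
        ract M x (c \<odot>\<^bsub>B\<^esub> b) = c \<odot>\<^bsub>M\<^esub> ract M x b"
    and ract_smult_left:
      "\<lbrakk>c \<in> carrier K; b \<in> carrier B; x \<in> carrier M\<rbrakk> \<Longrightarrow>
        ract M (c \<odot>\<^bsub>M\<^esub> x) b = c \<odot>\<^bsub>M\<^esub> ract M x b"
    and ract_mult:
      "\<lbrakk>b \<in> carrier B; b' \<in> carrier B; x \<in> carrier M\<rbrakk> \<Longrightarrow>
        ract M x (b \<otimes>\<^bsub>B\<^esub> b') = ract M (ract M x b) b'"
    and ract_one: "x \<in> carrier M \<Longrightarrow> ract M x \<one>\<^bsub>B\<^esub> = x"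
    and lact_ract:
      "\<lbrakk>b \<in> carrier B; b' \<in> carrier B; x \<in> carrier M\<rbrakk> \<Longrightarrow>
        ract M (lact M b x) b' = lact M b (ract M x b')"

locale graded_bimodule = hopf_group_coalgebra K G A \<Delta> \<epsilon> S
  for K :: "'k ring" and G :: "'g monoid" and A :: "'g \<Rightarrow> ('k, 'a) module"
    and \<Delta> :: "'g \<Rightarrow> 'g \<Rightarrow> 'a \<Rightarrow> ('a \<times> 'a \<Rightarrow> 'k) set"
    and \<epsilon> :: "'a \<Rightarrow> 'k" and S :: "'g \<Rightarrow> 'a \<Rightarrow> 'a" +
  fixes \<Gamma> :: "'g \<Rightarrow> ('k, 'a, 'v) bimodule"
  assumes bimod: "\<alpha> \<in> carrier G \<Longrightarrow> bimodule K (A \<alpha>) (\<Gamma> \<alpha>)"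

text \<open>Componentwise actions of \<open>B \<otimes> C\<close> on \<open>B \<otimes> M\<close> (\<open>M\<close> a \<open>C\<close>-bimodule) and on \<open>M \<otimes> C\<close>
  (\<open>M\<close> a \<open>B\<close>-bimodule).\<close>

definition lact_alg_mod where
  "lact_alg_mod K B C M = tensor_bilinear K B C B M B M (mult B) (lact M)"

definition ract_alg_mod where
  "ract_alg_mod K B C M = tensor_bilinear K B M B C B M (mult B) (ract M)"

definition lact_mod_alg where
  "lact_mod_alg K B C M = tensor_bilinear K B C M C M C (lact M) (mult C)"

definition ract_mod_alg where
  "ract_mod_alg K B C M = tensor_bilinear K M C B C M C (ract M) (mult C)"

locale left_covariant_bimodule = graded_bimodule K G A \<Delta> \<epsilon> S \<Gamma>
  for K :: "'k ring" and G :: "'g monoid" and A :: "'g \<Rightarrow> ('k, 'a) module"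
    and \<Delta> :: "'g \<Rightarrow> 'g \<Rightarrow> 'a \<Rightarrow> ('a \<times> 'a \<Rightarrow> 'k) set"
    and \<epsilon> :: "'a \<Rightarrow> 'k" and S :: "'g \<Rightarrow> 'a \<Rightarrow> 'a"
    and \<Gamma> :: "'g \<Rightarrow> ('k, 'a, 'v) bimodule" +
  fixes \<Delta>l :: "'g \<Rightarrow> 'g \<Rightarrow> 'v \<Rightarrow> ('a \<times> 'v \<Rightarrow> 'k) set"
  assumes left_coact_linear:
      "\<lbrakk>\<alpha> \<in> carrier G; \<beta> \<in> carrier G\<rbrakk> \<Longrightarrow>
        linear_map K (\<Gamma> (\<alpha> \<otimes>\<^bsub>G\<^esub> \<beta>)) (tensor K (A \<alpha>) (\<Gamma> \<beta>)) (\<Delta>l \<alpha> \<beta>)"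
    and left_coact_lact:
      "\<lbrakk>\<alpha> \<in> carrier G; \<beta> \<in> carrier G; a \<in> carrier (A (\<alpha> \<otimes>\<^bsub>G\<^esub> \<beta>));
        \<rho> \<in> carrier (\<Gamma> (\<alpha> \<otimes>\<^bsub>G\<^esub> \<beta>))\<rbrakk> \<Longrightarrow>
        \<Delta>l \<alpha> \<beta> (lact (\<Gamma> (\<alpha> \<otimes>\<^bsub>G\<^esub> \<beta>)) a \<rho>) =
          lact_alg_mod K (A \<alpha>) (A \<beta>) (\<Gamma> \<beta>) (\<Delta> \<alpha> \<beta> a) (\<Delta>l \<alpha> \<beta> \<rho>)"
    and left_coact_ract:
      "\<lbrakk>\<alpha> \<in> carrier G; \<beta> \<in> carrier G; a \<in> carrier (A (\<alpha> \<otimes>\<^bsub>G\<^esub> \<beta>));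
        \<rho> \<in> carrier (\<Gamma> (\<alpha> \<otimes>\<^bsub>G\<^esub> \<beta>))\<rbrakk> \<Longrightarrow>
        \<Delta>l \<alpha> \<beta> (ract (\<Gamma> (\<alpha> \<otimes>\<^bsub>G\<^esub> \<beta>)) \<rho> a) =
          ract_alg_mod K (A \<alpha>) (A \<beta>) (\<Gamma> \<beta>) (\<Delta>l \<alpha> \<beta> \<rho>) (\<Delta> \<alpha> \<beta> a)"
    and left_coact_coassoc:
      "\<lbrakk>\<alpha> \<in> carrier G; \<beta> \<in> carrier G; \<gamma> \<in> carrier G;
        \<rho> \<in> carrier (\<Gamma> (\<alpha> \<otimes>\<^bsub>G\<^esub> \<beta> \<otimes>\<^bsub>G\<^esub> \<gamma>))\<rbrakk> \<Longrightarrow>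
        tensor_assoc K (A \<alpha>) (A \<beta>) (\<Gamma> \<gamma>)
          (tensor_map K (A (\<alpha> \<otimes>\<^bsub>G\<^esub> \<beta>)) (\<Gamma> \<gamma>) (tensor K (A \<alpha>) (A \<beta>)) (\<Gamma> \<gamma>) (\<Delta> \<alpha> \<beta>) (\<lambda>x. x)
            (\<Delta>l (\<alpha> \<otimes>\<^bsub>G\<^esub> \<beta>) \<gamma> \<rho>)) =
        tensor_map K (A \<alpha>) (\<Gamma> (\<beta> \<otimes>\<^bsub>G\<^esub> \<gamma>)) (A \<alpha>) (tensor K (A \<beta>) (\<Gamma> \<gamma>)) (\<lambda>x. x) (\<Delta>l \<beta> \<gamma>)
          (\<Delta>l \<alpha> (\<beta> \<otimes>\<^bsub>G\<^esub> \<gamma>) \<rho>)"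
    and left_coact_counit:
      "\<lbrakk>\<alpha> \<in> carrier G; \<rho> \<in> carrier (\<Gamma> \<alpha>)\<rbrakk> \<Longrightarrow>
        fun_tensor_id K (A \<one>\<^bsub>G\<^esub>) (\<Gamma> \<alpha>) \<epsilon> (\<Delta>l \<one>\<^bsub>G\<^esub> \<alpha> \<rho>) = \<rho>"

locale right_covariant_bimodule = graded_bimodule K G A \<Delta> \<epsilon> S \<Gamma>
  for K :: "'k ring" and G :: "'g monoid" and A :: "'g \<Rightarrow> ('k, 'a) module"
    and \<Delta> :: "'g \<Rightarrow> 'g \<Rightarrow> 'a \<Rightarrow> ('a \<times> 'a \<Rightarrow> 'k) set"
    and \<epsilon> :: "'a \<Rightarrow> 'k" and S :: "'g \<Rightarrow> 'a \<Rightarrow> 'a"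
    and \<Gamma> :: "'g \<Rightarrow> ('k, 'a, 'v) bimodule" +
  fixes \<Delta>r :: "'g \<Rightarrow> 'g \<Rightarrow> 'v \<Rightarrow> ('v \<times> 'a \<Rightarrow> 'k) set"
  assumes right_coact_linear:
      "\<lbrakk>\<alpha> \<in> carrier G; \<beta> \<in> carrier G\<rbrakk> \<Longrightarrow>
        linear_map K (\<Gamma> (\<alpha> \<otimes>\<^bsub>G\<^esub> \<beta>)) (tensor K (\<Gamma> \<alpha>) (A \<beta>)) (\<Delta>r \<alpha> \<beta>)"
    and right_coact_lact:
      "\<lbrakk>\<alpha> \<in> carrier G; \<beta> \<in> carrier G; a \<in> carrier (A (\<alpha> \<otimes>\<^bsub>G\<^esub> \<beta>));
        \<rho> \<in> carrier (\<Gamma> (\<alpha> \<otimes>\<^bsub>G\<^esub> \<beta>))\<rbrakk> \<Longrightarrow>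
        \<Delta>r \<alpha> \<beta> (lact (\<Gamma> (\<alpha> \<otimes>\<^bsub>G\<^esub> \<beta>)) a \<rho>) =
          lact_mod_alg K (A \<alpha>) (A \<beta>) (\<Gamma> \<alpha>) (\<Delta> \<alpha> \<beta> a) (\<Delta>r \<alpha> \<beta> \<rho>)"
    and right_coact_ract:
      "\<lbrakk>\<alpha> \<in> carrier G; \<beta> \<in> carrier G; a \<in> carrier (A (\<alpha> \<otimes>\<^bsub>G\<^esub> \<beta>));
        \<rho> \<in> carrier (\<Gamma> (\<alpha> \<otimes>\<^bsub>G\<^esub> \<beta>))\<rbrakk> \<Longrightarrow>
        \<Delta>r \<alpha> \<beta> (ract (\<Gamma> (\<alpha> \<otimes>\<^bsub>G\<^esub> \<beta>)) \<rho> a) =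
          ract_mod_alg K (A \<alpha>) (A \<beta>) (\<Gamma> \<alpha>) (\<Delta>r \<alpha> \<beta> \<rho>) (\<Delta> \<alpha> \<beta> a)"
    and right_coact_coassoc:
      "\<lbrakk>\<alpha> \<in> carrier G; \<beta> \<in> carrier G; \<gamma> \<in> carrier G;
        \<rho> \<in> carrier (\<Gamma> (\<alpha> \<otimes>\<^bsub>G\<^esub> \<beta> \<otimes>\<^bsub>G\<^esub> \<gamma>))\<rbrakk> \<Longrightarrow>
        tensor_map K (\<Gamma> \<alpha>) (A (\<beta> \<otimes>\<^bsub>G\<^esub> \<gamma>)) (\<Gamma> \<alpha>) (tensor K (A \<beta>) (A \<gamma>)) (\<lambda>x. x) (\<Delta> \<beta> \<gamma>)
          (\<Delta>r \<alpha> (\<beta> \<otimes>\<^bsub>G\<^esub> \<gamma>) \<rho>) =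
        tensor_assoc K (\<Gamma> \<alpha>) (A \<beta>) (A \<gamma>)
          (tensor_map K (\<Gamma> (\<alpha> \<otimes>\<^bsub>G\<^esub> \<beta>)) (A \<gamma>) (tensor K (\<Gamma> \<alpha>) (A \<beta>)) (A \<gamma>) (\<Delta>r \<alpha> \<beta>) (\<lambda>x. x)
            (\<Delta>r (\<alpha> \<otimes>\<^bsub>G\<^esub> \<beta>) \<gamma> \<rho>))"
    and right_coact_counit:
      "\<lbrakk>\<alpha> \<in> carrier G; \<rho> \<in> carrier (\<Gamma> \<alpha>)\<rbrakk> \<Longrightarrow>
        id_tensor_fun K (\<Gamma> \<alpha>) (A \<one>\<^bsub>G\<^esub>) \<epsilon> (\<Delta>r \<alpha> \<one>\<^bsub>G\<^esub> \<rho>) = \<rho>"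

locale bicovariant_bimodule =
  left_covariant_bimodule K G A \<Delta> \<epsilon> S \<Gamma> \<Delta>l + right_covariant_bimodule K G A \<Delta> \<epsilon> S \<Gamma> \<Delta>r
  for K :: "'k ring" and G :: "'g monoid" and A :: "'g \<Rightarrow> ('k, 'a) module"
    and \<Delta> :: "'g \<Rightarrow> 'g \<Rightarrow> 'a \<Rightarrow> ('a \<times> 'a \<Rightarrow> 'k) set"
    and \<epsilon> :: "'a \<Rightarrow> 'k" and S :: "'g \<Rightarrow> 'a \<Rightarrow> 'a"
    and \<Gamma> :: "'g \<Rightarrow> ('k, 'a, 'v) bimodule"
    and \<Delta>l :: "'g \<Rightarrow> 'g \<Rightarrow> 'v \<Rightarrow> ('a \<times> 'v \<Rightarrow> 'k) set"
    and \<Delta>r :: "'g \<Rightarrow> 'g \<Rightarrow> 'v \<Rightarrow> ('v \<times> 'a \<Rightarrow> 'k) set" +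
  assumes coact_compat:
      "\<lbrakk>\<alpha> \<in> carrier G; \<beta> \<in> carrier G; \<gamma> \<in> carrier G;
        \<rho> \<in> carrier (\<Gamma> (\<alpha> \<otimes>\<^bsub>G\<^esub> \<beta> \<otimes>\<^bsub>G\<^esub> \<gamma>))\<rbrakk> \<Longrightarrow>
        tensor_assoc K (A \<alpha>) (\<Gamma> \<beta>) (A \<gamma>)
          (tensor_map K (\<Gamma> (\<alpha> \<otimes>\<^bsub>G\<^esub> \<beta>)) (A \<gamma>) (tensor K (A \<alpha>) (\<Gamma> \<beta>)) (A \<gamma>) (\<Delta>l \<alpha> \<beta>) (\<lambda>x. x)
            (\<Delta>r (\<alpha> \<otimes>\<^bsub>G\<^esub> \<beta>) \<gamma> \<rho>)) =
        tensor_map K (A \<alpha>) (\<Gamma> (\<beta> \<otimes>\<^bsub>G\<^esub> \<gamma>)) (A \<alpha>) (tensor K (\<Gamma> \<beta>) (A \<gamma>)) (\<lambda>x. x) (\<Delta>r \<beta> \<gamma>)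
          (\<Delta>l \<alpha> (\<beta> \<otimes>\<^bsub>G\<^esub> \<gamma>) \<rho>)"


section \<open>The bimodule of a family of functionals and a family of elements\<close>

text \<open>The free left \<open>A \<alpha>\<close>-module on \<open>I\<close>, with the right multiplication
  \<open>(\<Sum>i. a i \<omega> i) b = \<Sum>i j. a i (f i j * b) \<omega> j\<close>. The vector space structure \<open>smult\<close> is the one
  induced from \<open>A \<alpha>\<close>.\<close>

definition free_bimodule ::
  "'k ring \<Rightarrow> 'g monoid \<Rightarrow> ('g \<Rightarrow> ('k, 'a) module) \<Rightarrow> ('g \<Rightarrow> 'g \<Rightarrow> 'a \<Rightarrow> ('a \<times> 'a \<Rightarrow> 'k) set)
    \<Rightarrow> 'i set \<Rightarrow> ('i \<Rightarrow> 'i \<Rightarrow> 'g \<Rightarrow> 'a \<Rightarrow> 'k) \<Rightarrow> 'g \<Rightarrow> ('k, 'a, 'i \<Rightarrow> 'a) bimodule"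
  where "free_bimodule K G A \<Delta> I f \<alpha> =
    (let F = free_module (A \<alpha>) I in
      \<lparr>carrier = carrier F, mult = undefined, one = undefined, zero = \<zero>\<^bsub>F\<^esub>, add = add F,
       smult = (\<lambda>c \<rho>. \<lambda>i\<in>I. c \<odot>\<^bsub>A \<alpha>\<^esub> \<rho> i),
       lact = smult F,
       ract = (\<lambda>\<rho> b. fin_supp_sum F I (\<lambda>i. fin_supp_sum F I (\<lambda>j.
                 (\<rho> i \<otimes>\<^bsub>A \<alpha>\<^esub> fun_conv K G A \<Delta> \<alpha> (f i j) b) \<odot>\<^bsub>F\<^esub> free_basis (A \<alpha>) I j)))\<rparr>)"

definition free_left_coact ::
  "'k ring \<Rightarrow> 'g monoid \<Rightarrow> ('g \<Rightarrow> ('k, 'a) module) \<Rightarrow> ('g \<Rightarrow> 'g \<Rightarrow> 'a \<Rightarrow> ('a \<times> 'a \<Rightarrow> 'k) set)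
    \<Rightarrow> 'i set \<Rightarrow> ('i \<Rightarrow> 'i \<Rightarrow> 'g \<Rightarrow> 'a \<Rightarrow> 'k)
    \<Rightarrow> 'g \<Rightarrow> 'g \<Rightarrow> ('i \<Rightarrow> 'a) \<Rightarrow> ('a \<times> ('i \<Rightarrow> 'a) \<Rightarrow> 'k) set"
  where "free_left_coact K G A \<Delta> I f \<alpha> \<beta> \<rho> =
    (let \<Gamma> = free_bimodule K G A \<Delta> I f in
      fin_supp_sum (tensor K (A \<alpha>) (\<Gamma> \<beta>)) I (\<lambda>i.
        lact_alg_mod K (A \<alpha>) (A \<beta>) (\<Gamma> \<beta>) (\<Delta> \<alpha> \<beta> (\<rho> i))
          (pure_tensor K (A \<alpha>) (\<Gamma> \<beta>) \<one>\<^bsub>A \<alpha>\<^esub> (free_basis (A \<beta>) I i))))"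

definition free_right_coact ::
  "'k ring \<Rightarrow> 'g monoid \<Rightarrow> ('g \<Rightarrow> ('k, 'a) module) \<Rightarrow> ('g \<Rightarrow> 'g \<Rightarrow> 'a \<Rightarrow> ('a \<times> 'a \<Rightarrow> 'k) set)
    \<Rightarrow> 'i set \<Rightarrow> ('i \<Rightarrow> 'i \<Rightarrow> 'g \<Rightarrow> 'a \<Rightarrow> 'k) \<Rightarrow> ('g \<Rightarrow> 'i \<Rightarrow> 'i \<Rightarrow> 'a)
    \<Rightarrow> 'g \<Rightarrow> 'g \<Rightarrow> ('i \<Rightarrow> 'a) \<Rightarrow> (('i \<Rightarrow> 'a) \<times> 'a \<Rightarrow> 'k) set"
  where "free_right_coact K G A \<Delta> I f R \<alpha> \<beta> \<rho> =
    (let \<Gamma> = free_bimodule K G A \<Delta> I f; T = tensor K (\<Gamma> \<alpha>) (A \<beta>) in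
      fin_supp_sum T I (\<lambda>i. fin_supp_sum T I (\<lambda>j.
        lact_mod_alg K (A \<alpha>) (A \<beta>) (\<Gamma> \<alpha>) (\<Delta> \<alpha> \<beta> (\<rho> i))
          (pure_tensor K (\<Gamma> \<alpha>) (A \<beta>) (free_basis (A \<alpha>) I j) (R \<beta> j i)))))"

end

theory Submission
  imports Defs
begin

text \<open>Write \<open>\<iota> i a = a \<omega> i\<close>. A linear map out of the free bimodule is determined by its values on the
  elements \<open>\<iota> i a\<close>, and on these the coactions are \<open>(id \<otimes> \<iota> i) (\<Delta> a)\<close> and
  \<open>\<Sum>j. (\<iota> j \<otimes> (\<cdot> R j i)) (\<Delta> a)\<close>. Every axiom thereby becomes an identity between linear maps
  evaluated at iterated coproducts, which coassociativity of \<open>\<Delta>\<close> reduces to an identity that can be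
  checked on pure tensors. Compatibility with the right action uses
  \<open>\<Delta> (f * b) = (id \<otimes> (f * \<cdot>)) (\<Delta> b)\<close>; for the right coaction the relation between \<open>f\<close> and \<open>R\<close>
  replaces \<open>f * \<cdot>\<close> by \<open>\<cdot> * f\<close> in the second tensor factor, and coassociativity moves the latter to
  \<open>f * \<cdot>\<close> in the first.\<close>

section \<open>Linear and bilinear maps\<close>

text \<open>Tensors are cosets and a coproduct is in general not a pure tensor, so nested
  expressions such as an associator applied to a tensor map of a coproduct cannot simply be
  computed. Each layer is first evaluated on an arbitrary tensor, by comparing two linear maps on
  pure tensors, and only then specialised to a coproduct; the price is a linearity proof for each
  side of every comparison. The second obstacle is a possibly infinite index set. A sum runs over
  the support of its terms, and this support changes with the argument. Even linearity of a sum
  requires finite supports, and interchanging two sums requires a finite rectangle that contains all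
  nonzero terms. The finiteness hypotheses give it in chains: \<open>f\<close> with first index i
  leaves finitely many second indices, \<open>R\<close> with second index i leaves finitely many
  first indices, and each of these new indices starts the next step.\<close>

lemma linear_mapI:
  assumes "\<And>x. x \<in> carrier V \<Longrightarrow> f x \<in> carrier W"
    and "\<And>x y. \<lbrakk>x \<in> carrier V; y \<in> carrier V\<rbrakk> \<Longrightarrow> f (x \<oplus>\<^bsub>V\<^esub> y) = f x \<oplus>\<^bsub>W\<^esub> f y"
    and "\<And>c x. \<lbrakk>c \<in> carrier K; x \<in> carrier V\<rbrakk> \<Longrightarrow> f (c \<odot>\<^bsub>V\<^esub> x) = c \<odot>\<^bsub>W\<^esub> f x"
  shows "linear_map K V W f"
  using assms by (auto simp: linear_map_def)

lemma linear_map_closed: "\<lbrakk>linear_map K V W f; x \<in> carrier V\<rbrakk> \<Longrightarrow> f x \<in> carrier W"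
  by (auto simp: linear_map_def)

lemma linear_map_add:
  "\<lbrakk>linear_map K V W f; x \<in> carrier V; y \<in> carrier V\<rbrakk> \<Longrightarrow> f (x \<oplus>\<^bsub>V\<^esub> y) = f x \<oplus>\<^bsub>W\<^esub> f y"
  by (auto simp: linear_map_def)

lemma linear_map_smult:
  "\<lbrakk>linear_map K V W f; c \<in> carrier K; x \<in> carrier V\<rbrakk> \<Longrightarrow> f (c \<odot>\<^bsub>V\<^esub> x) = c \<odot>\<^bsub>W\<^esub> f x"
  by (auto simp: linear_map_def)

lemma linear_map_zero:
  assumes "module K V" "module K W" "linear_map K V W f"
  shows "f \<zero>\<^bsub>V\<^esub> = \<zero>\<^bsub>W\<^esub>"
proof -
  interpret V: module K V by fact
  interpret W: module K W by fact
  have "f (\<zero>\<^bsub>K\<^esub> \<odot>\<^bsub>V\<^esub> \<zero>\<^bsub>V\<^esub>) = \<zero>\<^bsub>K\<^esub> \<odot>\<^bsub>W\<^esub> f \<zero>\<^bsub>V\<^esub>"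
    using assms(3) by (intro linear_map_smult) auto
  then show ?thesis
    using linear_map_closed[OF assms(3)] by simp
qed

lemma linear_map_minus:
  assumes "module K V" "module K W" "linear_map K V W f" "x \<in> carrier V"
  shows "f (\<ominus>\<^bsub>V\<^esub> x) = \<ominus>\<^bsub>W\<^esub> f x"
proof -
  interpret V: module K V by fact
  interpret W: module K W by fact
  have "f (\<ominus>\<^bsub>V\<^esub> x) \<oplus>\<^bsub>W\<^esub> f x = \<zero>\<^bsub>W\<^esub>"
    using linear_map_add[OF assms(3), of "\<ominus>\<^bsub>V\<^esub> x" x] linear_map_zero[OF assms(1-3)] assms(4)
    by (simp add: V.M.l_neg)
  then show ?thesis
    using assms(4) linear_map_closed[OF assms(3)] by (simp add: W.M.minus_equality)
qed

text \<open>Over an infinite \<open>B\<close> both sums are zero by convention, and a linear map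
  sends zero to zero, so the induction covers that case as well.\<close>

lemma linear_map_finsum:
  assumes "module K V" "module K W" "linear_map K V W f" "t \<in> B \<rightarrow> carrier V"
  shows "f (finsum V t B) = finsum W (\<lambda>i. f (t i)) B"
proof -
  interpret V: module K V by fact
  interpret W: module K W by fact
  show ?thesis
    using assms(4)
  proof (induction B rule: infinite_finite_induct)
    case (insert a B)
    then show ?case
      using linear_map_closed[OF assms(3)]
      by (simp add: Pi_iff linear_map_add[OF assms(3)])
  qed (simp_all add: linear_map_zero[OF assms(1-3)])
qed

lemma linear_map_id: "linear_map K V V (\<lambda>x. x)"
  by (auto simp: linear_map_def)

lemma linear_map_comp:
  "\<lbrakk>linear_map K W U f; linear_map K V W g\<rbrakk> \<Longrightarrow> linear_map K V U (\<lambda>x. f (g x))"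
  by (rule linear_mapI) (simp_all add: linear_map_closed linear_map_add linear_map_smult)

lemma linear_map_cong:
  assumes "module K V" "linear_map K V W g" "\<And>x. x \<in> carrier V \<Longrightarrow> f' x = g x"
  shows "linear_map K V W f'"
proof -
  interpret V: module K V by fact
  show ?thesis using assms(2,3) by (simp add: linear_map_def Pi_iff)
qed

lemma linear_map_zero_fun:
  assumes "module K V" "module K W"
  shows "linear_map K V W (\<lambda>x. \<zero>\<^bsub>W\<^esub>)"
proof -
  interpret W: module K W by fact
  show ?thesis by (intro linear_mapI) auto
qed

lemma linear_map_add_fun:
  assumes "module K V" "module K W" "linear_map K V W f" "linear_map K V W g"
  shows "linear_map K V W (\<lambda>x. f x \<oplus>\<^bsub>W\<^esub> g x)"
proof -
  interpret V: module K V by fact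
  interpret W: module K W by fact
  note [simp] = linear_map_closed[OF assms(3)] linear_map_closed[OF assms(4)]
  show ?thesis
    by (intro linear_mapI)
      (auto simp: linear_map_add[OF assms(3)] linear_map_add[OF assms(4)] W.M.a_ac W.smult_r_distr
        linear_map_smult[OF assms(3)] linear_map_smult[OF assms(4)])
qed

lemma linear_map_smult_fun:
  assumes "module K V" "module K W" "linear_map K V W f" "c \<in> carrier K"
  shows "linear_map K V W (\<lambda>x. c \<odot>\<^bsub>W\<^esub> f x)"
proof -
  interpret W: module K W by fact
  note [simp] = linear_map_closed[OF assms(3)]
  \<comment> \<open>Multiplication by \<open>c\<close> respects scalars because the base ring is
    commutative.\<close>
  have "c \<odot>\<^bsub>W\<^esub> (d \<odot>\<^bsub>W\<^esub> x) = d \<odot>\<^bsub>W\<^esub> (c \<odot>\<^bsub>W\<^esub> x)" if "d \<in> carrier K" "x \<in> carrier W" for d x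
    using that assms(4) by (simp add: W.smult_assoc1[symmetric] W.R.m_comm)
  then show ?thesis
    using assms(4)
    by (intro linear_mapI)
      (auto simp: linear_map_add[OF assms(3)] linear_map_smult[OF assms(3)] W.smult_r_distr)
qed

lemma linear_map_smult_left:
  assumes "module K V" "linear_map K Z (ground K) g" "v \<in> carrier V"
  shows "linear_map K Z V (\<lambda>z. g z \<odot>\<^bsub>V\<^esub> v)"
proof -
  interpret V: module K V by fact
  show ?thesis
    using assms(2,3) by (auto simp: linear_map_def Pi_iff ground_def V.smult_l_distr V.smult_assoc1)
qed

lemma linear_map_smult_right:
  "\<lbrakk>module K V; c \<in> carrier K\<rbrakk> \<Longrightarrow> linear_map K V V (\<lambda>v. c \<odot>\<^bsub>V\<^esub> v)"
  by (rule linear_map_smult_fun) (auto intro: linear_map_id)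

text \<open>Both slots are phrased through \<open>linear_map\<close>, so that closure, zero, finite
  sums and composition carry over to each slot without separate proofs.\<close>

definition bilinear_map ::
  "('k, 'r) ring_scheme \<Rightarrow> ('k, 'a, 'm) module_scheme \<Rightarrow> ('k, 'b, 'n) module_scheme
    \<Rightarrow> ('k, 'c, 'o) module_scheme \<Rightarrow> ('a \<Rightarrow> 'b \<Rightarrow> 'c) \<Rightarrow> bool"
  where "bilinear_map K V W U \<phi> \<longleftrightarrow>
    (\<forall>w \<in> carrier W. linear_map K V U (\<lambda>v. \<phi> v w)) \<and> (\<forall>v \<in> carrier V. linear_map K W U (\<phi> v))"

lemma bilinear_mapI:
  assumes "\<And>w. w \<in> carrier W \<Longrightarrow> linear_map K V U (\<lambda>v. \<phi> v w)"
    and "\<And>v. v \<in> carrier V \<Longrightarrow> linear_map K W U (\<phi> v)"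
  shows "bilinear_map K V W U \<phi>"
  using assms by (simp add: bilinear_map_def)

text \<open>Serves operations whose convenient formula holds on the carriers only, such as
  \<open>ract\<close> through \<open>ract_eq\<close>.\<close>

lemma bilinear_map_cong:
  assumes "\<And>v w. \<lbrakk>v \<in> carrier V; w \<in> carrier W\<rbrakk> \<Longrightarrow> \<phi> v w = \<psi> v w"
    and "module K V" "module K W" "bilinear_map K V W U \<psi>"
  shows "bilinear_map K V W U \<phi>"
proof -
  interpret V: module K V by fact
  interpret W: module K W by fact
  show ?thesis using assms(1,4) by (simp add: bilinear_map_def linear_map_def Pi_iff)
qed

lemma bilinear_map_left: "\<lbrakk>bilinear_map K V W U \<phi>; w \<in> carrier W\<rbrakk> \<Longrightarrow> linear_map K V U (\<lambda>v. \<phi> v w)"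
  by (simp add: bilinear_map_def)

lemma bilinear_map_right: "\<lbrakk>bilinear_map K V W U \<phi>; v \<in> carrier V\<rbrakk> \<Longrightarrow> linear_map K W U (\<phi> v)"
  by (simp add: bilinear_map_def)

lemma bilinear_map_closed:
  "\<lbrakk>bilinear_map K V W U \<phi>; v \<in> carrier V; w \<in> carrier W\<rbrakk> \<Longrightarrow> \<phi> v w \<in> carrier U"
  by (simp add: bilinear_map_def linear_map_def Pi_iff)

section \<open>Finitely supported sums\<close>

text \<open>The support depends on \<open>t\<close>; any finite set containing it may replace it,
  which brings sums with different supports under one index set.\<close>

lemma fin_supp_sum_eq:
  assumes "module K M" "t \<in> I \<rightarrow> carrier M" "finite B" "B \<subseteq> I" "\<And>i. i \<in> I - B \<Longrightarrow> t i = \<zero>\<^bsub>M\<^esub>"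
  shows "fin_supp_sum M I t = finsum M t B"
proof -
  interpret M: module K M by fact
  show ?thesis
    unfolding fin_supp_sum_def
  proof (rule M.M.add.finprod_mono_neutral_cong_left)
    show "t i = \<zero>\<^bsub>M\<^esub>" if "i \<in> B - {i \<in> I. t i \<noteq> \<zero>\<^bsub>M\<^esub>}" for i
      using that assms(4) by auto
    show "t \<in> B \<rightarrow> carrier M" using assms(2,4) by auto
  qed (use assms in auto)
qed

lemma fin_supp_sum_closed:
  assumes "module K M" "t \<in> I \<rightarrow> carrier M"
  shows "fin_supp_sum M I t \<in> carrier M"
proof -
  interpret M: module K M by fact
  show ?thesis unfolding fin_supp_sum_def using assms(2) by (intro M.M.finsum_closed) auto
qed

lemma fin_supp_sum_cong:
  assumes "module K M" "t' \<in> I \<rightarrow> carrier M" "\<And>i. i \<in> I \<Longrightarrow> t i = t' i"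
  shows "fin_supp_sum M I t = fin_supp_sum M I t'"
proof -
  interpret M: module K M by fact
  have "{i \<in> I. t i \<noteq> \<zero>\<^bsub>M\<^esub>} = {i \<in> I. t' i \<noteq> \<zero>\<^bsub>M\<^esub>}" using assms(3) by auto
  then show ?thesis
    unfolding fin_supp_sum_def using assms(2,3) by (intro M.M.finsum_cong') auto
qed

lemma fin_supp_sum_zero:
  assumes "module K M" "\<And>i. i \<in> I \<Longrightarrow> t i = \<zero>\<^bsub>M\<^esub>"
  shows "fin_supp_sum M I t = \<zero>\<^bsub>M\<^esub>"
proof -
  interpret M: module K M by fact
  have "{i \<in> I. t i \<noteq> \<zero>\<^bsub>M\<^esub>} = {}" using assms(2) by blast
  then show ?thesis by (simp only: fin_supp_sum_def M.M.finsum_empty)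
qed

lemma fin_supp_sum_delta:
  assumes "module K M" "k \<in> I" "t k \<in> carrier M" "\<And>i. \<lbrakk>i \<in> I; i \<noteq> k\<rbrakk> \<Longrightarrow> t i = \<zero>\<^bsub>M\<^esub>"
  shows "fin_supp_sum M I t = t k"
proof -
  interpret M: module K M by fact
  have "t i \<in> carrier M" if "i \<in> I" for i
    using that assms(3,4) by (cases "i = k") auto
  then have "fin_supp_sum M I t = finsum M t {k}"
    using assms by (intro fin_supp_sum_eq) auto
  then show ?thesis using assms(3) by simp
qed

lemma fin_supp_sum_add:
  assumes "module K M" "t \<in> I \<rightarrow> carrier M" "t' \<in> I \<rightarrow> carrier M"
    and "finite {i \<in> I. t i \<noteq> \<zero>\<^bsub>M\<^esub>}" "finite {i \<in> I. t' i \<noteq> \<zero>\<^bsub>M\<^esub>}"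
  shows "fin_supp_sum M I (\<lambda>i. t i \<oplus>\<^bsub>M\<^esub> t' i) = fin_supp_sum M I t \<oplus>\<^bsub>M\<^esub> fin_supp_sum M I t'"
proof -
  interpret M: module K M by fact
  \<comment> \<open>The three supports differ in general, since terms can cancel; the union serves
    for all of them.\<close>
  define B where "B = {i \<in> I. t i \<noteq> \<zero>\<^bsub>M\<^esub>} \<union> {i \<in> I. t' i \<noteq> \<zero>\<^bsub>M\<^esub>}"
  have B: "finite B" "B \<subseteq> I" using assms by (auto simp: B_def)
  have z: "t i = \<zero>\<^bsub>M\<^esub>" "t' i = \<zero>\<^bsub>M\<^esub>" if "i \<in> I - B" for i using that by (auto simp: B_def)
  note eq = fin_supp_sum_eq[OF assms(1) _ B]
  have "fin_supp_sum M I (\<lambda>i. t i \<oplus>\<^bsub>M\<^esub> t' i) = finsum M (\<lambda>i. t i \<oplus>\<^bsub>M\<^esub> t' i) B"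
    by (rule eq) (use assms(2,3) z in auto)
  also have "\<dots> = finsum M t B \<oplus>\<^bsub>M\<^esub> finsum M t' B"
    using assms(2,3) B by (intro M.M.finsum_addf) auto
  also have "\<dots> = fin_supp_sum M I t \<oplus>\<^bsub>M\<^esub> fin_supp_sum M I t'"
    using eq[OF assms(2) z(1)] eq[OF assms(3) z(2)] by simp
  finally show ?thesis .
qed

text \<open>\<open>f\<close> may kill terms, so the support on the right can be smaller; the support
  of \<open>t\<close> serves on both sides. Its finiteness matters: with an infinite support the sum
  on the left would be zero by convention, while the one on the right could be finite and
  nonzero.\<close>

lemma linear_map_fin_supp_sum:
  assumes "module K V" "module K W" "linear_map K V W f" "t \<in> I \<rightarrow> carrier V"
    and "finite {i \<in> I. t i \<noteq> \<zero>\<^bsub>V\<^esub>}"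
  shows "f (fin_supp_sum V I t) = fin_supp_sum W I (\<lambda>i. f (t i))"
proof -
  define B where "B = {i \<in> I. t i \<noteq> \<zero>\<^bsub>V\<^esub>}"
  have B: "finite B" "B \<subseteq> I" "\<And>i. i \<in> I - B \<Longrightarrow> t i = \<zero>\<^bsub>V\<^esub>" using assms by (auto simp: B_def)
  have "f (fin_supp_sum V I t) = f (finsum V t B)"
    using assms B by (subst fin_supp_sum_eq[OF assms(1) _ B]) auto
  also have "\<dots> = finsum W (\<lambda>i. f (t i)) B"
    using assms B by (intro linear_map_finsum[OF assms(1-3)]) auto
  also have "\<dots> = fin_supp_sum W I (\<lambda>i. f (t i))"
    using assms B linear_map_closed[OF assms(3)] linear_map_zero[OF assms(1-3)]
    by (intro fin_supp_sum_eq[symmetric]) auto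
  finally show ?thesis .
qed

text \<open>The supports may vary with \<open>v\<close> without a common finite bound. Pointwise
  finiteness is enough because additivity compares only two arguments at a time.\<close>

lemma linear_map_fin_supp_sum_fun:
  assumes "module K V" "module K W" "\<And>i. i \<in> I \<Longrightarrow> linear_map K V W (g i)"
    and "\<And>v. v \<in> carrier V \<Longrightarrow> finite {i \<in> I. g i v \<noteq> \<zero>\<^bsub>W\<^esub>}"
  shows "linear_map K V W (\<lambda>v. fin_supp_sum W I (\<lambda>i. g i v))"
proof (rule linear_mapI)
  interpret V: module K V by fact
  interpret W: module K W by fact
  have closed: "(\<lambda>i. g i v) \<in> I \<rightarrow> carrier W" if "v \<in> carrier V" for v
    using linear_map_closed[OF assms(3) that] by auto
  show "fin_supp_sum W I (\<lambda>i. g i v) \<in> carrier W" if "v \<in> carrier V" for v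
    using closed that assms(2) by (intro fin_supp_sum_closed) auto
  show "fin_supp_sum W I (\<lambda>i. g i (v \<oplus>\<^bsub>V\<^esub> v')) =
      fin_supp_sum W I (\<lambda>i. g i v) \<oplus>\<^bsub>W\<^esub> fin_supp_sum W I (\<lambda>i. g i v')"
    if v: "v \<in> carrier V" "v' \<in> carrier V" for v v'
  proof -
    have "fin_supp_sum W I (\<lambda>i. g i (v \<oplus>\<^bsub>V\<^esub> v')) = fin_supp_sum W I (\<lambda>i. g i v \<oplus>\<^bsub>W\<^esub> g i v')"
      using v closed[of v] closed[of v'] linear_map_add[OF assms(3)]
      by (intro fin_supp_sum_cong[OF assms(2)]) auto
    also have "\<dots> = fin_supp_sum W I (\<lambda>i. g i v) \<oplus>\<^bsub>W\<^esub> fin_supp_sum W I (\<lambda>i. g i v')"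
      using v closed assms(4) by (intro fin_supp_sum_add[OF assms(2)]) auto
    finally show ?thesis .
  qed
  show "fin_supp_sum W I (\<lambda>i. g i (c \<odot>\<^bsub>V\<^esub> v)) = c \<odot>\<^bsub>W\<^esub> fin_supp_sum W I (\<lambda>i. g i v)"
    if c: "c \<in> carrier K" "v \<in> carrier V" for c v
  proof -
    have "c \<odot>\<^bsub>W\<^esub> fin_supp_sum W I (\<lambda>i. g i v) = fin_supp_sum W I (\<lambda>i. c \<odot>\<^bsub>W\<^esub> g i v)"
      using c closed assms(4)
      by (intro linear_map_fin_supp_sum[OF assms(2,2) linear_map_smult_right[OF assms(2)]]) auto
    also have "\<dots> = fin_supp_sum W I (\<lambda>i. g i (c \<odot>\<^bsub>V\<^esub> v))"
      using c closed[of "c \<odot>\<^bsub>V\<^esub> v"] linear_map_smult[OF assms(3)]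
      by (intro fin_supp_sum_cong[OF assms(2)]) auto
    finally show ?thesis by simp
  qed
qed

lemma finsum_swap:
  assumes "module K M" "finite B" "finite C" "\<And>i j. \<lbrakk>i \<in> B; j \<in> C\<rbrakk> \<Longrightarrow> t i j \<in> carrier M"
  shows "finsum M (\<lambda>i. finsum M (t i) C) B = finsum M (\<lambda>j. finsum M (\<lambda>i. t i j) B) C"
proof -
  interpret M: module K M by fact
  show ?thesis
    using assms(2,4)
  proof (induction B)
    case (insert b B)
    have "finsum M (\<lambda>i. finsum M (t i) C) (insert b B) =
        finsum M (t b) C \<oplus>\<^bsub>M\<^esub> finsum M (\<lambda>i. finsum M (t i) C) B"
      using insert by (intro M.M.finsum_insert) auto
    also have "\<dots> = finsum M (t b) C \<oplus>\<^bsub>M\<^esub> finsum M (\<lambda>j. finsum M (\<lambda>i. t i j) B) C"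
      using insert by simp
    also have "\<dots> = finsum M (\<lambda>j. t b j \<oplus>\<^bsub>M\<^esub> finsum M (\<lambda>i. t i j) B) C"
      using insert by (intro M.M.finsum_addf[symmetric]) auto
    also have "\<dots> = finsum M (\<lambda>j. finsum M (\<lambda>i. t i j) (insert b B)) C"
      using insert by (intro M.M.finsum_cong') auto
    finally show ?case .
  qed (simp add: M.M.finsum_zero)
qed

text \<open>Finite rows and columns would not be enough: with t(n,n) = 1 and t(n,n+1) = -1 on the
  natural numbers every row sums to 0, whereas the first column sums to 1. A finite rectangle
  outside which all terms vanish excludes this.\<close>

lemma fin_supp_sum_swap:
  assumes M: "module K M" and t: "\<And>i j. \<lbrakk>i \<in> I; j \<in> I\<rbrakk> \<Longrightarrow> t i j \<in> carrier M"
    and fin: "finite B" "finite C"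
    and z: "\<And>i j. \<lbrakk>i \<in> I; j \<in> I; i \<notin> B \<or> j \<notin> C\<rbrakk> \<Longrightarrow> t i j = \<zero>\<^bsub>M\<^esub>"
  shows "fin_supp_sum M I (\<lambda>i. fin_supp_sum M I (t i)) =
    fin_supp_sum M I (\<lambda>j. fin_supp_sum M I (\<lambda>i. t i j))"
proof -
  interpret M: module K M by fact
  \<comment> \<open>\<open>B\<close> and \<open>C\<close> are mere bounds and may leave
    \<open>I\<close>.\<close>
  let ?B = "B \<inter> I" and ?C = "C \<inter> I"
  have "fin_supp_sum M I (t i) = finsum M (t i) ?C" if "i \<in> I" for i
    using that t z fin by (intro fin_supp_sum_eq[OF M]) auto
  then have "fin_supp_sum M I (\<lambda>i. fin_supp_sum M I (t i)) = fin_supp_sum M I (\<lambda>i. finsum M (t i) ?C)"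
    using t by (intro fin_supp_sum_cong[OF M]) auto
  also have "\<dots> = finsum M (\<lambda>i. finsum M (t i) ?C) ?B"
    using t z fin by (intro fin_supp_sum_eq[OF M]) (auto intro!: M.M.add.finprod_one_eqI)
  also have "\<dots> = finsum M (\<lambda>j. finsum M (\<lambda>i. t i j) ?B) ?C"
    using fin t by (intro finsum_swap[OF M]) auto
  also have "\<dots> = fin_supp_sum M I (\<lambda>j. finsum M (\<lambda>i. t i j) ?B)"
    using t z fin by (intro fin_supp_sum_eq[OF M, symmetric]) (auto intro!: M.M.add.finprod_one_eqI)
  also have "\<dots> = fin_supp_sum M I (\<lambda>j. fin_supp_sum M I (\<lambda>i. t i j))"
  proof (rule fin_supp_sum_cong[OF M])
    show "finsum M (\<lambda>i. t i j) ?B = fin_supp_sum M I (\<lambda>i. t i j)" if "j \<in> I" for j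
      using that t z fin by (intro fin_supp_sum_eq[OF M, symmetric]) auto
    show "(\<lambda>j. fin_supp_sum M I (\<lambda>i. t i j)) \<in> I \<rightarrow> carrier M"
      using t by (auto intro!: fin_supp_sum_closed[OF M])
  qed
  finally show ?thesis .
qed

section \<open>Free modules\<close>

lemma free_module_mem_iff:
  "x \<in> carrier (free_module R X) \<longleftrightarrow>
    x \<in> extensional X \<and> (\<forall>s \<in> X. x s \<in> carrier R) \<and> finite {s \<in> X. x s \<noteq> \<zero>\<^bsub>R\<^esub>}"
  unfolding free_module_def partial_object.simps PiE_iff mem_Collect_eq by blast

lemma free_module_add: "x \<oplus>\<^bsub>free_module R X\<^esub> y = (\<lambda>s\<in>X. x s \<oplus>\<^bsub>R\<^esub> y s)"
  by (simp add: free_module_def)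

lemma free_module_zero: "\<zero>\<^bsub>free_module R X\<^esub> = (\<lambda>s\<in>X. \<zero>\<^bsub>R\<^esub>)"
  by (simp add: free_module_def)

lemma free_module_smult: "r \<odot>\<^bsub>free_module R X\<^esub> x = (\<lambda>s\<in>X. r \<otimes>\<^bsub>R\<^esub> x s)"
  by (simp add: free_module_def)

lemma free_module_memI:
  assumes "\<And>s. s \<in> X \<Longrightarrow> t s \<in> carrier R" "finite B" "\<And>s. s \<in> X - B \<Longrightarrow> t s = \<zero>\<^bsub>R\<^esub>"
  shows "(\<lambda>s\<in>X. t s) \<in> carrier (free_module R X)"
proof -
  have "{s \<in> X. (\<lambda>s\<in>X. t s) s \<noteq> \<zero>\<^bsub>R\<^esub>} \<subseteq> B" using assms(3) by auto
  then have "finite {s \<in> X. (\<lambda>s\<in>X. t s) s \<noteq> \<zero>\<^bsub>R\<^esub>}" using assms(2) by (rule finite_subset)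
  then show ?thesis using assms(1) unfolding free_module_mem_iff by simp
qed

text \<open>Stated for an arbitrary ring because the coefficients will later lie in
  \<open>A s\<close>, which may be noncommutative, whereas the locale \<open>module\<close> asks for
  a commutative ring.\<close>

lemma free_module_abelian_group:
  assumes "ring R"
  shows "abelian_group (free_module R X)"
proof -
  interpret R: ring R by fact
  let ?F = "free_module R X"
  let ?supp = "\<lambda>x. {s \<in> X. x s \<noteq> \<zero>\<^bsub>R\<^esub>}"
  show ?thesis
  proof (rule abelian_groupI)
    fix x y assume "x \<in> carrier ?F" "y \<in> carrier ?F"
    then show "x \<oplus>\<^bsub>?F\<^esub> y \<in> carrier ?F" unfolding free_module_add
      by (intro free_module_memI[where B = "?supp x \<union> ?supp y"]) (auto simp: free_module_mem_iff)
  next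
    fix x assume x: "x \<in> carrier ?F"
    let ?y = "\<lambda>s\<in>X. \<ominus>\<^bsub>R\<^esub> x s"
    have "?y \<in> carrier ?F"
      using x by (intro free_module_memI[where B = "?supp x"]) (auto simp: free_module_mem_iff)
    moreover have "?y \<oplus>\<^bsub>?F\<^esub> x = \<zero>\<^bsub>?F\<^esub>"
      using x by (auto simp: free_module_mem_iff free_module_add free_module_zero fun_eq_iff R.l_neg)
    ultimately show "\<exists>y\<in>carrier ?F. y \<oplus>\<^bsub>?F\<^esub> x = \<zero>\<^bsub>?F\<^esub>" by blast
  next
    fix x y z assume "x \<in> carrier ?F" "y \<in> carrier ?F" "z \<in> carrier ?F"
    then show "x \<oplus>\<^bsub>?F\<^esub> y \<oplus>\<^bsub>?F\<^esub> z = x \<oplus>\<^bsub>?F\<^esub> (y \<oplus>\<^bsub>?F\<^esub> z)"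
      by (auto simp: free_module_mem_iff free_module_add fun_eq_iff R.a_assoc)
  next
    fix x y assume "x \<in> carrier ?F" "y \<in> carrier ?F"
    then show "x \<oplus>\<^bsub>?F\<^esub> y = y \<oplus>\<^bsub>?F\<^esub> x"
      by (auto simp: free_module_mem_iff free_module_add fun_eq_iff R.a_comm)
  next
    fix x assume "x \<in> carrier ?F"
    then show "\<zero>\<^bsub>?F\<^esub> \<oplus>\<^bsub>?F\<^esub> x = x"
      by (auto simp: free_module_mem_iff free_module_add free_module_zero fun_eq_iff extensional_def)
  next
    show "\<zero>\<^bsub>?F\<^esub> \<in> carrier ?F" unfolding free_module_zero
      by (rule free_module_memI[where B = "{}"]) auto
  qed
qed

lemma free_module_smult_closed:
  assumes "ring R" "r \<in> carrier R" "x \<in> carrier (free_module R X)"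
  shows "r \<odot>\<^bsub>free_module R X\<^esub> x \<in> carrier (free_module R X)"
proof -
  interpret R: ring R by fact
  show ?thesis
    using assms(2,3) unfolding free_module_smult
    by (intro free_module_memI[where B = "{s \<in> X. x s \<noteq> \<zero>\<^bsub>R\<^esub>}"]) (auto simp: free_module_mem_iff)
qed

lemma free_module_module:
  assumes "cring K"
  shows "module K (free_module K X)"
proof -
  let ?F = "free_module K X"
  interpret K: cring K by fact
  note simps = free_module_add free_module_smult free_module_mem_iff fun_eq_iff
  show ?thesis
  proof (rule moduleI)
    show "abelian_group (?F)"
      by (rule free_module_abelian_group) (rule K.ring_axioms)
  next
    fix a x assume "a \<in> carrier K" "x \<in> carrier (?F)"
    then show "a \<odot>\<^bsub>?F\<^esub> x \<in> carrier (?F)"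
      by (rule free_module_smult_closed[OF K.ring_axioms])
  next
    fix a b x assume "a \<in> carrier K" "b \<in> carrier K" "x \<in> carrier (?F)"
    then show "(a \<oplus>\<^bsub>K\<^esub> b) \<odot>\<^bsub>?F\<^esub> x = a \<odot>\<^bsub>?F\<^esub> x \<oplus>\<^bsub>?F\<^esub> b \<odot>\<^bsub>?F\<^esub> x"
      and "(a \<otimes>\<^bsub>K\<^esub> b) \<odot>\<^bsub>?F\<^esub> x = a \<odot>\<^bsub>?F\<^esub> (b \<odot>\<^bsub>?F\<^esub> x)"
      by (auto simp: simps K.l_distr K.m_assoc)
  next
    fix a x y assume "a \<in> carrier K" "x \<in> carrier (?F)" "y \<in> carrier (?F)"
    then show "a \<odot>\<^bsub>?F\<^esub> (x \<oplus>\<^bsub>?F\<^esub> y) = a \<odot>\<^bsub>?F\<^esub> x \<oplus>\<^bsub>?F\<^esub> a \<odot>\<^bsub>?F\<^esub> y"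
      by (auto simp: simps K.r_distr)
  next
    fix x assume "x \<in> carrier (?F)"
    then show "\<one>\<^bsub>K\<^esub> \<odot>\<^bsub>?F\<^esub> x = x"
      by (auto simp: simps extensional_def)
  qed (fact assms)
qed

text \<open>The inclusion of the \<open>s\<close>-th summand. With the coefficient as an argument it
  becomes a linear map, which a basis vector alone is not.\<close>

definition single :: "('r, 'm) ring_scheme \<Rightarrow> 's set \<Rightarrow> 's \<Rightarrow> 'r \<Rightarrow> 's \<Rightarrow> 'r" where
  "single R X s r = (\<lambda>t\<in>X. if t = s then r else \<zero>\<^bsub>R\<^esub>)"

lemma free_basis_eq_single: "free_basis R X s = single R X s \<one>\<^bsub>R\<^esub>"
  by (simp add: free_basis_def single_def)

lemma single_closed:
  assumes "ring R" "r \<in> carrier R"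
  shows "single R X s r \<in> carrier (free_module R X)"
proof -
  interpret R: ring R by fact
  show ?thesis unfolding single_def
    by (rule free_module_memI[where B = "{s}"]) (use assms in auto)
qed

lemma single_add:
  assumes "ring R" "r \<in> carrier R" "r' \<in> carrier R"
  shows "single R X s (r \<oplus>\<^bsub>R\<^esub> r') = single R X s r \<oplus>\<^bsub>free_module R X\<^esub> single R X s r'"
proof -
  interpret R: ring R by fact
  show ?thesis using assms by (auto simp: single_def free_module_add fun_eq_iff)
qed

lemma single_smult:
  assumes "ring R" "r \<in> carrier R" "r' \<in> carrier R"
  shows "r \<odot>\<^bsub>free_module R X\<^esub> single R X s r' = single R X s (r \<otimes>\<^bsub>R\<^esub> r')"
proof -
  interpret R: ring R by fact
  show ?thesis using assms by (auto simp: single_def free_module_smult fun_eq_iff)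
qed

lemma free_module_induct [consumes 2, case_names single zero add]:
  assumes "ring R" "x \<in> carrier (free_module R X)"
    and single: "\<And>s r. \<lbrakk>s \<in> X; r \<in> carrier R\<rbrakk> \<Longrightarrow> P (single R X s r)"
    and zero: "P \<zero>\<^bsub>free_module R X\<^esub>"
    and add: "\<And>x y. \<lbrakk>x \<in> carrier (free_module R X); y \<in> carrier (free_module R X); P x; P y\<rbrakk> \<Longrightarrow>
      P (x \<oplus>\<^bsub>free_module R X\<^esub> y)"
  shows "P x"
proof -
  interpret R: ring R by fact
  let ?F = "free_module R X"
  \<comment> \<open>Induction on a finite set that contains the support, with \<open>x\<close> left
    arbitrary because removing one coordinate changes the element.\<close>
  have *: "P x" if "finite B" "\<And>s. s \<in> X - B \<Longrightarrow> x s = \<zero>\<^bsub>R\<^esub>" "x \<in> carrier ?F" for B x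
    using that
  proof (induction B arbitrary: x)
    case empty
    then have "x = \<zero>\<^bsub>?F\<^esub>"
      by (auto simp: free_module_mem_iff free_module_zero fun_eq_iff extensional_def)
    then show ?case using zero by simp
  next
    case (insert s B)
    define y where "y = (\<lambda>t\<in>X. if t = s then \<zero>\<^bsub>R\<^esub> else x t)"
    have supp: "y t = \<zero>\<^bsub>R\<^esub>" if "t \<in> X - B" for t
      using insert.prems(1)[of t] that by (simp add: y_def)
    have y: "y \<in> carrier ?F"
      unfolding y_def by (rule free_module_memI[where B = B])
        (use insert.hyps insert.prems in \<open>auto simp: free_module_mem_iff\<close>)
    show ?case
    proof (cases "s \<in> X")
      case True
      then have xs: "x s \<in> carrier R" using insert.prems(2) by (simp add: free_module_mem_iff)
      have "x = single R X s (x s) \<oplus>\<^bsub>?F\<^esub> y"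
        using insert.prems(2) True
        by (auto simp: free_module_mem_iff free_module_add y_def single_def fun_eq_iff extensional_def)
      then show ?thesis
        using add[OF single_closed[OF assms(1) xs] y single[OF True xs] insert.IH[OF supp y]]
        by simp
    next
      \<comment> \<open>An index outside \<open>X\<close> carries no coordinate, so the smaller set
        already bounds the support.\<close>
      case False
      then show ?thesis using insert.IH[of x] insert.prems by auto
    qed
  qed
  show ?thesis
    by (rule *[where B = "{s \<in> X. x s \<noteq> \<zero>\<^bsub>R\<^esub>}"])
      (use assms(2) in \<open>simp_all add: free_module_mem_iff\<close>)
qed

section \<open>Quotient modules\<close>

text \<open>Copies the record of \<open>tensor\<close> for an arbitrary submodule, so that the
  quotient laws are proved once and without reference to the bilinearity relations.\<close>

definition quot_module :: "('k, 'v, 'm) module_scheme \<Rightarrow> 'v set \<Rightarrow> ('k, 'v set) module" where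
  "quot_module F N =
    \<lparr>carrier = a_rcosets\<^bsub>F\<^esub> N, mult = undefined, one = undefined, zero = N, add = set_add F,
     smult = (\<lambda>c X. \<Union>x\<in>X. N +>\<^bsub>F\<^esub> (c \<odot>\<^bsub>F\<^esub> x))\<rparr>"

context
  fixes K :: "('k, 'r) ring_scheme" and F :: "('k, 'v, 'm) module_scheme" and N :: "'v set"
  assumes F: "module K F" and N: "submodule N K F"
begin

interpretation F: module K F by (fact F)

interpretation N: abelian_subgroup N F
  by (rule abelian_subgroupI3)
    (use submodule.axioms(1)[OF N] in \<open>auto intro: additive_subgroupI F.M.abelian_group_axioms\<close>)

lemma quot_coset_closed: "x \<in> carrier F \<Longrightarrow> N +>\<^bsub>F\<^esub> x \<in> carrier (quot_module F N)"
  by (simp add: quot_module_def F.a_rcosetsI N.a_subset)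

lemma quot_carrierE:
  assumes "X \<in> carrier (quot_module F N)"
  obtains x where "x \<in> carrier F" "X = N +>\<^bsub>F\<^esub> x"
  using assms by (auto simp: quot_module_def A_RCOSETS_def')

lemma quot_zero: "\<zero>\<^bsub>quot_module F N\<^esub> = N +>\<^bsub>F\<^esub> \<zero>\<^bsub>F\<^esub>"
  by (simp add: quot_module_def N.a_subset)

lemma quot_add:
  "\<lbrakk>x \<in> carrier F; y \<in> carrier F\<rbrakk> \<Longrightarrow> (N +>\<^bsub>F\<^esub> x) \<oplus>\<^bsub>quot_module F N\<^esub> (N +>\<^bsub>F\<^esub> y) = N +>\<^bsub>F\<^esub> (x \<oplus>\<^bsub>F\<^esub> y)"
  by (simp add: quot_module_def N.a_rcos_sum)

text \<open>The scalar action is defined as a union over all representatives. The cosets in that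
  union coincide because \<open>N\<close> is closed under scalars.\<close>

lemma quot_smult:
  assumes "c \<in> carrier K" "x \<in> carrier F"
  shows "c \<odot>\<^bsub>quot_module F N\<^esub> (N +>\<^bsub>F\<^esub> x) = N +>\<^bsub>F\<^esub> (c \<odot>\<^bsub>F\<^esub> x)"
proof -
  have "N +>\<^bsub>F\<^esub> (c \<odot>\<^bsub>F\<^esub> y) = N +>\<^bsub>F\<^esub> (c \<odot>\<^bsub>F\<^esub> x)" if y: "y \<in> N +>\<^bsub>F\<^esub> x" for y
  proof -
    obtain n where n: "n \<in> N" "y = n \<oplus>\<^bsub>F\<^esub> x"
      using y by (auto simp: a_r_coset_def')
    then have "n \<in> carrier F" using N.a_subset by auto
    then have "c \<odot>\<^bsub>F\<^esub> y = c \<odot>\<^bsub>F\<^esub> n \<oplus>\<^bsub>F\<^esub> c \<odot>\<^bsub>F\<^esub> x"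
      using n assms by (simp add: F.smult_r_distr)
    moreover have "c \<odot>\<^bsub>F\<^esub> n \<in> N" using submodule.smult_closed[OF N] assms n by blast
    ultimately have "c \<odot>\<^bsub>F\<^esub> y \<in> N +>\<^bsub>F\<^esub> (c \<odot>\<^bsub>F\<^esub> x)"
      by (auto simp: a_r_coset_def')
    then show ?thesis
      using assms by (metis F.smult_closed N.a_repr_independence')
  qed
  moreover have "x \<in> N +>\<^bsub>F\<^esub> x" using assms(2) by (rule N.a_rcos_self)
  ultimately have "(\<Union>y\<in>N +>\<^bsub>F\<^esub> x. N +>\<^bsub>F\<^esub> (c \<odot>\<^bsub>F\<^esub> y)) = N +>\<^bsub>F\<^esub> (c \<odot>\<^bsub>F\<^esub> x)"
    by blast
  then show ?thesis by (simp add: quot_module_def)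
qed

lemma quot_module_module: "module K (quot_module F N)"
proof -
  let ?Q = "quot_module F N"
  note closed = quot_coset_closed
  note [simp] = quot_add quot_smult quot_zero
  show ?thesis
  proof (rule moduleI)
    show "abelian_group ?Q"
    proof (rule abelian_groupI)
      show "\<zero>\<^bsub>?Q\<^esub> \<in> carrier ?Q" by (simp add: closed)
    next
      fix x y assume "x \<in> carrier ?Q" "y \<in> carrier ?Q"
      then show "x \<oplus>\<^bsub>?Q\<^esub> y \<in> carrier ?Q" "x \<oplus>\<^bsub>?Q\<^esub> y = y \<oplus>\<^bsub>?Q\<^esub> x"
        by (auto elim!: quot_carrierE simp: closed F.M.a_comm)
    next
      fix x y z assume "x \<in> carrier ?Q" "y \<in> carrier ?Q" "z \<in> carrier ?Q"
      then show "x \<oplus>\<^bsub>?Q\<^esub> y \<oplus>\<^bsub>?Q\<^esub> z = x \<oplus>\<^bsub>?Q\<^esub> (y \<oplus>\<^bsub>?Q\<^esub> z)"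
        by (auto elim!: quot_carrierE simp: F.M.a_assoc)
    next
      fix x assume "x \<in> carrier ?Q"
      then obtain x' where x': "x' \<in> carrier F" "x = N +>\<^bsub>F\<^esub> x'" by (rule quot_carrierE)
      then show "\<zero>\<^bsub>?Q\<^esub> \<oplus>\<^bsub>?Q\<^esub> x = x" by simp
      have "(N +>\<^bsub>F\<^esub> \<ominus>\<^bsub>F\<^esub> x') \<oplus>\<^bsub>?Q\<^esub> x = \<zero>\<^bsub>?Q\<^esub>"
        using x' by (simp add: F.M.l_neg)
      then show "\<exists>y\<in>carrier ?Q. y \<oplus>\<^bsub>?Q\<^esub> x = \<zero>\<^bsub>?Q\<^esub>"
        using x' by (meson closed F.M.a_inv_closed)
    qed
  next
    fix a b x assume "a \<in> carrier K" "b \<in> carrier K" "x \<in> carrier ?Q"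
    then show "(a \<oplus>\<^bsub>K\<^esub> b) \<odot>\<^bsub>?Q\<^esub> x = a \<odot>\<^bsub>?Q\<^esub> x \<oplus>\<^bsub>?Q\<^esub> b \<odot>\<^bsub>?Q\<^esub> x"
      and "(a \<otimes>\<^bsub>K\<^esub> b) \<odot>\<^bsub>?Q\<^esub> x = a \<odot>\<^bsub>?Q\<^esub> (b \<odot>\<^bsub>?Q\<^esub> x)"
      by (auto elim!: quot_carrierE simp: F.smult_l_distr F.smult_assoc1)
  next
    fix a x y assume "a \<in> carrier K" "x \<in> carrier ?Q" "y \<in> carrier ?Q"
    then show "a \<odot>\<^bsub>?Q\<^esub> (x \<oplus>\<^bsub>?Q\<^esub> y) = a \<odot>\<^bsub>?Q\<^esub> x \<oplus>\<^bsub>?Q\<^esub> a \<odot>\<^bsub>?Q\<^esub> y"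
      by (auto elim!: quot_carrierE simp: F.smult_r_distr)
  next
    fix a x assume "a \<in> carrier K" "x \<in> carrier ?Q"
    then show "a \<odot>\<^bsub>?Q\<^esub> x \<in> carrier ?Q"
      by (auto elim!: quot_carrierE simp: closed)
  next
    fix x assume "x \<in> carrier ?Q"
    then show "\<one>\<^bsub>K\<^esub> \<odot>\<^bsub>?Q\<^esub> x = x"
      by (auto elim!: quot_carrierE)
  qed (rule F.R.is_cring)
qed

lemma quot_eqI:
  assumes "x \<in> carrier F" "y \<in> carrier F" "x \<ominus>\<^bsub>F\<^esub> y \<in> N"
  shows "N +>\<^bsub>F\<^esub> x = N +>\<^bsub>F\<^esub> y"
proof -
  have "x = (x \<ominus>\<^bsub>F\<^esub> y) \<oplus>\<^bsub>F\<^esub> y"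
    using assms(1,2) by (simp add: a_minus_def F.M.a_assoc F.M.l_neg)
  then have "x \<in> N +>\<^bsub>F\<^esub> y" using assms(3) by (auto simp: a_r_coset_def')
  then show ?thesis using assms(2) by (metis N.a_repr_independence')
qed

text \<open>This makes \<open>the_elem\<close> in \<open>tensor_lift\<close> meaningful: a linear
  map vanishing on \<open>N\<close> takes a single value on each coset.\<close>

lemma quot_image:
  assumes U: "module K U" and h: "linear_map K F U h" and null: "\<And>n. n \<in> N \<Longrightarrow> h n = \<zero>\<^bsub>U\<^esub>"
    and x: "x \<in> carrier F"
  shows "h ` (N +>\<^bsub>F\<^esub> x) = {h x}"
proof -
  interpret U: module K U by (fact U)
  have "h (n \<oplus>\<^bsub>F\<^esub> x) = h x" if "n \<in> N" for n
    using that linear_map_add[OF h, of n x] null[of n] x N.a_subset linear_map_closed[OF h x] by auto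
  moreover have "x \<in> N +>\<^bsub>F\<^esub> x" using x by (rule N.a_rcos_self)
  ultimately show ?thesis by (auto simp: a_r_coset_def')
qed

end

section \<open>Tensor products\<close>

text \<open>The sum in \<open>tensor_lift\<close> runs over the support of the coefficients,
  \<open>fin_supp_sum\<close> over the support of the terms. The latter can be smaller, as some
  \<open>t s\<close> may vanish.\<close>

lemma free_lift_eq:
  assumes U: "module K U" and t: "\<And>s. s \<in> X \<Longrightarrow> t s \<in> carrier U"
    and x: "x \<in> carrier (free_module K X)"
  shows "finsum U (\<lambda>s. x s \<odot>\<^bsub>U\<^esub> t s) {s \<in> X. x s \<noteq> \<zero>\<^bsub>K\<^esub>} = fin_supp_sum U X (\<lambda>s. x s \<odot>\<^bsub>U\<^esub> t s)"
proof -
  interpret U: module K U by (fact U)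
  show ?thesis
    using x t by (intro fin_supp_sum_eq[OF U, symmetric]) (auto simp: free_module_mem_iff)
qed

lemma free_lift_linear:
  assumes U: "module K U" and t: "\<And>s. s \<in> X \<Longrightarrow> t s \<in> carrier U"
  shows "linear_map K (free_module K X) U (\<lambda>x. finsum U (\<lambda>s. x s \<odot>\<^bsub>U\<^esub> t s) {s \<in> X. x s \<noteq> \<zero>\<^bsub>K\<^esub>})"
proof -
  interpret U: module K U by (fact U)
  have F: "module K (free_module K X)" by (rule free_module_module) (rule U.R.is_cring)
  show ?thesis
  proof (rule linear_map_cong[OF F linear_map_fin_supp_sum_fun[OF F U] free_lift_eq[OF U t]])
    show "linear_map K (free_module K X) U (\<lambda>x. x s \<odot>\<^bsub>U\<^esub> t s)" if "s \<in> X" for s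
      using t that
      by (intro linear_mapI) (auto simp: free_module_mem_iff free_module_add free_module_smult
          U.smult_l_distr U.smult_assoc1)
    show "finite {s \<in> X. x s \<odot>\<^bsub>U\<^esub> t s \<noteq> \<zero>\<^bsub>U\<^esub>}" if "x \<in> carrier (free_module K X)" for x
      by (rule finite_subset[of _ "{s \<in> X. x s \<noteq> \<zero>\<^bsub>K\<^esub>}"])
        (use that t in \<open>auto simp: free_module_mem_iff\<close>)
  qed
qed

lemma free_lift_basis:
  assumes U: "module K U" and t: "\<And>s. s \<in> X \<Longrightarrow> t s \<in> carrier U" and p: "p \<in> X"
  shows "finsum U (\<lambda>s. free_basis K X p s \<odot>\<^bsub>U\<^esub> t s) {s \<in> X. free_basis K X p s \<noteq> \<zero>\<^bsub>K\<^esub>} = t p"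
proof -
  interpret U: module K U by (fact U)
  have "free_basis K X p \<in> carrier (free_module K X)"
    unfolding free_basis_eq_single by (rule single_closed) (auto intro: U.R.ring_axioms)
  then have "finsum U (\<lambda>s. free_basis K X p s \<odot>\<^bsub>U\<^esub> t s) {s \<in> X. free_basis K X p s \<noteq> \<zero>\<^bsub>K\<^esub>}
      = fin_supp_sum U X (\<lambda>s. free_basis K X p s \<odot>\<^bsub>U\<^esub> t s)"
    using t by (intro free_lift_eq[OF U])
  also have "\<dots> = free_basis K X p p \<odot>\<^bsub>U\<^esub> t p"
    using p t by (intro fin_supp_sum_delta[OF U]) (auto simp: free_basis_def)
  finally show ?thesis using p t by (simp add: free_basis_def)
qed

section \<open>Universal property of the tensor product\<close>

lemma tensor_eq_quot:
  "tensor K V W = quot_module (pair_module K V W) (bilinear_submodule K V W)"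
  by (simp add: tensor_def quot_module_def Let_def)

context
  fixes K :: "('k, 'r) ring_scheme" and V :: "('k, 'a, 'm) module_scheme"
    and W :: "('k, 'b, 'n) module_scheme"
  assumes V: "module K V" and W: "module K W"
begin

interpretation V: module K V by (fact V)
interpretation W: module K W by (fact W)

private abbreviation (input) "F \<equiv> pair_module K V W"
private abbreviation (input) "e \<equiv> pair_basis K V W"
private abbreviation (input) "N \<equiv> bilinear_submodule K V W"

interpretation F: module K F by (rule free_module_module) (rule V.R.is_cring)

lemma pair_basis_closed: "e v w \<in> carrier F"
  unfolding free_basis_eq_single by (rule single_closed) (auto intro: V.R.ring_axioms)

lemma bilinear_relations_subset: "bilinear_relations K V W \<subseteq> carrier F"
  unfolding bilinear_relations_def Let_def by (auto simp: pair_basis_closed)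

lemma bilinear_submodule_submodule: "submodule N K F"
proof -
  let ?S = "{N. submodule N K F \<and> bilinear_relations K V W \<subseteq> N}"
  \<comment> \<open>The whole module belongs to the family, so the intersection is taken over a
    nonempty family and stays inside the carrier.\<close>
  have car: "carrier F \<in> ?S"
    using F.carrier_is_submodule bilinear_relations_subset by simp
  have S: "submodule M K F" if "M \<in> ?S" for M using that by simp
  show ?thesis
    unfolding bilinear_submodule_def
  proof (rule F.submoduleI)
    show "\<Inter>?S \<subseteq> carrier F" using car by blast
    show "\<zero>\<^bsub>F\<^esub> \<in> \<Inter>?S"
    proof (rule InterI)
      fix M assume "M \<in> ?S"
      from subgroup.one_closed[OF submodule.axioms(1)[OF S[OF this]]]
      show "\<zero>\<^bsub>F\<^esub> \<in> M" by simp
    qed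
    show "\<ominus>\<^bsub>F\<^esub> a \<in> \<Inter>?S" if "a \<in> \<Inter>?S" for a
      using that F.submoduleE(3)[OF S] by blast
    show "a \<oplus>\<^bsub>F\<^esub> b \<in> \<Inter>?S" if "a \<in> \<Inter>?S" "b \<in> \<Inter>?S" for a b
      using that F.submoduleE(5)[OF S] by blast
    show "c \<odot>\<^bsub>F\<^esub> b \<in> \<Inter>?S" if "c \<in> carrier K" "b \<in> \<Inter>?S" for c b
      using that F.submoduleE(4)[OF S] by blast
  qed
qed

lemma bilinear_relations_in: "bilinear_relations K V W \<subseteq> N"
  unfolding bilinear_submodule_def by blast

lemma bilinear_submodule_least:
  "\<lbrakk>submodule M K F; bilinear_relations K V W \<subseteq> M\<rbrakk> \<Longrightarrow> N \<subseteq> M"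
  unfolding bilinear_submodule_def by blast

lemmas quot = F.module_axioms bilinear_submodule_submodule

lemma tensor_module: "module K (tensor K V W)"
  unfolding tensor_eq_quot by (rule quot_module_module[OF quot])

lemma pure_tensor_closed: "pure_tensor K V W v w \<in> carrier (tensor K V W)"
  unfolding tensor_eq_quot pure_tensor_def
  by (rule quot_coset_closed[OF quot pair_basis_closed])

text \<open>Each of the four laws is an equality of cosets whose difference of representatives is
  one of the four kinds of generating relations.\<close>

lemma pure_tensor_bilinear: "bilinear_map K V W (tensor K V W) (pure_tensor K V W)"
proof -
  note rel = subsetD[OF bilinear_relations_in]
  note [simp] = quot_add[OF quot] quot_smult[OF quot] pair_basis_closed
  show ?thesis
  proof (intro bilinear_mapI linear_mapI pure_tensor_closed)
    fix w v v' assume "w \<in> carrier W" "v \<in> carrier V" "v' \<in> carrier V"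
    then have "e (v \<oplus>\<^bsub>V\<^esub> v') w \<ominus>\<^bsub>F\<^esub> (e v w \<oplus>\<^bsub>F\<^esub> e v' w) \<in> bilinear_relations K V W"
      unfolding bilinear_relations_def Let_def by blast
    from quot_eqI[OF quot _ _ rel[OF this]]
    show "pure_tensor K V W (v \<oplus>\<^bsub>V\<^esub> v') w = pure_tensor K V W v w \<oplus>\<^bsub>tensor K V W\<^esub> pure_tensor K V W v' w"
      by (simp add: pure_tensor_def tensor_eq_quot)
  next
    fix w c v assume "w \<in> carrier W" "c \<in> carrier K" "v \<in> carrier V"
    then have "e (c \<odot>\<^bsub>V\<^esub> v) w \<ominus>\<^bsub>F\<^esub> c \<odot>\<^bsub>F\<^esub> e v w \<in> bilinear_relations K V W"
      and c: "c \<in> carrier K"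
      unfolding bilinear_relations_def Let_def by blast+
    from quot_eqI[OF quot _ _ rel[OF this(1)]] c
    show "pure_tensor K V W (c \<odot>\<^bsub>V\<^esub> v) w = c \<odot>\<^bsub>tensor K V W\<^esub> pure_tensor K V W v w"
      by (simp add: pure_tensor_def tensor_eq_quot)
  next
    fix v w w' assume "v \<in> carrier V" "w \<in> carrier W" "w' \<in> carrier W"
    then have "e v (w \<oplus>\<^bsub>W\<^esub> w') \<ominus>\<^bsub>F\<^esub> (e v w \<oplus>\<^bsub>F\<^esub> e v w') \<in> bilinear_relations K V W"
      unfolding bilinear_relations_def Let_def by blast
    from quot_eqI[OF quot _ _ rel[OF this]]
    show "pure_tensor K V W v (w \<oplus>\<^bsub>W\<^esub> w') = pure_tensor K V W v w \<oplus>\<^bsub>tensor K V W\<^esub> pure_tensor K V W v w'"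
      by (simp add: pure_tensor_def tensor_eq_quot)
  next
    fix v c w assume "v \<in> carrier V" "c \<in> carrier K" "w \<in> carrier W"
    then have "e v (c \<odot>\<^bsub>W\<^esub> w) \<ominus>\<^bsub>F\<^esub> c \<odot>\<^bsub>F\<^esub> e v w \<in> bilinear_relations K V W"
      and c: "c \<in> carrier K"
      unfolding bilinear_relations_def Let_def by blast+
    from quot_eqI[OF quot _ _ rel[OF this(1)]] c
    show "pure_tensor K V W v (c \<odot>\<^bsub>W\<^esub> w) = c \<odot>\<^bsub>tensor K V W\<^esub> pure_tensor K V W v w"
      by (simp add: pure_tensor_def tensor_eq_quot)
  qed
qed

text \<open>Cases for zero and for scalar multiples do not occur: zero is the pure tensor of two
  zeros, and a scalar is absorbed into the left factor.\<close>

lemma tensor_induct: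
  assumes X: "X \<in> carrier (tensor K V W)"
    and pure: "\<And>v w. \<lbrakk>v \<in> carrier V; w \<in> carrier W\<rbrakk> \<Longrightarrow> P (pure_tensor K V W v w)"
    and add: "\<And>X Y. \<lbrakk>X \<in> carrier (tensor K V W); Y \<in> carrier (tensor K V W); P X; P Y\<rbrakk> \<Longrightarrow>
      P (X \<oplus>\<^bsub>tensor K V W\<^esub> Y)"
  shows "P X"
proof -
  note tens = tensor_eq_quot[of K V W]
  have "P (N +>\<^bsub>F\<^esub> x)" if "x \<in> carrier F" for x
    using V.R.ring_axioms that
  proof (induction rule: free_module_induct)
    case (single s r)
    obtain v w where s: "s = (v, w)" "v \<in> carrier V" "w \<in> carrier W" using single by auto
    have "single K (carrier V \<times> carrier W) s r = r \<odot>\<^bsub>F\<^esub> e v w"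
      using single_smult[OF V.R.ring_axioms single(2), of "\<one>\<^bsub>K\<^esub>" "carrier V \<times> carrier W" s] single(2) s
      by (simp add: free_basis_eq_single)
    then have "N +>\<^bsub>F\<^esub> single K (carrier V \<times> carrier W) s r = r \<odot>\<^bsub>tensor K V W\<^esub> pure_tensor K V W v w"
      using single(2) by (simp add: tens pure_tensor_def quot_smult[OF quot] pair_basis_closed)
    also have "\<dots> = pure_tensor K V W (r \<odot>\<^bsub>V\<^esub> v) w"
      using linear_map_smult[OF bilinear_map_left[OF pure_tensor_bilinear s(3)] single(2) s(2)] by simp
    finally show ?case using pure[of "r \<odot>\<^bsub>V\<^esub> v" w] single(2) s by simp
  next
    case zero
    have "pure_tensor K V W \<zero>\<^bsub>V\<^esub> \<zero>\<^bsub>W\<^esub> = \<zero>\<^bsub>tensor K V W\<^esub>"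
      using linear_map_zero[OF V tensor_module bilinear_map_left[OF pure_tensor_bilinear]] by simp
    then show ?case using pure[of "\<zero>\<^bsub>V\<^esub>" "\<zero>\<^bsub>W\<^esub>"] quot_zero[OF quot] by (simp add: tens)
  next
    case (add x y)
    then show ?case
      using assms(3)[of "N +>\<^bsub>F\<^esub> x" "N +>\<^bsub>F\<^esub> y"]
      by (simp add: tens quot_add[OF quot] quot_coset_closed[OF quot])
  qed
  then show ?thesis using X unfolding tens by (metis quot_carrierE[OF quot])
qed

context
  fixes U :: "('k, 'c, 'l) module_scheme" and \<phi> :: "'a \<Rightarrow> 'b \<Rightarrow> 'c"
  assumes U: "module K U" and \<phi>: "bilinear_map K V W U \<phi>"
begin

private abbreviation (input) "h \<equiv> \<lambda>x. finsum U (\<lambda>p. x p \<odot>\<^bsub>U\<^esub> \<phi> (fst p) (snd p))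
                 {p \<in> carrier V \<times> carrier W. x p \<noteq> \<zero>\<^bsub>K\<^esub>}"

interpretation U: module K U by (fact U)

lemma pair_lift_linear: "linear_map K F U h"
  using bilinear_map_closed[OF \<phi>] by (intro free_lift_linear U) auto

lemma pair_lift_basis: "\<lbrakk>v \<in> carrier V; w \<in> carrier W\<rbrakk> \<Longrightarrow> h (e v w) = \<phi> v w"
  using bilinear_map_closed[OF \<phi>]
  by (subst free_lift_basis[OF U, where t = "\<lambda>p. \<phi> (fst p) (snd p)"]) auto

text \<open>The kernel of the lifted map is a submodule that contains the relations because \<phi>
  is bilinear, hence it contains the smallest such submodule.\<close>

lemma pair_lift_null: "n \<in> N \<Longrightarrow> h n = \<zero>\<^bsub>U\<^esub>"
proof -
  note lin = pair_lift_linear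
  note [simp] = linear_map_closed[OF lin] linear_map_add[OF lin] linear_map_smult[OF lin]
    linear_map_minus[OF F.module_axioms U lin] linear_map_zero[OF F.module_axioms U lin]
    pair_basis_closed bilinear_map_closed[OF \<phi>]
  let ?N = "{x \<in> carrier F. h x = \<zero>\<^bsub>U\<^esub>}"
  have "submodule ?N K F"
    by (rule F.submoduleI) auto
  moreover have "bilinear_relations K V W \<subseteq> ?N"
  proof -
    have 1: "h (x \<ominus>\<^bsub>F\<^esub> y) = \<zero>\<^bsub>U\<^esub>" if "x \<in> carrier F" "y \<in> carrier F" "h x = h y" for x y
      using that by (simp add: a_minus_def U.M.r_neg)
    show ?thesis
      unfolding bilinear_relations_def Let_def
      by (auto intro!: 1 simp: pair_lift_basis linear_map_add[OF bilinear_map_left[OF \<phi>]]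
          linear_map_add[OF bilinear_map_right[OF \<phi>]] linear_map_smult[OF bilinear_map_left[OF \<phi>]]
          linear_map_smult[OF bilinear_map_right[OF \<phi>]])
  qed
  ultimately show "n \<in> N \<Longrightarrow> h n = \<zero>\<^bsub>U\<^esub>" using bilinear_submodule_least by blast
qed

lemma tensor_lift_coset:
  assumes "x \<in> carrier F" shows "tensor_lift K V W U \<phi> (N +>\<^bsub>F\<^esub> x) = h x"
  unfolding tensor_lift_def
  using quot_image[OF quot U pair_lift_linear pair_lift_null assms] by simp

lemma tensor_lift_linear: "linear_map K (tensor K V W) U (tensor_lift K V W U \<phi>)"
proof -
  note lin = pair_lift_linear
  note [simp] = linear_map_closed[OF lin] linear_map_add[OF lin] linear_map_smult[OF lin]
    tensor_lift_coset quot_add[OF quot] quot_smult[OF quot]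
  show ?thesis
    unfolding tensor_eq_quot
    by (rule linear_mapI) (auto elim!: quot_carrierE[OF quot])
qed

lemma tensor_lift_pure:
  "\<lbrakk>v \<in> carrier V; w \<in> carrier W\<rbrakk> \<Longrightarrow> tensor_lift K V W U \<phi> (pure_tensor K V W v w) = \<phi> v w"
  by (simp add: pure_tensor_def tensor_lift_coset pair_basis_closed pair_lift_basis)

end

text \<open>The uniqueness half of the universal property. Every later reduction to pure tensors
  goes through this rule or its two-variable form.\<close>

lemma tensor_linear_eqI:
  assumes "linear_map K (tensor K V W) U f" "linear_map K (tensor K V W) U g"
    and "\<And>v w. \<lbrakk>v \<in> carrier V; w \<in> carrier W\<rbrakk> \<Longrightarrow> f (pure_tensor K V W v w) = g (pure_tensor K V W v w)"
    and "X \<in> carrier (tensor K V W)"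
  shows "f X = g X"
  by (rule tensor_induct[OF assms(4)])
    (simp_all add: assms(3) linear_map_add[OF assms(1)] linear_map_add[OF assms(2)])

end

declare tensor_module [simp] pure_tensor_closed [simp]

lemma ground_module: assumes "cring K" shows "module K (ground K)"
proof -
  interpret K: cring K by fact
  show ?thesis
    by (rule moduleI)
      (auto simp: ground_def assms K.m_assoc K.l_distr K.r_distr K.a_ac
        intro!: abelian_groupI exI[where x = "\<ominus>\<^bsub>K\<^esub> _"] bexI[where x = "\<ominus>\<^bsub>K\<^esub> _"] K.l_neg)
qed

text \<open>One argument is made pure while the other stays arbitrary, then the second one.
  Linearity is asked for in each argument separately so that \<phi> and \<psi> may be compound
  expressions.\<close>

lemma tensor_bilinear_eqI:
  assumes mods: "module K V" "module K W" "module K V'" "module K W'"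
    and left: "\<And>Y. Y \<in> carrier (tensor K V' W') \<Longrightarrow> linear_map K (tensor K V W) U (\<lambda>X. \<phi> X Y)"
      "\<And>Y. Y \<in> carrier (tensor K V' W') \<Longrightarrow> linear_map K (tensor K V W) U (\<lambda>X. \<psi> X Y)"
    and right: "\<And>X. X \<in> carrier (tensor K V W) \<Longrightarrow> linear_map K (tensor K V' W') U (\<lambda>Y. \<phi> X Y)"
      "\<And>X. X \<in> carrier (tensor K V W) \<Longrightarrow> linear_map K (tensor K V' W') U (\<lambda>Y. \<psi> X Y)"
    and pure: "\<And>v w v' w'. \<lbrakk>v \<in> carrier V; w \<in> carrier W; v' \<in> carrier V'; w' \<in> carrier W'\<rbrakk> \<Longrightarrow>
      \<phi> (pure_tensor K V W v w) (pure_tensor K V' W' v' w') =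
      \<psi> (pure_tensor K V W v w) (pure_tensor K V' W' v' w')"
    and X: "X \<in> carrier (tensor K V W)" and Y: "Y \<in> carrier (tensor K V' W')"
  shows "\<phi> X Y = \<psi> X Y"
proof (rule tensor_linear_eqI[OF mods(1,2) left(1)[OF Y] left(2)[OF Y] _ X])
  fix v w assume vw: "v \<in> carrier V" "w \<in> carrier W"
  note c = pure_tensor_closed[OF mods(1,2)]
  show "\<phi> (pure_tensor K V W v w) Y = \<psi> (pure_tensor K V W v w) Y"
    by (rule tensor_linear_eqI[OF mods(3,4) right(1)[OF c] right(2)[OF c] pure[OF vw] Y])
qed

lemma pure_tensor_smult_right:
  assumes "module K V" "module K W" "c \<in> carrier K" "v \<in> carrier V" "w \<in> carrier W"
  shows "pure_tensor K V W v (c \<odot>\<^bsub>W\<^esub> w) = c \<odot>\<^bsub>tensor K V W\<^esub> pure_tensor K V W v w"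
  using linear_map_smult[OF bilinear_map_right[OF pure_tensor_bilinear[OF assms(1,2)] assms(4)] assms(3,5)] .

lemma pure_tensor_smult_left:
  assumes "module K V" "module K W" "c \<in> carrier K" "v \<in> carrier V" "w \<in> carrier W"
  shows "pure_tensor K V W (c \<odot>\<^bsub>V\<^esub> v) w = c \<odot>\<^bsub>tensor K V W\<^esub> pure_tensor K V W v w"
  using linear_map_smult[OF bilinear_map_left[OF pure_tensor_bilinear[OF assms(1,2)] assms(5)] assms(3,4)] .

text \<open>In \<open>tensor_assoc\<close> and \<open>tensor_bilinear\<close> a lift is nested
  inside another one, so the inner bilinear map depends on the outer variables. Linearity in such a
  parameter holds for every \<open>X\<close> because both sides of each law are linear in
  \<open>X\<close> and agree on pure tensors.\<close>

lemma tensor_lift_linear_param: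
  assumes V: "module K V" and W: "module K W" and Z: "module K Z" and U: "module K U"
    and bil: "\<And>z. z \<in> carrier Z \<Longrightarrow> bilinear_map K V W U (\<phi> z)"
    and lin: "\<And>v w. \<lbrakk>v \<in> carrier V; w \<in> carrier W\<rbrakk> \<Longrightarrow> linear_map K Z U (\<lambda>z. \<phi> z v w)"
    and X: "X \<in> carrier (tensor K V W)"
  shows "linear_map K Z U (\<lambda>z. tensor_lift K V W U (\<phi> z) X)"
proof -
  interpret Z: module K Z by (fact Z)
  note L = tensor_lift_linear[OF V W U bil] and T = tensor_module[OF V W]
  note [simp] = tensor_lift_pure[OF V W U bil]
  show ?thesis
  proof (rule linear_mapI)
    fix z assume "z \<in> carrier Z"
    then show "tensor_lift K V W U (\<phi> z) X \<in> carrier U"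
      using linear_map_closed[OF L X] by simp
  next
    fix z z' assume z: "z \<in> carrier Z" "z' \<in> carrier Z"
    show "tensor_lift K V W U (\<phi> (z \<oplus>\<^bsub>Z\<^esub> z')) X =
        tensor_lift K V W U (\<phi> z) X \<oplus>\<^bsub>U\<^esub> tensor_lift K V W U (\<phi> z') X"
      by (rule tensor_linear_eqI[OF V W L linear_map_add_fun[OF T U L L] _ X])
        (use z linear_map_add[OF lin] in simp_all)
  next
    fix c z assume z: "c \<in> carrier K" "z \<in> carrier Z"
    show "tensor_lift K V W U (\<phi> (c \<odot>\<^bsub>Z\<^esub> z)) X = c \<odot>\<^bsub>U\<^esub> tensor_lift K V W U (\<phi> z) X"
      by (rule tensor_linear_eqI[OF V W L linear_map_smult_fun[OF T U L] _ X])
        (use z linear_map_smult[OF lin] in simp_all)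
  qed
qed

lemma pure_tensor_linear_left:
  assumes "module K V" "module K W" "linear_map K Z V f" "w \<in> carrier W"
  shows "linear_map K Z (tensor K V W) (\<lambda>z. pure_tensor K V W (f z) w)"
  by (rule linear_map_comp[OF bilinear_map_left[OF pure_tensor_bilinear] assms(3)]) (fact assms)+

lemma pure_tensor_linear_right:
  assumes "module K V" "module K W" "v \<in> carrier V" "linear_map K Z W g"
  shows "linear_map K Z (tensor K V W) (\<lambda>z. pure_tensor K V W v (g z))"
  by (rule linear_map_comp[OF bilinear_map_right[OF pure_tensor_bilinear] assms(4)]) (fact assms)+

lemma bilinear_map_comp:
  assumes "bilinear_map K V W U \<phi>" "linear_map K V' V f" "linear_map K W' W g"
  shows "bilinear_map K V' W' U (\<lambda>v w. \<phi> (f v) (g w))"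
proof (rule bilinear_mapI)
  show "linear_map K V' U (\<lambda>v. \<phi> (f v) (g w))" if "w \<in> carrier W'" for w
    by (rule linear_map_comp[OF bilinear_map_left[OF assms(1)] assms(2)])
      (rule linear_map_closed[OF assms(3) that])
  show "linear_map K W' U (\<lambda>w. \<phi> (f v) (g w))" if "v \<in> carrier V'" for v
    by (rule linear_map_comp[OF bilinear_map_right[OF assms(1)] assms(3)])
      (rule linear_map_closed[OF assms(2) that])
qed

section \<open>Functoriality of the tensor product, and supports of families of tensor maps\<close>

context
  fixes K :: "('k, 'r) ring_scheme" and V :: "('k, 'a, 'm) module_scheme"
    and W :: "('k, 'b, 'n) module_scheme" and V' :: "('k, 'c, 'o) module_scheme"
    and W' :: "('k, 'd, 'p) module_scheme" and f g
  assumes mods: "module K V" "module K W" "module K V'" "module K W'"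
    and lin: "linear_map K V V' f" "linear_map K W W' g"
begin

lemma tensor_map_linear:
  "linear_map K (tensor K V W) (tensor K V' W') (tensor_map K V W V' W' f g)"
  unfolding tensor_map_def
  by (intro tensor_lift_linear mods tensor_module bilinear_map_comp[OF _ lin] pure_tensor_bilinear)

lemma tensor_map_pure:
  "\<lbrakk>v \<in> carrier V; w \<in> carrier W\<rbrakk> \<Longrightarrow>
    tensor_map K V W V' W' f g (pure_tensor K V W v w) = pure_tensor K V' W' (f v) (g w)"
  unfolding tensor_map_def
  by (subst tensor_lift_pure)
    (simp_all add: mods tensor_module bilinear_map_comp[OF _ lin] pure_tensor_bilinear)

end

lemma pure_tensor_zero:
  assumes "module K V" "module K W"
  shows "w \<in> carrier W \<Longrightarrow> pure_tensor K V W \<zero>\<^bsub>V\<^esub> w = \<zero>\<^bsub>tensor K V W\<^esub>"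
    and "v \<in> carrier V \<Longrightarrow> pure_tensor K V W v \<zero>\<^bsub>W\<^esub> = \<zero>\<^bsub>tensor K V W\<^esub>"
  using linear_map_zero[OF assms(1) tensor_module[OF assms] bilinear_map_left[OF pure_tensor_bilinear[OF assms]]]
    linear_map_zero[OF assms(2) tensor_module[OF assms] bilinear_map_right[OF pure_tensor_bilinear[OF assms]]]
  by auto

text \<open>Turns the vanishing of one entry of \<open>R\<close> into the vanishing of a whole
  tensor map, which bounds supports independently of the tensor \<open>X\<close>.\<close>

lemma tensor_map_zero:
  assumes mods: "module K V" "module K W" "module K V'" "module K W'"
    and lin: "linear_map K V V' f" "linear_map K W W' g"
    and zero: "(\<forall>v \<in> carrier V. f v = \<zero>\<^bsub>V'\<^esub>) \<or> (\<forall>w \<in> carrier W. g w = \<zero>\<^bsub>W'\<^esub>)"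
    and X: "X \<in> carrier (tensor K V W)"
  shows "tensor_map K V W V' W' f g X = \<zero>\<^bsub>tensor K V' W'\<^esub>"
proof (rule tensor_linear_eqI[OF mods(1,2) tensor_map_linear[OF mods lin] linear_map_zero_fun _ X])
  fix v w assume "v \<in> carrier V" "w \<in> carrier W"
  then show "tensor_map K V W V' W' f g (pure_tensor K V W v w) = \<zero>\<^bsub>tensor K V' W'\<^esub>"
    using zero linear_map_closed[OF lin(1)] linear_map_closed[OF lin(2)]
    by (auto simp: tensor_map_pure[OF mods lin] pure_tensor_zero[OF mods(3,4)])
qed (use mods in auto)

text \<open>There need not be a finite bound common to all tensors; the support at a sum lies in the
  union of the two supports, so finiteness passes from pure tensors to all of them.\<close>

lemma finite_support_tensor:
  assumes V: "module K V" and W: "module K W" and U: "module K U"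
    and lin: "\<And>i. i \<in> I \<Longrightarrow> linear_map K (tensor K V W) U (g i)"
    and fin: "\<And>v w. \<lbrakk>v \<in> carrier V; w \<in> carrier W\<rbrakk> \<Longrightarrow>
      finite {i \<in> I. g i (pure_tensor K V W v w) \<noteq> \<zero>\<^bsub>U\<^esub>}"
    and X: "X \<in> carrier (tensor K V W)"
  shows "finite {i \<in> I. g i X \<noteq> \<zero>\<^bsub>U\<^esub>}"
proof (rule tensor_induct[OF V W X])
  fix X Y
  assume X: "X \<in> carrier (tensor K V W)" "finite {i \<in> I. g i X \<noteq> \<zero>\<^bsub>U\<^esub>}"
    and Y: "Y \<in> carrier (tensor K V W)" "finite {i \<in> I. g i Y \<noteq> \<zero>\<^bsub>U\<^esub>}"
  interpret U: module K U by (rule U)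
  have "{i \<in> I. g i (X \<oplus>\<^bsub>tensor K V W\<^esub> Y) \<noteq> \<zero>\<^bsub>U\<^esub>} \<subseteq> {i \<in> I. g i X \<noteq> \<zero>\<^bsub>U\<^esub>} \<union> {i \<in> I. g i Y \<noteq> \<zero>\<^bsub>U\<^esub>}"
    using linear_map_add[OF lin X(1) Y(1)] by auto
  then show "finite {i \<in> I. g i (X \<oplus>\<^bsub>tensor K V W\<^esub> Y) \<noteq> \<zero>\<^bsub>U\<^esub>}"
    by (rule finite_subset) (use X Y in simp)
qed (rule fin)

text \<open>Finite supports in one factor suffice, since a pure tensor with a zero entry vanishes.
  In the applications the other factor is the identity for every \<open>j\<close>.\<close>

lemma tensor_map_finite_support:
  assumes mods: "module K V" "module K W" "module K V'" "module K W'"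
    and lin: "\<And>j. j \<in> I \<Longrightarrow> linear_map K V V' (g j)" "\<And>j. j \<in> I \<Longrightarrow> linear_map K W W' (h j)"
    and fin: "(\<forall>v \<in> carrier V. finite {j \<in> I. g j v \<noteq> \<zero>\<^bsub>V'\<^esub>}) \<or>
      (\<forall>w \<in> carrier W. finite {j \<in> I. h j w \<noteq> \<zero>\<^bsub>W'\<^esub>})"
    and X: "X \<in> carrier (tensor K V W)"
  shows "finite {j \<in> I. tensor_map K V W V' W' (g j) (h j) X \<noteq> \<zero>\<^bsub>tensor K V' W'\<^esub>}"
proof (rule finite_support_tensor[OF mods(1,2) tensor_module[OF mods(3,4)] tensor_map_linear[OF mods lin] _ X])
  fix v w assume vw: "v \<in> carrier V" "w \<in> carrier W"
  let ?S = "{j \<in> I. tensor_map K V W V' W' (g j) (h j) (pure_tensor K V W v w) \<noteq> \<zero>\<^bsub>tensor K V' W'\<^esub>}"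
  have "?S \<subseteq> {j \<in> I. g j v \<noteq> \<zero>\<^bsub>V'\<^esub>}" "?S \<subseteq> {j \<in> I. h j w \<noteq> \<zero>\<^bsub>W'\<^esub>}"
    using vw linear_map_closed[OF lin(1)] linear_map_closed[OF lin(2)]
    by (auto simp: tensor_map_pure[OF mods lin] pure_tensor_zero[OF mods(3,4)])
  then show "finite ?S" using fin vw finite_subset by blast
qed

section \<open>Contraction of one tensor factor with a functional\<close>

context
  fixes K :: "('k, 'r) ring_scheme" and V :: "('k, 'a, 'm) module_scheme"
    and W :: "('k, 'b, 'n) module_scheme" and g
  assumes mods: "module K V" "module K W" and g: "linear_map K W (ground K) g"
begin

lemma id_tensor_fun_bilinear:
  "bilinear_map K V W V (\<lambda>v w. g w \<odot>\<^bsub>V\<^esub> v)"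
  by (intro bilinear_mapI linear_map_smult_left linear_map_smult_right mods g)
    (use linear_map_closed[OF g] in \<open>auto simp: ground_def\<close>)

lemma id_tensor_fun_linear:
  "linear_map K (tensor K V W) V (id_tensor_fun K V W g)"
  unfolding id_tensor_fun_def by (intro tensor_lift_linear mods id_tensor_fun_bilinear)

lemma id_tensor_fun_pure:
  "\<lbrakk>v \<in> carrier V; w \<in> carrier W\<rbrakk> \<Longrightarrow> id_tensor_fun K V W g (pure_tensor K V W v w) = g w \<odot>\<^bsub>V\<^esub> v"
  unfolding id_tensor_fun_def by (subst tensor_lift_pure) (simp_all add: mods id_tensor_fun_bilinear)

end

context
  fixes K :: "('k, 'r) ring_scheme" and V :: "('k, 'a, 'm) module_scheme"
    and W :: "('k, 'b, 'n) module_scheme" and g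
  assumes mods: "module K V" "module K W" and g: "linear_map K V (ground K) g"
begin

lemma fun_tensor_id_bilinear: "bilinear_map K V W W (\<lambda>v w. g v \<odot>\<^bsub>W\<^esub> w)"
  by (intro bilinear_mapI linear_map_smult_left linear_map_smult_right mods g)
    (use linear_map_closed[OF g] in \<open>auto simp: ground_def\<close>)

lemma fun_tensor_id_linear: "linear_map K (tensor K V W) W (fun_tensor_id K V W g)"
  unfolding fun_tensor_id_def by (intro tensor_lift_linear mods fun_tensor_id_bilinear)

lemma fun_tensor_id_pure:
  "\<lbrakk>v \<in> carrier V; w \<in> carrier W\<rbrakk> \<Longrightarrow> fun_tensor_id K V W g (pure_tensor K V W v w) = g v \<odot>\<^bsub>W\<^esub> w"
  unfolding fun_tensor_id_def by (subst tensor_lift_pure) (simp_all add: mods fun_tensor_id_bilinear)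

end

section \<open>The associator and componentwise products\<close>

context
  fixes K :: "('k, 'r) ring_scheme" and U :: "('k, 'a, 'm) module_scheme"
    and V :: "('k, 'b, 'n) module_scheme" and W :: "('k, 'c, 'o) module_scheme"
  assumes mods: "module K U" "module K V" "module K W"
begin

lemma tensor_assoc_inner_bilinear:
  "w \<in> carrier W \<Longrightarrow> bilinear_map K U V (tensor K U (tensor K V W))
      (\<lambda>u v. pure_tensor K U (tensor K V W) u (pure_tensor K V W v w))"
  by (intro bilinear_mapI pure_tensor_linear_left pure_tensor_linear_right mods tensor_module
      linear_map_id pure_tensor_closed)

lemma tensor_assoc_outer_bilinear:
  "bilinear_map K (tensor K U V) W (tensor K U (tensor K V W)) (\<lambda>x w.
     tensor_lift K U V (tensor K U (tensor K V W))
       (\<lambda>u v. pure_tensor K U (tensor K V W) u (pure_tensor K V W v w)) x)"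
  by (intro bilinear_mapI tensor_lift_linear tensor_lift_linear_param mods tensor_module
      tensor_assoc_inner_bilinear pure_tensor_linear_right linear_map_id)

lemma tensor_assoc_linear:
  "linear_map K (tensor K (tensor K U V) W) (tensor K U (tensor K V W)) (tensor_assoc K U V W)"
  unfolding tensor_assoc_def Let_def
  by (intro tensor_lift_linear tensor_module mods tensor_assoc_outer_bilinear)

lemma tensor_assoc_pure:
  "\<lbrakk>u \<in> carrier U; v \<in> carrier V; w \<in> carrier W\<rbrakk> \<Longrightarrow>
    tensor_assoc K U V W (pure_tensor K (tensor K U V) W (pure_tensor K U V u v) w) =
      pure_tensor K U (tensor K V W) u (pure_tensor K V W v w)"
  unfolding tensor_assoc_def Let_def
  by (simp add: tensor_lift_pure tensor_module mods tensor_assoc_outer_bilinear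
      tensor_assoc_inner_bilinear pure_tensor_closed)

end

context
  fixes K :: "('k, 'r) ring_scheme"
    and V :: "('k, 'a, 'm1) module_scheme" and W :: "('k, 'b, 'n1) module_scheme"
    and V' :: "('k, 'c, 'm2) module_scheme" and W' :: "('k, 'd, 'n2) module_scheme"
    and V'' :: "('k, 'e, 'm3) module_scheme" and W'' :: "('k, 'f, 'n3) module_scheme"
    and p q
  assumes mods: "module K V" "module K W" "module K V'" "module K W'" "module K V''" "module K W''"
    and bil: "bilinear_map K V V' V'' p" "bilinear_map K W W' W'' q"
begin

lemma tensor_bilinear_inner_bilinear:
  "\<lbrakk>v \<in> carrier V; w \<in> carrier W\<rbrakk> \<Longrightarrow>
    bilinear_map K V' W' (tensor K V'' W'') (\<lambda>v' w'. pure_tensor K V'' W'' (p v v') (q w w'))"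
  by (rule bilinear_map_comp[OF pure_tensor_bilinear bilinear_map_right bilinear_map_right])
    (rule mods bil | assumption)+

lemma tensor_bilinear_outer_bilinear:
  assumes Y: "Y \<in> carrier (tensor K V' W')"
  shows "bilinear_map K V W (tensor K V'' W'') (\<lambda>v w.
     tensor_lift K V' W' (tensor K V'' W'') (\<lambda>v' w'. pure_tensor K V'' W'' (p v v') (q w w')) Y)"
proof (rule bilinear_mapI)
  note [simp] = bilinear_map_closed[OF bil(1)] bilinear_map_closed[OF bil(2)]
  show "linear_map K V (tensor K V'' W'') (\<lambda>v. tensor_lift K V' W' (tensor K V'' W'')
      (\<lambda>v' w'. pure_tensor K V'' W'' (p v v') (q w w')) Y)" if "w \<in> carrier W" for w
    by (rule tensor_lift_linear_param)
      (use that Y in \<open>auto intro: mods tensor_module tensor_bilinear_inner_bilinear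
        pure_tensor_linear_left bilinear_map_left[OF bil(1)]\<close>)
  show "linear_map K W (tensor K V'' W'') (\<lambda>w. tensor_lift K V' W' (tensor K V'' W'')
      (\<lambda>v' w'. pure_tensor K V'' W'' (p v v') (q w w')) Y)" if "v \<in> carrier V" for v
    by (rule tensor_lift_linear_param)
      (use that Y in \<open>auto intro: mods tensor_module tensor_bilinear_inner_bilinear
        pure_tensor_linear_right bilinear_map_left[OF bil(2)]\<close>)
qed

lemma tensor_bilinear_bilinear:
  "bilinear_map K (tensor K V W) (tensor K V' W') (tensor K V'' W'')
    (tensor_bilinear K V W V' W' V'' W'' p q)"
  unfolding tensor_bilinear_def Let_def
  by (intro bilinear_mapI tensor_lift_linear tensor_lift_linear_param mods tensor_module
      tensor_bilinear_outer_bilinear tensor_bilinear_inner_bilinear)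

lemma tensor_bilinear_pure:
  "\<lbrakk>v \<in> carrier V; w \<in> carrier W; v' \<in> carrier V'; w' \<in> carrier W'\<rbrakk> \<Longrightarrow>
    tensor_bilinear K V W V' W' V'' W'' p q (pure_tensor K V W v w) (pure_tensor K V' W' v' w') =
      pure_tensor K V'' W'' (p v v') (q w w')"
  unfolding tensor_bilinear_def Let_def
  by (simp add: tensor_lift_pure mods tensor_module tensor_bilinear_outer_bilinear
      tensor_bilinear_inner_bilinear pure_tensor_closed)

end

text \<open>Linearity rules in a form that \<open>intro\<close> can apply to nested expressions.\<close>

lemma linear_tensor_map:
  assumes "module K V" "module K W" "module K V'" "module K W'"
    and "linear_map K V V' f" "linear_map K W W' g" "linear_map K Z (tensor K V W) h"
  shows "linear_map K Z (tensor K V' W') (\<lambda>z. tensor_map K V W V' W' f g (h z))"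
  using linear_map_comp[OF tensor_map_linear[OF assms(1-6)] assms(7)] .

lemma linear_tensor_assoc:
  assumes "module K U" "module K V" "module K W" "linear_map K Z (tensor K (tensor K U V) W) h"
  shows "linear_map K Z (tensor K U (tensor K V W)) (\<lambda>z. tensor_assoc K U V W (h z))"
  using linear_map_comp[OF tensor_assoc_linear[OF assms(1-3)] assms(4)] .

lemma linear_id_tensor_fun:
  assumes "module K V" "module K W" "linear_map K W (ground K) g" "linear_map K Z (tensor K V W) h"
  shows "linear_map K Z V (\<lambda>z. id_tensor_fun K V W g (h z))"
  using linear_map_comp[OF id_tensor_fun_linear[OF assms(1-3)] assms(4)] .

lemma linear_fun_tensor_id:
  assumes "module K V" "module K W" "linear_map K V (ground K) g" "linear_map K Z (tensor K V W) h"
  shows "linear_map K Z W (\<lambda>z. fun_tensor_id K V W g (h z))"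
  using linear_map_comp[OF fun_tensor_id_linear[OF assms(1-3)] assms(4)] .

lemma linear_bilinear_left:
  assumes "bilinear_map K V W U \<phi>" "w \<in> carrier W" "linear_map K Z V h"
  shows "linear_map K Z U (\<lambda>z. \<phi> (h z) w)"
  using linear_map_comp[OF bilinear_map_left[OF assms(1,2)] assms(3)] .

lemma linear_bilinear_right:
  assumes "bilinear_map K V W U \<phi>" "v \<in> carrier V" "linear_map K Z W h"
  shows "linear_map K Z U (\<lambda>z. \<phi> v (h z))"
  using linear_map_comp[OF bilinear_map_right[OF assms(1,2)] assms(3)] .

lemmas linear_intros = linear_map_id linear_tensor_map linear_tensor_assoc linear_id_tensor_fun
  linear_fun_tensor_id pure_tensor_linear_left pure_tensor_linear_right

lemma assoc_algebra_mult_bilinear: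
  assumes "assoc_algebra K B"
  shows "bilinear_map K B B B (mult B)"
proof -
  interpret B: assoc_algebra K B by fact
  show ?thesis
    by (intro bilinear_mapI linear_mapI)
      (auto simp: B.B.l_distr B.B.r_distr B.smult_mult_left B.smult_mult_right)
qed

section \<open>The free bimodule\<close>

context hopf_group_coalgebra
begin

abbreviation "linear V W h \<equiv> linear_map K V W h"
abbreviation "bilinear V W U \<phi> \<equiv> bilinear_map K V W U \<phi>"
abbreviation gmult (infixl "\<cdot>" 70) where "s \<cdot> t \<equiv> s \<otimes>\<^bsub>G\<^esub> t"
abbreviation "e \<equiv> \<one>\<^bsub>G\<^esub>"
abbreviation "AA s t \<equiv> tensor K (A s) (A t)"
abbreviation "pt V W \<equiv> pure_tensor K V W"
abbreviation "tmap V W V' W' \<equiv> tensor_map K V W V' W'"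
abbreviation "assoc U V W \<equiv> tensor_assoc K U V W"
abbreviation "id_fun V W \<equiv> id_tensor_fun K V W"
abbreviation "fun_id V W \<equiv> fun_tensor_id K V W"
abbreviation "pure s t \<equiv> pt (A s) (A t)"
abbreviation "Amap s t \<equiv> tmap (A s) (A t) (A s) (A t)"

lemma A_module [simp]: "s \<in> carrier G \<Longrightarrow> module K (A s)"
  using alg assoc_algebra.axioms(1) by blast

lemma A_ring: "s \<in> carrier G \<Longrightarrow> ring (A s)"
  using alg assoc_algebra.axioms(2) by blast

lemma A_mult_bilinear: "s \<in> carrier G \<Longrightarrow> bilinear (A s) (A s) (A s) (mult (A s))"
  by (rule assoc_algebra_mult_bilinear[OF alg])

lemma ground_module' [simp]: "module K (ground K)"
  by (rule ground_module) (rule K.is_cring)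

lemma comult_linear:
  assumes "s \<in> carrier G" "t \<in> carrier G"
  shows "linear (A (s \<cdot> t)) (AA s t) (\<Delta> s t)"
  using comult_algebra_map[OF assms] by (simp add: algebra_map_def linear_map_def tensor_algebra_def)

lemma comult_mult:
  assumes "s \<in> carrier G" "t \<in> carrier G" "a \<in> carrier (A (s \<cdot> t))" "b \<in> carrier (A (s \<cdot> t))"
  shows "\<Delta> s t (a \<otimes>\<^bsub>A (s \<cdot> t)\<^esub> b) =
    tensor_bilinear K (A s) (A t) (A s) (A t) (A s) (A t) (mult (A s)) (mult (A t)) (\<Delta> s t a) (\<Delta> s t b)"
  using comult_algebra_map[OF assms(1,2)] assms(3,4)
  by (simp add: algebra_map_def ring_hom_def tensor_algebra_def)

lemma comult_one:
  assumes "s \<in> carrier G" "t \<in> carrier G"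
  shows "\<Delta> s t \<one>\<^bsub>A (s \<cdot> t)\<^esub> = pure s t \<one>\<^bsub>A s\<^esub> \<one>\<^bsub>A t\<^esub>"
  using comult_algebra_map[OF assms(1,2)]
  by (simp add: algebra_map_def ring_hom_def tensor_algebra_def)

lemma comult_right_linear:
  "s \<in> carrier G \<Longrightarrow> linear (A s) (AA s e) (\<Delta> s e)"
  using comult_linear[of s e] by simp

lemma comult_left_linear:
  "s \<in> carrier G \<Longrightarrow> linear (A s) (AA e s) (\<Delta> e s)"
  using comult_linear[of e s] by simp

lemma fun_conv_linear:
  "\<lbrakk>s \<in> carrier G; linear (A e) (ground K) (\<phi> e)\<rbrakk> \<Longrightarrow> linear (A s) (A s) (fun_conv K G A \<Delta> s \<phi>)"
  unfolding fun_conv_def by (intro linear_id_tensor_fun comult_right_linear) auto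

lemma conv_fun_linear:
  "\<lbrakk>s \<in> carrier G; linear (A e) (ground K) (\<phi> e)\<rbrakk> \<Longrightarrow>
    linear (A s) (A s) (\<lambda>a. conv_fun K G A \<Delta> s a \<phi>)"
  unfolding conv_fun_def by (intro linear_fun_tensor_id comult_left_linear) auto

end

text \<open>The right action and the left coaction are built from \<open>f\<close> alone;
  \<open>R\<close> joins in an extension of this locale, for the right coaction.\<close>

locale functional_family = hopf_group_coalgebra K G A \<Delta> \<epsilon> S
  for K :: "'k ring" and G :: "'g monoid" and A :: "'g \<Rightarrow> ('k, 'a) module"
    and \<Delta> :: "'g \<Rightarrow> 'g \<Rightarrow> 'a \<Rightarrow> ('a \<times> 'a \<Rightarrow> 'k) set"
    and \<epsilon> :: "'a \<Rightarrow> 'k" and S :: "'g \<Rightarrow> 'a \<Rightarrow> 'a" +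
  fixes I :: "'i set" and f :: "'i \<Rightarrow> 'i \<Rightarrow> 'g \<Rightarrow> 'a \<Rightarrow> 'k"
  assumes f_linear: "\<lbrakk>i \<in> I; j \<in> I; s \<in> carrier G\<rbrakk> \<Longrightarrow> linear (A s) (ground K) (f i j s)"
    and f_finite: "\<lbrakk>i \<in> I; s \<in> carrier G; b \<in> carrier (A s)\<rbrakk> \<Longrightarrow> finite {j \<in> I. f i j s b \<noteq> \<zero>\<^bsub>K\<^esub>}"
    and f_mult: "\<lbrakk>i \<in> I; j \<in> I; s \<in> carrier G; a \<in> carrier (A s); b \<in> carrier (A s)\<rbrakk> \<Longrightarrow>
      f i j s (a \<otimes>\<^bsub>A s\<^esub> b) = fin_supp_sum K I (\<lambda>k. f i k s a \<otimes>\<^bsub>K\<^esub> f k j s b)"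
    and f_one: "\<lbrakk>i \<in> I; j \<in> I; s \<in> carrier G\<rbrakk> \<Longrightarrow> f i j s \<one>\<^bsub>A s\<^esub> = (if i = j then \<one>\<^bsub>K\<^esub> else \<zero>\<^bsub>K\<^esub>)"
begin

abbreviation "fsum M \<equiv> fin_supp_sum M I"
abbreviation "\<Gamma> \<equiv> free_bimodule K G A \<Delta> I f"
abbreviation "A\<Gamma> s t \<equiv> tensor K (A s) (\<Gamma> t)"
abbreviation "\<Gamma>A s t \<equiv> tensor K (\<Gamma> s) (A t)"
abbreviation "\<Delta>l \<equiv> free_left_coact K G A \<Delta> I f"
abbreviation "\<iota> s i \<equiv> single (A s) I i"
abbreviation "fc s i j \<equiv> fun_conv K G A \<Delta> s (f i j)"
abbreviation "cf s i j \<equiv> \<lambda>a. conv_fun K G A \<Delta> s a (f i j)"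

lemma f_closed: "\<lbrakk>i \<in> I; j \<in> I; s \<in> carrier G; a \<in> carrier (A s)\<rbrakk> \<Longrightarrow> f i j s a \<in> carrier K"
  using linear_map_closed[OF f_linear] by (simp add: ground_def)

lemma bimodule_carrier: "carrier (\<Gamma> s) = carrier (free_module (A s) I)"
  and bimodule_add: "add (\<Gamma> s) = add (free_module (A s) I)"
  and bimodule_zero: "\<zero>\<^bsub>\<Gamma> s\<^esub> = \<zero>\<^bsub>free_module (A s) I\<^esub>"
  and bimodule_smult: "c \<odot>\<^bsub>\<Gamma> s\<^esub> \<rho> = (\<lambda>i\<in>I. c \<odot>\<^bsub>A s\<^esub> \<rho> i)"
  and bimodule_lact: "lact (\<Gamma> s) = smult (free_module (A s) I)"
  by (simp_all add: free_bimodule_def Let_def)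

text \<open>\<open>ract\<close> is defined by sums in the free module over \<open>A s\<close>, while
  the results on sums ask for a module over \<open>K\<close>, which is what \<Gamma> is. The two
  records share carrier, addition and zero, and a sum reads nothing else.\<close>

lemma fin_supp_sum_bimodule: "fin_supp_sum (free_module (A s) I) = fin_supp_sum (\<Gamma> s)"
  by (simp add: fin_supp_sum_def finsum_def finprod_def bimodule_carrier bimodule_add bimodule_zero
      fun_eq_iff)

text \<open>Not an instance of \<open>free_module_module\<close>: the scalars come from
  \<open>K\<close> and act on every coordinate through \<open>A s\<close>, and \<open>A s\<close>
  may be noncommutative. Just the additive group is inherited from the free module.\<close>

lemma bimodule_module [simp]:
  assumes s: "s \<in> carrier G"
  shows "module K (\<Gamma> s)"
proof (rule moduleI)
  interpret B: assoc_algebra K "A s" by (rule alg[OF s])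
  let ?F = "free_module (A s) I"
  interpret F: abelian_group ?F by (rule free_module_abelian_group[OF A_ring[OF s]])
  note simps = bimodule_carrier bimodule_add bimodule_zero bimodule_smult free_module_add
    free_module_mem_iff fun_eq_iff
  show "cring K" by (rule K.is_cring)
  show "abelian_group (\<Gamma> s)"
  proof (rule abelian_groupI)
    show "\<exists>y\<in>carrier (\<Gamma> s). y \<oplus>\<^bsub>\<Gamma> s\<^esub> x = \<zero>\<^bsub>\<Gamma> s\<^esub>" if "x \<in> carrier (\<Gamma> s)" for x
      using that F.l_neg F.a_inv_closed unfolding bimodule_carrier bimodule_add bimodule_zero by blast
  qed (auto simp: bimodule_carrier bimodule_add bimodule_zero F.a_ac)
  show "c \<odot>\<^bsub>\<Gamma> s\<^esub> x \<in> carrier (\<Gamma> s)" if "c \<in> carrier K" "x \<in> carrier (\<Gamma> s)" for c x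
    using that unfolding bimodule_smult bimodule_carrier
    by (intro free_module_memI[where B = "{i \<in> I. x i \<noteq> \<zero>\<^bsub>A s\<^esub>}"]) (auto simp: free_module_mem_iff)
  show "(c \<oplus>\<^bsub>K\<^esub> d) \<odot>\<^bsub>\<Gamma> s\<^esub> x = c \<odot>\<^bsub>\<Gamma> s\<^esub> x \<oplus>\<^bsub>\<Gamma> s\<^esub> d \<odot>\<^bsub>\<Gamma> s\<^esub> x"
    "(c \<otimes>\<^bsub>K\<^esub> d) \<odot>\<^bsub>\<Gamma> s\<^esub> x = c \<odot>\<^bsub>\<Gamma> s\<^esub> (d \<odot>\<^bsub>\<Gamma> s\<^esub> x)"
    if "c \<in> carrier K" "d \<in> carrier K" "x \<in> carrier (\<Gamma> s)" for c d x
    using that by (auto simp: simps B.smult_l_distr B.smult_assoc1)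
  show "c \<odot>\<^bsub>\<Gamma> s\<^esub> (x \<oplus>\<^bsub>\<Gamma> s\<^esub> y) = c \<odot>\<^bsub>\<Gamma> s\<^esub> x \<oplus>\<^bsub>\<Gamma> s\<^esub> c \<odot>\<^bsub>\<Gamma> s\<^esub> y"
    if "c \<in> carrier K" "x \<in> carrier (\<Gamma> s)" "y \<in> carrier (\<Gamma> s)" for c x y
    using that by (auto simp: simps B.smult_r_distr)
  show "\<one>\<^bsub>K\<^esub> \<odot>\<^bsub>\<Gamma> s\<^esub> x = x" if "x \<in> carrier (\<Gamma> s)" for x
    using that by (auto simp: simps extensional_def)
qed

lemma single_linear:
  assumes s: "s \<in> carrier G"
  shows "linear (A s) (\<Gamma> s) (\<iota> s i)"
proof (rule linear_mapI)
  interpret B: assoc_algebra K "A s" by (rule alg[OF s])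
  show "\<iota> s i (c \<odot>\<^bsub>A s\<^esub> x) = c \<odot>\<^bsub>\<Gamma> s\<^esub> \<iota> s i x" if "c \<in> carrier K" "x \<in> carrier (A s)" for c x
    using that by (auto simp: single_def bimodule_smult fun_eq_iff)
qed (auto simp: bimodule_carrier bimodule_add single_closed single_add A_ring[OF s])

lemma single_closed' [simp]:
  "\<lbrakk>s \<in> carrier G; a \<in> carrier (A s)\<rbrakk> \<Longrightarrow> \<iota> s i a \<in> carrier (\<Gamma> s)"
  using linear_map_closed[OF single_linear] .

lemma single_zero: "s \<in> carrier G \<Longrightarrow> \<iota> s i \<zero>\<^bsub>A s\<^esub> = \<zero>\<^bsub>\<Gamma> s\<^esub>"
  by (rule linear_map_zero[OF _ _ single_linear]) auto

lemma coordinate_linear: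
  "\<lbrakk>s \<in> carrier G; i \<in> I\<rbrakk> \<Longrightarrow> linear (\<Gamma> s) (A s) (\<lambda>\<rho>. \<rho> i)"
  by (rule linear_mapI)
    (auto simp: bimodule_carrier bimodule_add bimodule_smult free_module_mem_iff free_module_add)

lemma bimodule_support: "\<rho> \<in> carrier (\<Gamma> s) \<Longrightarrow> finite {i \<in> I. \<rho> i \<noteq> \<zero>\<^bsub>A s\<^esub>}"
  by (simp add: bimodule_carrier free_module_mem_iff)

text \<open>The existence half of the universal property of a direct sum: an arbitrary family of
  linear maps on the summands extends, because each \<open>\<rho>\<close> has finite support. Both
  coactions and the right action have this form.\<close>

lemma bimodule_lift_linear:
  assumes "s \<in> carrier G" "module K W" "\<And>i. i \<in> I \<Longrightarrow> linear (A s) W (g i)"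
  shows "linear (\<Gamma> s) W (\<lambda>\<rho>. fin_supp_sum W I (\<lambda>i. g i (\<rho> i)))"
proof (rule linear_map_fin_supp_sum_fun)
  show "linear (\<Gamma> s) W (\<lambda>\<rho>. g i (\<rho> i))" if "i \<in> I" for i
    by (rule linear_map_comp[OF assms(3) coordinate_linear]) (use assms that in auto)
  show "finite {i \<in> I. g i (\<rho> i) \<noteq> \<zero>\<^bsub>W\<^esub>}" if "\<rho> \<in> carrier (\<Gamma> s)" for \<rho>
    using linear_map_zero[OF _ assms(2) assms(3)] assms(1)
    by (intro finite_subset[OF _ bimodule_support[OF that]]) auto
qed (use assms in auto)

lemma bimodule_lift_single:
  assumes "s \<in> carrier G" "module K W" "\<And>i. i \<in> I \<Longrightarrow> linear (A s) W (g i)"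
    and "i \<in> I" "a \<in> carrier (A s)"
  shows "fin_supp_sum W I (\<lambda>j. g j (\<iota> s i a j)) = g i a"
proof -
  have "fin_supp_sum W I (\<lambda>j. g j (\<iota> s i a j)) = g i (\<iota> s i a i)"
    using assms linear_map_zero[OF _ assms(2) assms(3)] linear_map_closed[OF assms(3)]
    by (intro fin_supp_sum_delta) (auto simp: single_def)
  then show ?thesis using assms(4) by (simp add: single_def)
qed

lemma bimodule_linear_eqI:
  assumes s: "s \<in> carrier G" and W: "module K W"
    and g: "linear (\<Gamma> s) W g" and h: "linear (\<Gamma> s) W h"
    and eq: "\<And>i a. \<lbrakk>i \<in> I; a \<in> carrier (A s)\<rbrakk> \<Longrightarrow> g (\<iota> s i a) = h (\<iota> s i a)"
    and x: "x \<in> carrier (\<Gamma> s)"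
  shows "g x = h x"
  using A_ring[OF s] x[unfolded bimodule_carrier]
proof (induction rule: free_module_induct)
  case (single i a)
  then show ?case by (rule eq)
next
  case zero
  then show ?case
    using linear_map_zero[OF _ W g] linear_map_zero[OF _ W h] s by (simp add: bimodule_zero[symmetric])
next
  case (add x y)
  then show ?case
    using linear_map_add[OF g, of x y] linear_map_add[OF h, of x y]
    by (simp add: bimodule_carrier bimodule_add)
qed

section \<open>Convolution with the functionals as linear operators on the components of the
  algebra\<close>

lemma fc_linear: "\<lbrakk>s \<in> carrier G; i \<in> I; j \<in> I\<rbrakk> \<Longrightarrow> linear (A s) (A s) (fc s i j)"
  by (intro fun_conv_linear f_linear) auto

lemma cf_linear: "\<lbrakk>s \<in> carrier G; i \<in> I; j \<in> I\<rbrakk> \<Longrightarrow> linear (A s) (A s) (cf s i j)"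
  by (intro conv_fun_linear f_linear) auto

lemma fc_closed [simp]:
  "\<lbrakk>s \<in> carrier G; i \<in> I; j \<in> I; a \<in> carrier (A s)\<rbrakk> \<Longrightarrow> fc s i j a \<in> carrier (A s)"
  using linear_map_closed[OF fc_linear] .

lemma cf_closed [simp]:
  "\<lbrakk>s \<in> carrier G; i \<in> I; j \<in> I; a \<in> carrier (A s)\<rbrakk> \<Longrightarrow> cf s i j a \<in> carrier (A s)"
  using linear_map_closed[OF cf_linear] .

lemma id_tensor_f_finite:
  assumes V: "module K V" and "i \<in> I" "s \<in> carrier G" "X \<in> carrier (tensor K V (A s))"
  shows "finite {j \<in> I. id_fun V (A s) (f i j s) X \<noteq> \<zero>\<^bsub>V\<^esub>}"
proof (rule finite_support_tensor[OF V _ V _ _ assms(4)])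
  interpret V: module K V by (rule V)
  show "finite {j \<in> I. id_fun V (A s) (f i j s) (pt V (A s) v w) \<noteq> \<zero>\<^bsub>V\<^esub>}"
    if "v \<in> carrier V" "w \<in> carrier (A s)" for v w
    by (rule finite_subset[OF _ f_finite[OF assms(2,3) that(2)]])
      (use assms that in \<open>auto simp: id_tensor_fun_pure f_linear\<close>)
qed (use assms in \<open>auto intro: id_tensor_fun_linear f_linear\<close>)

lemma fun_tensor_f_finite:
  assumes V: "module K V" and "i \<in> I" "s \<in> carrier G" "X \<in> carrier (tensor K (A s) V)"
  shows "finite {j \<in> I. fun_id (A s) V (f i j s) X \<noteq> \<zero>\<^bsub>V\<^esub>}"
proof (rule finite_support_tensor[OF _ V V _ _ assms(4)])
  interpret V: module K V by (rule V)
  show "finite {j \<in> I. fun_id (A s) V (f i j s) (pt (A s) V w v) \<noteq> \<zero>\<^bsub>V\<^esub>}"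
    if "w \<in> carrier (A s)" "v \<in> carrier V" for v w
    by (rule finite_subset[OF _ f_finite[OF assms(2,3) that(1)]])
      (use assms that in \<open>auto simp: fun_tensor_id_pure f_linear\<close>)
qed (use assms in \<open>auto intro: fun_tensor_id_linear f_linear\<close>)

lemma fc_finite:
  "\<lbrakk>s \<in> carrier G; i \<in> I; a \<in> carrier (A s)\<rbrakk> \<Longrightarrow> finite {j \<in> I. fc s i j a \<noteq> \<zero>\<^bsub>A s\<^esub>}"
  unfolding fun_conv_def
  by (rule id_tensor_f_finite) (auto intro: linear_map_closed[OF comult_right_linear])

lemma cf_finite:
  "\<lbrakk>s \<in> carrier G; i \<in> I; a \<in> carrier (A s)\<rbrakk> \<Longrightarrow> finite {j \<in> I. cf s i j a \<noteq> \<zero>\<^bsub>A s\<^esub>}"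
  unfolding conv_fun_def
  by (rule fun_tensor_f_finite) (auto intro: linear_map_closed[OF comult_left_linear])

lemma A_mult_closed [simp]:
  "\<lbrakk>s \<in> carrier G; a \<in> carrier (A s); b \<in> carrier (A s)\<rbrakk> \<Longrightarrow> a \<otimes>\<^bsub>A s\<^esub> b \<in> carrier (A s)"
  using bilinear_map_closed[OF A_mult_bilinear] .

lemma A_one_closed [simp]: "s \<in> carrier G \<Longrightarrow> \<one>\<^bsub>A s\<^esub> \<in> carrier (A s)"
  using ring.ring_simprules(6)[OF A_ring] .

lemma A_mult_zero [simp]:
  assumes "s \<in> carrier G" "a \<in> carrier (A s)"
  shows "a \<otimes>\<^bsub>A s\<^esub> \<zero>\<^bsub>A s\<^esub> = \<zero>\<^bsub>A s\<^esub>" "\<zero>\<^bsub>A s\<^esub> \<otimes>\<^bsub>A s\<^esub> a = \<zero>\<^bsub>A s\<^esub>"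
  using assms ring.ring_simprules(24,25)[OF A_ring] by auto

lemma A_mult_one [simp]:
  assumes "s \<in> carrier G" "a \<in> carrier (A s)"
  shows "a \<otimes>\<^bsub>A s\<^esub> \<one>\<^bsub>A s\<^esub> = a" "\<one>\<^bsub>A s\<^esub> \<otimes>\<^bsub>A s\<^esub> a = a"
  using assms monoid.r_one[OF ring.is_monoid[OF A_ring]] monoid.l_one[OF ring.is_monoid[OF A_ring]]
  by auto

lemma A_mult_assoc:
  assumes "s \<in> carrier G" "a \<in> carrier (A s)" "b \<in> carrier (A s)" "c \<in> carrier (A s)"
  shows "a \<otimes>\<^bsub>A s\<^esub> b \<otimes>\<^bsub>A s\<^esub> c = a \<otimes>\<^bsub>A s\<^esub> (b \<otimes>\<^bsub>A s\<^esub> c)"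
  using assms monoid.m_assoc[OF ring.is_monoid[OF A_ring]] by auto

lemma lact_single:
  "\<lbrakk>s \<in> carrier G; a \<in> carrier (A s); b \<in> carrier (A s)\<rbrakk> \<Longrightarrow>
    lact (\<Gamma> s) b (\<iota> s i a) = \<iota> s i (b \<otimes>\<^bsub>A s\<^esub> a)"
  by (simp add: bimodule_lact single_smult A_ring)

lemma lact_bilinear:
  assumes s: "s \<in> carrier G"
  shows "bilinear (A s) (\<Gamma> s) (\<Gamma> s) (lact (\<Gamma> s))"
proof -
  interpret B: assoc_algebra K "A s" by (rule alg[OF s])
  have closed: "lact (\<Gamma> s) b x \<in> carrier (\<Gamma> s)" if "b \<in> carrier (A s)" "x \<in> carrier (\<Gamma> s)" for b x
    using that by (simp add: bimodule_lact bimodule_carrier free_module_smult_closed A_ring[OF s])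
  show ?thesis
    by (intro bilinear_mapI linear_mapI closed)
      (auto simp: bimodule_lact bimodule_carrier bimodule_add bimodule_smult
        free_module_smult free_module_add free_module_mem_iff fun_eq_iff
        B.B.l_distr B.B.r_distr B.smult_mult_left B.smult_mult_right)
qed

text \<open>The right product of \<open>x\<close> times the i-th basis vector with \<open>b\<close>.
  The coefficient comes last so that \<open>rsum s i b\<close> can serve as the i-th member of a
  family in \<open>bimodule_lift_linear\<close>.\<close>

abbreviation "rsum s i b x \<equiv> fsum (\<Gamma> s) (\<lambda>j. \<iota> s j (x \<otimes>\<^bsub>A s\<^esub> fc s i j b))"

lemma rsum_finite:
  "\<lbrakk>s \<in> carrier G; i \<in> I; a \<in> carrier (A s); b \<in> carrier (A s)\<rbrakk> \<Longrightarrow>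
    finite {j \<in> I. \<iota> s j (a \<otimes>\<^bsub>A s\<^esub> fc s i j b) \<noteq> \<zero>\<^bsub>\<Gamma> s\<^esub>}"
  by (rule finite_subset[OF _ fc_finite[of s i b]]) (auto simp: single_zero)

lemma rsum_bilinear:
  assumes s: "s \<in> carrier G" and i: "i \<in> I"
  shows "bilinear (A s) (A s) (\<Gamma> s) (\<lambda>x b. rsum s i b x)"
proof (rule bilinear_mapI; rule linear_map_fin_supp_sum_fun)
  show "linear (A s) (\<Gamma> s) (\<lambda>x. \<iota> s j (x \<otimes>\<^bsub>A s\<^esub> fc s i j b))" if "b \<in> carrier (A s)" "j \<in> I" for b j
    by (rule linear_map_comp[OF single_linear bilinear_map_left[OF A_mult_bilinear]])
      (use s i that in auto)
  show "linear (A s) (\<Gamma> s) (\<lambda>b. \<iota> s j (x \<otimes>\<^bsub>A s\<^esub> fc s i j b))" if "x \<in> carrier (A s)" "j \<in> I" for x j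
    by (rule linear_map_comp[OF single_linear linear_bilinear_right[OF A_mult_bilinear _ fc_linear]])
      (use s i that in auto)
qed (use s i rsum_finite in auto)

lemma rsum_closed [simp]:
  "\<lbrakk>s \<in> carrier G; i \<in> I; a \<in> carrier (A s); b \<in> carrier (A s)\<rbrakk> \<Longrightarrow> rsum s i b a \<in> carrier (\<Gamma> s)"
  using bilinear_map_closed[OF rsum_bilinear] .

lemma ract_eq:
  assumes s: "s \<in> carrier G" and \<rho>: "\<rho> \<in> carrier (\<Gamma> s)" and b: "b \<in> carrier (A s)"
  shows "ract (\<Gamma> s) \<rho> b = fsum (\<Gamma> s) (\<lambda>i. rsum s i b (\<rho> i))"
proof -
  have \<rho>i: "\<rho> i \<in> carrier (A s)" if "i \<in> I" for i
    using \<rho> that by (simp add: bimodule_carrier free_module_mem_iff)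
  have "ract (\<Gamma> s) \<rho> b = fsum (\<Gamma> s) (\<lambda>i. fsum (\<Gamma> s) (\<lambda>j.
      (\<rho> i \<otimes>\<^bsub>A s\<^esub> fc s i j b) \<odot>\<^bsub>free_module (A s) I\<^esub> free_basis (A s) I j))"
    unfolding fin_supp_sum_bimodule[symmetric] by (simp add: free_bimodule_def Let_def)
  also have "\<dots> = fsum (\<Gamma> s) (\<lambda>i. rsum s i b (\<rho> i))"
    using s b \<rho>i
    by (intro fin_supp_sum_cong[of K]) (auto simp: free_basis_eq_single single_smult A_ring)
  finally show ?thesis .
qed

lemma ract_bilinear:
  assumes s: "s \<in> carrier G"
  shows "bilinear (\<Gamma> s) (A s) (\<Gamma> s) (ract (\<Gamma> s))"
proof (rule bilinear_map_cong[OF ract_eq[OF s]])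
  show "bilinear (\<Gamma> s) (A s) (\<Gamma> s) (\<lambda>\<rho> b. fsum (\<Gamma> s) (\<lambda>i. rsum s i b (\<rho> i)))"
  proof (rule bilinear_mapI)
    show "linear (\<Gamma> s) (\<Gamma> s) (\<lambda>\<rho>. fsum (\<Gamma> s) (\<lambda>i. rsum s i b (\<rho> i)))" if "b \<in> carrier (A s)" for b
      using s that by (intro bimodule_lift_linear bilinear_map_left[OF rsum_bilinear]) auto
    show "linear (A s) (\<Gamma> s) (\<lambda>b. fsum (\<Gamma> s) (\<lambda>i. rsum s i b (\<rho> i)))"
      if \<rho>: "\<rho> \<in> carrier (\<Gamma> s)" for \<rho>
    proof (rule linear_map_fin_supp_sum_fun)
      show "linear (A s) (\<Gamma> s) (\<lambda>b. rsum s i b (\<rho> i))" if "i \<in> I" for i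
        using s \<rho> that
        by (intro bilinear_map_right[OF rsum_bilinear]) (auto simp: bimodule_carrier free_module_mem_iff)
      show "finite {i \<in> I. rsum s i b (\<rho> i) \<noteq> \<zero>\<^bsub>\<Gamma> s\<^esub>}" if "b \<in> carrier (A s)" for b
        using linear_map_zero[OF _ _ bilinear_map_left[OF rsum_bilinear]] s that
        by (intro finite_subset[OF _ bimodule_support[OF \<rho>]]) auto
    qed (use s in auto)
  qed
qed (use s in auto)

lemma ract_single:
  assumes "s \<in> carrier G" "i \<in> I" "a \<in> carrier (A s)" "b \<in> carrier (A s)"
  shows "ract (\<Gamma> s) (\<iota> s i a) b = rsum s i b a"
  using bimodule_lift_single[of s "\<Gamma> s" "\<lambda>i x. rsum s i b x" i a]
    bilinear_map_left[OF rsum_bilinear] assms by (simp add: ract_eq)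

text \<open>\<open>fc\<close> applies \<open>id \<otimes> f\<close> to the coproduct, and the
  coproduct is multiplicative. It remains to see how \<open>id \<otimes> f\<close> acts on a product
  of two tensors; on pure tensors this is \<open>f_mult\<close> in the second factor.\<close>

lemma fc_mult:
  assumes s: "s \<in> carrier G" and ij: "i \<in> I" "j \<in> I" and b: "b \<in> carrier (A s)" "b' \<in> carrier (A s)"
  shows "fc s i j (b \<otimes>\<^bsub>A s\<^esub> b') = fsum (A s) (\<lambda>k. fc s i k b \<otimes>\<^bsub>A s\<^esub> fc s k j b')"
proof -
  let ?T = "AA s e"
  let ?m = "tensor_bilinear K (A s) (A e) (A s) (A e) (A s) (A e) (mult (A s)) (mult (A e))"
  let ?g = "\<lambda>i j. id_fun (A s) (A e) (f i j e)"
  have m: "bilinear ?T ?T ?T ?m"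
    using s by (intro tensor_bilinear_bilinear A_mult_bilinear) auto
  interpret B: assoc_algebra K "A s" by (rule alg[OF s])
  have g: "linear ?T (A s) (?g i j)" if "i \<in> I" "j \<in> I" for i j
    using s that by (intro id_tensor_fun_linear f_linear) auto
  note [simp] = linear_map_closed[OF g]
  \<comment> \<open>Pulling the two functional values out of a product of algebra elements yields
    them in the opposite order from \<open>f_mult\<close>.\<close>
  have smult_swap: "(c \<otimes>\<^bsub>K\<^esub> d) \<odot>\<^bsub>A s\<^esub> z = d \<odot>\<^bsub>A s\<^esub> (c \<odot>\<^bsub>A s\<^esub> z)"
    if "c \<in> carrier K" "d \<in> carrier K" "z \<in> carrier (A s)" for c d z
    using that by (simp add: K.m_comm[of c d] B.smult_assoc1)
  have fin: "finite {k \<in> I. ?g i k X \<otimes>\<^bsub>A s\<^esub> ?g k j Y \<noteq> \<zero>\<^bsub>A s\<^esub>}"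
    if "X \<in> carrier ?T" "Y \<in> carrier ?T" for X Y
    using s ij that by (intro finite_subset[OF _ id_tensor_f_finite[of "A s" i "e" X]]) auto
  have lin1: "linear ?T (A s) (\<lambda>X. fsum (A s) (\<lambda>k. ?g i k X \<otimes>\<^bsub>A s\<^esub> ?g k j Y))"
    if "Y \<in> carrier ?T" for Y
    using s ij that fin
    by (intro linear_map_fin_supp_sum_fun linear_bilinear_left[OF A_mult_bilinear] g) auto
  have lin2: "linear ?T (A s) (\<lambda>Y. fsum (A s) (\<lambda>k. ?g i k X \<otimes>\<^bsub>A s\<^esub> ?g k j Y))"
    if "X \<in> carrier ?T" for X
    using s ij that fin
    by (intro linear_map_fin_supp_sum_fun linear_bilinear_right[OF A_mult_bilinear] g) auto
  have pure: "?g i j (?m (pure s e x x') (pure s e y y')) =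
      fsum (A s) (\<lambda>k. ?g i k (pure s e x x') \<otimes>\<^bsub>A s\<^esub> ?g k j (pure s e y y'))"
    if xy: "x \<in> carrier (A s)" "x' \<in> carrier (A e)" "y \<in> carrier (A s)" "y' \<in> carrier (A e)"
    for x x' y y'
  proof -
    have "?g i j (?m (pure s e x x') (pure s e y y')) = f i j e (x' \<otimes>\<^bsub>A e\<^esub> y') \<odot>\<^bsub>A s\<^esub> (x \<otimes>\<^bsub>A s\<^esub> y)"
      using s ij xy by (simp add: tensor_bilinear_pure A_mult_bilinear id_tensor_fun_pure f_linear)
    also have "f i j e (x' \<otimes>\<^bsub>A e\<^esub> y') = fsum K (\<lambda>k. f i k e x' \<otimes>\<^bsub>K\<^esub> f k j e y')"
      using ij xy by (simp add: f_mult)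
    \<comment> \<open>The same sum, read in \<open>K\<close> as a module over itself, so that the
      linear map sending a scalar \<open>c\<close> to the multiple by \<open>c\<close> of a fixed
      element can be moved inside.\<close>
    also have "\<dots> = fsum (ground K) (\<lambda>k. f i k e x' \<otimes>\<^bsub>K\<^esub> f k j e y')"
      by (simp add: fin_supp_sum_def finsum_def finprod_def ground_def)
    also have "\<dots> \<odot>\<^bsub>A s\<^esub> (x \<otimes>\<^bsub>A s\<^esub> y) = fsum (A s) (\<lambda>k. (f i k e x' \<otimes>\<^bsub>K\<^esub> f k j e y') \<odot>\<^bsub>A s\<^esub> (x \<otimes>\<^bsub>A s\<^esub> y))"
    proof (rule linear_map_fin_supp_sum)
      show "linear (ground K) (A s) (\<lambda>c. c \<odot>\<^bsub>A s\<^esub> (x \<otimes>\<^bsub>A s\<^esub> y))"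
        using s xy by (intro linear_map_smult_left linear_map_id) auto
      show "(\<lambda>k. f i k e x' \<otimes>\<^bsub>K\<^esub> f k j e y') \<in> I \<rightarrow> carrier (ground K)"
        using ij xy f_closed by (auto simp: ground_def)
      show "finite {k \<in> I. f i k e x' \<otimes>\<^bsub>K\<^esub> f k j e y' \<noteq> \<zero>\<^bsub>ground K\<^esub>}"
        by (rule finite_subset[OF _ f_finite[of i "e" x']])
          (use ij xy f_closed in \<open>auto simp: ground_def\<close>)
    qed (use s in auto)
    also have "\<dots> = fsum (A s) (\<lambda>k. ?g i k (pure s e x x') \<otimes>\<^bsub>A s\<^esub> ?g k j (pure s e y y'))"
      using s ij xy f_closed
      by (intro fin_supp_sum_cong[of K])
        (auto simp: id_tensor_fun_pure f_linear B.smult_mult_left B.smult_mult_right smult_swap)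
    finally show ?thesis .
  qed
  have "?g i j (?m X Y) = fsum (A s) (\<lambda>k. ?g i k X \<otimes>\<^bsub>A s\<^esub> ?g k j Y)"
    if X: "X \<in> carrier ?T" and Y: "Y \<in> carrier ?T" for X Y
  proof (rule tensor_linear_eqI[of K "A s" "A e" "A s" "\<lambda>X. ?g i j (?m X Y)"])
    fix x x' assume x: "x \<in> carrier (A s)" "x' \<in> carrier (A e)"
    have X': "pure s e x x' \<in> carrier ?T" (is "?X \<in> _")
      using s by (intro pure_tensor_closed) auto
    show "?g i j (?m ?X Y) = fsum (A s) (\<lambda>k. ?g i k ?X \<otimes>\<^bsub>A s\<^esub> ?g k j Y)"
      by (rule tensor_linear_eqI[of K "A s" "A e" "A s" "\<lambda>Y. ?g i j (?m ?X Y)",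
            OF _ _ linear_map_comp[OF g bilinear_map_right[OF m X']] lin2[OF X'] pure Y])
        (use s ij x in auto)
  qed (use s ij X Y lin1 linear_map_comp[OF g bilinear_map_left[OF m Y]] in auto)
  then show ?thesis
    using linear_map_closed[OF comult_right_linear[OF s] b(1)]
      linear_map_closed[OF comult_right_linear[OF s] b(2)] comult_mult[of s "e" b b'] s b
    unfolding fun_conv_def by simp
qed

lemma fc_one:
  assumes "s \<in> carrier G" "i \<in> I" "j \<in> I"
  shows "fc s i j \<one>\<^bsub>A s\<^esub> = (if i = j then \<one>\<^bsub>A s\<^esub> else \<zero>\<^bsub>A s\<^esub>)"
proof -
  interpret B: assoc_algebra K "A s" by (rule alg[OF assms(1)])
  have "fc s i j \<one>\<^bsub>A s\<^esub> = f i j e \<one>\<^bsub>A e\<^esub> \<odot>\<^bsub>A s\<^esub> \<one>\<^bsub>A s\<^esub>"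
    using assms comult_one[of s e] by (simp add: fun_conv_def id_tensor_fun_pure f_linear)
  then show ?thesis using assms by (simp add: f_one)
qed

text \<open>By \<open>fc_mult\<close> the matrix with entries \<open>fc s i j b\<close> is
  multiplicative in \<open>b\<close>, and the right action multiplies rows of coefficients by that
  matrix. What is left is an interchange of the sums over the intermediate and the final
  index.\<close>

lemma ract_mult:
  assumes s: "s \<in> carrier G" and b: "b \<in> carrier (A s)" "b' \<in> carrier (A s)"
    and x: "x \<in> carrier (\<Gamma> s)"
  shows "ract (\<Gamma> s) x (b \<otimes>\<^bsub>A s\<^esub> b') = ract (\<Gamma> s) (ract (\<Gamma> s) x b) b'"
proof (rule bimodule_linear_eqI[OF s _ _ _ _ x])
  show "linear (\<Gamma> s) (\<Gamma> s) (\<lambda>x. ract (\<Gamma> s) x (b \<otimes>\<^bsub>A s\<^esub> b'))"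
    using s b by (intro bilinear_map_left[OF ract_bilinear]) auto
  show "linear (\<Gamma> s) (\<Gamma> s) (\<lambda>x. ract (\<Gamma> s) (ract (\<Gamma> s) x b) b')"
    using s b by (intro linear_bilinear_left[OF ract_bilinear] bilinear_map_left[OF ract_bilinear]) auto
next
  fix i a assume ia: "i \<in> I" "a \<in> carrier (A s)"
  let ?t = "\<lambda>k j. \<iota> s j (a \<otimes>\<^bsub>A s\<^esub> fc s i k b \<otimes>\<^bsub>A s\<^esub> fc s k j b')"
  \<comment> \<open>Finitely many intermediate indices k survive for \<open>b\<close>; for each of
    them finitely many final indices j survive for \<open>b'\<close>.\<close>
  let ?B = "{k \<in> I. fc s i k b \<noteq> \<zero>\<^bsub>A s\<^esub>}"
  let ?C = "\<Union>k\<in>?B. {j \<in> I. fc s k j b' \<noteq> \<zero>\<^bsub>A s\<^esub>}"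
  have fin: "finite ?B" "finite ?C" using s b ia fc_finite by auto
  have "\<iota> s j (a \<otimes>\<^bsub>A s\<^esub> fc s i j (b \<otimes>\<^bsub>A s\<^esub> b')) = fsum (\<Gamma> s) (\<lambda>k. ?t k j)" if j: "j \<in> I" for j
  proof -
    have "\<iota> s j (a \<otimes>\<^bsub>A s\<^esub> fc s i j (b \<otimes>\<^bsub>A s\<^esub> b')) =
        \<iota> s j (a \<otimes>\<^bsub>A s\<^esub> fsum (A s) (\<lambda>k. fc s i k b \<otimes>\<^bsub>A s\<^esub> fc s k j b'))"
      using s ia b j by (simp add: fc_mult)
    also have "\<dots> = fsum (\<Gamma> s) (\<lambda>k. \<iota> s j (a \<otimes>\<^bsub>A s\<^esub> (fc s i k b \<otimes>\<^bsub>A s\<^esub> fc s k j b')))"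
    proof (rule linear_map_fin_supp_sum[where f = "\<lambda>x. \<iota> s j (a \<otimes>\<^bsub>A s\<^esub> x)"])
      show "linear (A s) (\<Gamma> s) (\<lambda>x. \<iota> s j (a \<otimes>\<^bsub>A s\<^esub> x))"
        by (rule linear_map_comp[OF single_linear bilinear_map_right[OF A_mult_bilinear]])
          (use s ia in auto)
      show "finite {k \<in> I. fc s i k b \<otimes>\<^bsub>A s\<^esub> fc s k j b' \<noteq> \<zero>\<^bsub>A s\<^esub>}"
        by (rule finite_subset[OF _ fin(1)]) (use s b j in auto)
    qed (use s b ia j in auto)
    also have "\<dots> = fsum (\<Gamma> s) (\<lambda>k. ?t k j)"
      using s b ia j by (intro fin_supp_sum_cong[of K]) (auto simp: A_mult_assoc)
    finally show ?thesis .
  qed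
  then have "rsum s i (b \<otimes>\<^bsub>A s\<^esub> b') a = fsum (\<Gamma> s) (\<lambda>j. fsum (\<Gamma> s) (\<lambda>k. ?t k j))"
    using s b ia by (intro fin_supp_sum_cong[of K]) (auto intro!: fin_supp_sum_closed[of K])
  also have "\<dots> = fsum (\<Gamma> s) (\<lambda>k. fsum (\<Gamma> s) (?t k))"
    by (rule fin_supp_sum_swap[OF bimodule_module[OF s] _ fin(2) fin(1)]) (use s b ia in \<open>auto simp: single_zero\<close>)
  also have "\<dots> = fsum (\<Gamma> s) (\<lambda>k. ract (\<Gamma> s) (\<iota> s k (a \<otimes>\<^bsub>A s\<^esub> fc s i k b)) b')"
    using s b ia by (intro fin_supp_sum_cong[of K]) (auto simp: ract_single)
  also have "\<dots> = ract (\<Gamma> s) (rsum s i b a) b'"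
    using s b ia rsum_finite
    by (intro linear_map_fin_supp_sum[OF _ _ bilinear_map_left[OF ract_bilinear], symmetric]) auto
  finally show "ract (\<Gamma> s) (\<iota> s i a) (b \<otimes>\<^bsub>A s\<^esub> b') = ract (\<Gamma> s) (ract (\<Gamma> s) (\<iota> s i a) b) b'"
    using s b ia by (simp add: ract_single)
qed (use s in auto)

lemma ract_one:
  assumes s: "s \<in> carrier G" and x: "x \<in> carrier (\<Gamma> s)"
  shows "ract (\<Gamma> s) x \<one>\<^bsub>A s\<^esub> = x"
proof (rule bimodule_linear_eqI[OF s _ _ _ _ x])
  show "linear (\<Gamma> s) (\<Gamma> s) (\<lambda>x. ract (\<Gamma> s) x \<one>\<^bsub>A s\<^esub>)"
    using s by (intro bilinear_map_left[OF ract_bilinear]) auto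
  fix i a assume ia: "i \<in> I" "a \<in> carrier (A s)"
  have "rsum s i \<one>\<^bsub>A s\<^esub> a = \<iota> s i (a \<otimes>\<^bsub>A s\<^esub> fc s i i \<one>\<^bsub>A s\<^esub>)"
    using s ia by (intro fin_supp_sum_delta[of K]) (auto simp: fc_one single_zero)
  then show "ract (\<Gamma> s) (\<iota> s i a) \<one>\<^bsub>A s\<^esub> = \<iota> s i a"
    using s ia by (simp add: ract_single fc_one)
qed (use s in \<open>auto intro: linear_map_id\<close>)

lemma lact_ract:
  assumes s: "s \<in> carrier G" and b: "b \<in> carrier (A s)" "b' \<in> carrier (A s)"
    and x: "x \<in> carrier (\<Gamma> s)"
  shows "ract (\<Gamma> s) (lact (\<Gamma> s) b x) b' = lact (\<Gamma> s) b (ract (\<Gamma> s) x b')"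
proof (rule bimodule_linear_eqI[OF s _ _ _ _ x])
  show "linear (\<Gamma> s) (\<Gamma> s) (\<lambda>x. ract (\<Gamma> s) (lact (\<Gamma> s) b x) b')"
    using s b by (intro linear_bilinear_left[OF ract_bilinear] bilinear_map_right[OF lact_bilinear]) auto
  show "linear (\<Gamma> s) (\<Gamma> s) (\<lambda>x. lact (\<Gamma> s) b (ract (\<Gamma> s) x b'))"
    using s b by (intro linear_bilinear_right[OF lact_bilinear] bilinear_map_left[OF ract_bilinear]) auto
  fix i a assume ia: "i \<in> I" "a \<in> carrier (A s)"
  have "lact (\<Gamma> s) b (rsum s i b' a) = fsum (\<Gamma> s) (\<lambda>j. lact (\<Gamma> s) b (\<iota> s j (a \<otimes>\<^bsub>A s\<^esub> fc s i j b')))"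
    using s b ia rsum_finite
    by (intro linear_map_fin_supp_sum[OF _ _ bilinear_map_right[OF lact_bilinear]]) auto
  also have "\<dots> = rsum s i b' (b \<otimes>\<^bsub>A s\<^esub> a)"
    using s b ia by (intro fin_supp_sum_cong[of K]) (auto simp: lact_single A_mult_assoc)
  finally show "ract (\<Gamma> s) (lact (\<Gamma> s) b (\<iota> s i a)) b' = lact (\<Gamma> s) b (ract (\<Gamma> s) (\<iota> s i a) b')"
    using s b ia by (simp add: ract_single lact_single)
qed (use s in auto)

lemma free_bimodule_bimodule:
  assumes s: "s \<in> carrier G"
  shows "bimodule K (A s) (\<Gamma> s)"
proof -
  note L = lact_bilinear[OF s] and R = ract_bilinear[OF s]
  note simps = bimodule_lact free_module_smult bimodule_carrier free_module_mem_iff fun_eq_iff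
  have "lact (\<Gamma> s) (b \<otimes>\<^bsub>A s\<^esub> b') x = lact (\<Gamma> s) b (lact (\<Gamma> s) b' x)"
    if "b \<in> carrier (A s)" "b' \<in> carrier (A s)" "x \<in> carrier (\<Gamma> s)" for b b' x
    using s that by (auto simp: simps A_mult_assoc)
  moreover have "lact (\<Gamma> s) \<one>\<^bsub>A s\<^esub> x = x" if "x \<in> carrier (\<Gamma> s)" for x
    using s that by (auto simp: simps extensional_def)
  ultimately show ?thesis
    by (intro bimodule.intro bimodule_axioms.intro alg bimodule_module s)
      (simp_all add: s ract_mult ract_one lact_ract bilinear_map_closed[OF L] bilinear_map_closed[OF R]
        linear_map_add[OF bilinear_map_left[OF L]] linear_map_add[OF bilinear_map_right[OF L]]
        linear_map_add[OF bilinear_map_left[OF R]] linear_map_add[OF bilinear_map_right[OF R]]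
        linear_map_smult[OF bilinear_map_left[OF L]] linear_map_smult[OF bilinear_map_right[OF L]]
        linear_map_smult[OF bilinear_map_left[OF R]] linear_map_smult[OF bilinear_map_right[OF R]])
qed

lemma free_bimodule_graded: "graded_bimodule K G A \<Delta> \<epsilon> S \<Gamma>"
  by (intro graded_bimodule.intro graded_bimodule_axioms.intro hopf_group_coalgebra_axioms
      free_bimodule_bimodule)

section \<open>Coassociativity and convolution\<close>

lemma comult_closed:
  "\<lbrakk>s \<in> carrier G; t \<in> carrier G; a \<in> carrier (A (s \<cdot> t))\<rbrakk> \<Longrightarrow> \<Delta> s t a \<in> carrier (AA s t)"
  using linear_map_closed[OF comult_linear] .

lemma linear_comult:
  assumes "s \<in> carrier G" "t \<in> carrier G" "linear Z (A (s \<cdot> t)) h"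
  shows "linear Z (AA s t) (\<lambda>z. \<Delta> s t (h z))"
  by (rule linear_map_comp[OF comult_linear assms(3)]) (fact assms)+

text \<open>Apply \<open>id \<otimes> id \<otimes> f\<close> to both sides of coassociativity for
  the degrees s, t, e. Splitting off the last factor first gives the left side, splitting it off
  from the second factor gives the right side.\<close>

lemma comult_fc:
  assumes G: "s \<in> carrier G" "t \<in> carrier G" and ij: "i \<in> I" "j \<in> I"
    and b: "b \<in> carrier (A (s \<cdot> t))"
  shows "\<Delta> s t (fc (s \<cdot> t) i j b) = Amap s t (\<lambda>x. x) (fc t i j) (\<Delta> s t b)"
proof -
  let ?f = "f i j e"
  let ?g = "id_fun (A t) (A e) ?f"
  let ?H = "tmap (A s) (AA t e) (A s) (A t) (\<lambda>x. x) ?g"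
  let ?a = "assoc (A s) (A t) (A e)"
  let ?D1 = "tmap (A (s \<cdot> t)) (A e) (AA s t) (A e) (\<Delta> s t) (\<lambda>x. x)"
  let ?D2 = "tmap (A s) (A t) (A s) (AA t e) (\<lambda>x. x) (\<Delta> t e)"
  have f: "linear (A e) (ground K) ?f" using ij by (rule f_linear) auto
  note lin = linear_intros f comult_linear[OF G] comult_right_linear fc_linear linear_comult
  \<comment> \<open>\<open>Y\<close> will be the coproduct of \<open>v\<close>, which need not be
    pure, so the contraction of the last factor is evaluated for arbitrary \<open>Y\<close>.\<close>
  have inner: "?H (?a (pt (AA s t) (A e) Y w)) = ?f w \<odot>\<^bsub>AA s t\<^esub> Y"
    if Y: "Y \<in> carrier (AA s t)" and w: "w \<in> carrier (A e)" for Y w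
  proof (rule tensor_linear_eqI[OF _ _ _ _ _ Y])
    have "linear (AA s t) (AA s t) (\<lambda>Y. ?f w \<odot>\<^bsub>AA s t\<^esub> Y)"
      using G ij w f_closed by (intro linear_map_smult_right) auto
    then show "linear (AA s t) (AA s t) (\<lambda>Y. ?f w \<odot>\<^bsub>AA s t\<^esub> Y)" .
    show "linear (AA s t) (AA s t) (\<lambda>Y. ?H (?a (pt (AA s t) (A e) Y w)))"
      using G w by (intro lin) auto
  qed (use G ij w f f_closed in \<open>auto simp: tensor_assoc_pure tensor_map_pure id_tensor_fun_pure
      id_tensor_fun_linear linear_map_id pure_tensor_closed pure_tensor_smult_right\<close>)
  have "?H (?a (?D1 (\<Delta> (s \<cdot> t) e b))) = \<Delta> s t (fc (s \<cdot> t) i j b)"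
    unfolding fun_conv_def
  proof (rule tensor_linear_eqI[of K "A (s \<cdot> t)" "A e" "AA s t"
        "\<lambda>Z. ?H (?a (?D1 Z))" "\<lambda>Z. \<Delta> s t (id_fun (A (s \<cdot> t)) (A e) ?f Z)"])
    show "linear (AA (s \<cdot> t) e) (AA s t) (\<lambda>Z. ?H (?a (?D1 Z)))"
      using G by (intro lin) auto
    show "linear (AA (s \<cdot> t) e) (AA s t) (\<lambda>Z. \<Delta> s t (id_fun (A (s \<cdot> t)) (A e) ?f Z))"
      using G by (intro lin) auto
    show "?H (?a (?D1 (pure (s \<cdot> t) e v w))) =
        \<Delta> s t (id_fun (A (s \<cdot> t)) (A e) ?f (pure (s \<cdot> t) e v w))"
      if "v \<in> carrier (A (s \<cdot> t))" "w \<in> carrier (A e)" for v w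
      using that G ij f f_closed
      by (simp add: tensor_map_pure comult_linear linear_map_id inner comult_closed id_tensor_fun_pure
          linear_map_smult[OF comult_linear])
  qed (use G b linear_map_closed[OF comult_right_linear] in auto)
  moreover have "?H (?D2 (\<Delta> s t b)) = Amap s t (\<lambda>x. x) (fc t i j) (\<Delta> s t b)"
  proof (rule tensor_linear_eqI[of K "A s" "A t" "AA s t" "\<lambda>Z. ?H (?D2 Z)"])
    show "linear (AA s t) (AA s t) (\<lambda>Z. ?H (?D2 Z))"
      using G by (intro lin) auto
    show "linear (AA s t) (AA s t) (Amap s t (\<lambda>x. x) (fc t i j))"
      using G ij by (intro lin tensor_map_linear) auto
    show "?H (?D2 (pure s t v w)) = Amap s t (\<lambda>x. x) (fc t i j) (pure s t v w)"
      if "v \<in> carrier (A s)" "w \<in> carrier (A t)" for v w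
      using that G ij f comult_closed[of t e w]
      by (simp add: tensor_map_pure comult_right_linear linear_map_id id_tensor_fun_linear fc_linear)
        (simp add: fun_conv_def)
  qed (use G b comult_closed in auto)
  ultimately show ?thesis using coassoc[of s t e b] G b by simp
qed

text \<open>Coassociativity for the degrees s, e, t, with the functional applied to the middle
  factor. The middle factor can be split off from the right factor, which gives \<open>cf\<close>
  there, or from the left factor, which gives \<open>fc\<close> there.\<close>

lemma comult_cf_fc:
  assumes G: "s \<in> carrier G" "t \<in> carrier G" and ij: "i \<in> I" "j \<in> I"
    and b: "b \<in> carrier (A (s \<cdot> t))"
  shows "Amap s t (\<lambda>x. x) (cf t i j) (\<Delta> s t b) = Amap s t (fc s i j) (\<lambda>x. x) (\<Delta> s t b)"
proof -
  let ?f = "f i j e"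
  let ?T = "AA s t"
  let ?g = "fun_id (A e) (A t) ?f"
  let ?H = "tmap (A s) (AA e t) (A s) (A t) (\<lambda>x. x) ?g"
  let ?a = "assoc (A s) (A e) (A t)"
  let ?D1 = "tmap (A s) (A t) (AA s e) (A t) (\<Delta> s e) (\<lambda>x. x)"
  let ?D2 = "tmap (A s) (A t) (A s) (AA e t) (\<lambda>x. x) (\<Delta> e t)"
  have f: "linear (A e) (ground K) ?f" using ij by (rule f_linear) auto
  note lin = linear_intros f comult_linear[OF G] comult_right_linear comult_left_linear
    fc_linear cf_linear linear_comult
  \<comment> \<open>The value of the functional is a scalar and crosses the tensor sign from the
    right factor to the left one.\<close>
  have inner: "?H (?a (pt (AA s e) (A t) Y w)) = pure s t (id_fun (A s) (A e) ?f Y) w"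
    if Y: "Y \<in> carrier (AA s e)" and w: "w \<in> carrier (A t)" for Y w
  proof (rule tensor_linear_eqI[OF _ _ _ _ _ Y])
    show "linear (AA s e) ?T (\<lambda>Y. pure s t (id_fun (A s) (A e) ?f Y) w)"
      using G w by (intro lin) auto
    show "linear (AA s e) ?T (\<lambda>Y. ?H (?a (pt (AA s e) (A t) Y w)))"
      using G w by (intro lin) auto
  qed (use G ij w f f_closed in \<open>auto simp: tensor_assoc_pure tensor_map_pure id_tensor_fun_pure
      fun_tensor_id_pure fun_tensor_id_linear linear_map_id pure_tensor_closed
      pure_tensor_smult_right pure_tensor_smult_left\<close>)
  have "?H (?a (?D1 (\<Delta> s t b))) = Amap s t (fc s i j) (\<lambda>x. x) (\<Delta> s t b)"
  proof (rule tensor_linear_eqI[of K "A s" "A t" ?T "\<lambda>Z. ?H (?a (?D1 Z))"])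
    show "linear ?T ?T (\<lambda>Z. ?H (?a (?D1 Z)))"
      using G by (intro lin) auto
    show "linear ?T ?T (Amap s t (fc s i j) (\<lambda>x. x))"
      using G ij by (intro lin tensor_map_linear) auto
    show "?H (?a (?D1 (pure s t v w))) = Amap s t (fc s i j) (\<lambda>x. x) (pure s t v w)"
      if "v \<in> carrier (A s)" "w \<in> carrier (A t)" for v w
      using that G ij comult_closed[of s e v]
      by (simp add: tensor_map_pure comult_right_linear linear_map_id inner fc_linear)
        (simp add: fun_conv_def)
  qed (use G b comult_closed in auto)
  moreover have "?H (?D2 (\<Delta> s t b)) = Amap s t (\<lambda>x. x) (cf t i j) (\<Delta> s t b)"
  proof (rule tensor_linear_eqI[of K "A s" "A t" ?T "\<lambda>Z. ?H (?D2 Z)"])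
    show "linear ?T ?T (\<lambda>Z. ?H (?D2 Z))"
      using G by (intro lin) auto
    show "linear ?T ?T (Amap s t (\<lambda>x. x) (cf t i j))"
      using G ij by (intro lin tensor_map_linear) auto
    show "?H (?D2 (pure s t v w)) = Amap s t (\<lambda>x. x) (cf t i j) (pure s t v w)"
      if "v \<in> carrier (A s)" "w \<in> carrier (A t)" for v w
      using that G ij f comult_closed[of e t w]
      by (simp add: tensor_map_pure comult_left_linear linear_map_id fun_tensor_id_linear cf_linear)
        (simp add: conv_fun_def)
  qed (use G b comult_closed in auto)
  ultimately show ?thesis using coassoc[of s e t b] G b by simp
qed

section \<open>The left coaction\<close>

abbreviation "lactl s t \<equiv> lact_alg_mod K (A s) (A t) (\<Gamma> t)"
abbreviation "ractl s t \<equiv> ract_alg_mod K (A s) (A t) (\<Gamma> t)"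
abbreviation "lactr s t \<equiv> lact_mod_alg K (A s) (A t) (\<Gamma> s)"
abbreviation "ractr s t \<equiv> ract_mod_alg K (A s) (A t) (\<Gamma> s)"

lemma lact_alg_mod_bilinear:
  "\<lbrakk>s \<in> carrier G; t \<in> carrier G\<rbrakk> \<Longrightarrow> bilinear (AA s t) (A\<Gamma> s t) (A\<Gamma> s t) (lactl s t)"
  unfolding lact_alg_mod_def by (intro tensor_bilinear_bilinear A_mult_bilinear lact_bilinear) auto

lemma lact_alg_mod_pure:
  "\<lbrakk>s \<in> carrier G; t \<in> carrier G; a \<in> carrier (A s); b \<in> carrier (A t);
    a' \<in> carrier (A s); x \<in> carrier (\<Gamma> t)\<rbrakk> \<Longrightarrow> lactl s t (pure s t a b) (pt (A s) (\<Gamma> t) a' x) =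
      pt (A s) (\<Gamma> t) (a \<otimes>\<^bsub>A s\<^esub> a') (lact (\<Gamma> t) b x)"
  unfolding lact_alg_mod_def by (intro tensor_bilinear_pure A_mult_bilinear lact_bilinear) auto

lemma ract_alg_mod_bilinear:
  "\<lbrakk>s \<in> carrier G; t \<in> carrier G\<rbrakk> \<Longrightarrow> bilinear (A\<Gamma> s t) (AA s t) (A\<Gamma> s t) (ractl s t)"
  unfolding ract_alg_mod_def by (intro tensor_bilinear_bilinear A_mult_bilinear ract_bilinear) auto

lemma ract_alg_mod_pure:
  "\<lbrakk>s \<in> carrier G; t \<in> carrier G; a \<in> carrier (A s); b \<in> carrier (A t);
    a' \<in> carrier (A s); x \<in> carrier (\<Gamma> t)\<rbrakk> \<Longrightarrow> ractl s t (pt (A s) (\<Gamma> t) a' x) (pure s t a b) =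
      pt (A s) (\<Gamma> t) (a' \<otimes>\<^bsub>A s\<^esub> a) (ract (\<Gamma> t) x b)"
  unfolding ract_alg_mod_def by (intro tensor_bilinear_pure A_mult_bilinear ract_bilinear) auto

abbreviation "tmult s t \<equiv>
  tensor_bilinear K (A s) (A t) (A s) (A t) (A s) (A t) (mult (A s)) (mult (A t))"

lemma tmult_bilinear:
  "\<lbrakk>s \<in> carrier G; t \<in> carrier G\<rbrakk> \<Longrightarrow> bilinear (AA s t) (AA s t) (AA s t) (tmult s t)"
  by (intro tensor_bilinear_bilinear A_mult_bilinear) auto

lemma tmult_pure:
  "\<lbrakk>s \<in> carrier G; t \<in> carrier G; a \<in> carrier (A s); b \<in> carrier (A t);
    a' \<in> carrier (A s); b' \<in> carrier (A t)\<rbrakk> \<Longrightarrow> tmult s t (pure s t a b) (pure s t a' b') =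
      pure s t (a \<otimes>\<^bsub>A s\<^esub> a') (b \<otimes>\<^bsub>A t\<^esub> b')"
  by (intro tensor_bilinear_pure A_mult_bilinear) auto

abbreviation "TL s t i \<equiv> tmap (A s) (A t) (A s) (\<Gamma> t) (\<lambda>x. x) (\<iota> t i)"

lemma TL_linear:
  "\<lbrakk>s \<in> carrier G; t \<in> carrier G\<rbrakk> \<Longrightarrow> linear (AA s t) (A\<Gamma> s t) (TL s t i)"
  by (intro tensor_map_linear single_linear linear_map_id) auto

lemma TL_pure:
  "\<lbrakk>s \<in> carrier G; t \<in> carrier G; a \<in> carrier (A s); b \<in> carrier (A t)\<rbrakk> \<Longrightarrow>
    TL s t i (pure s t a b) = pt (A s) (\<Gamma> t) a (\<iota> t i b)"
  by (intro tensor_map_pure single_linear linear_map_id) auto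

lemma TL_closed [simp]:
  "\<lbrakk>s \<in> carrier G; t \<in> carrier G; X \<in> carrier (AA s t)\<rbrakk> \<Longrightarrow> TL s t i X \<in> carrier (A\<Gamma> s t)"
  using linear_map_closed[OF TL_linear] .

text \<open>On pure tensors, a \<otimes> b times 1 \<otimes> \<omega> is a \<otimes> b\<omega>. The
  summands in the definition of the left coaction thereby become values of a fixed linear map at
  coproducts.\<close>

lemma lact_alg_mod_unit:
  assumes G: "s \<in> carrier G" "t \<in> carrier G" and X: "X \<in> carrier (AA s t)"
  shows "lactl s t X (pt (A s) (\<Gamma> t) \<one>\<^bsub>A s\<^esub> (free_basis (A t) I i)) = TL s t i X"
  by (rule tensor_linear_eqI[OF _ _ bilinear_map_left[OF lact_alg_mod_bilinear] TL_linear _ X])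
    (use G in \<open>simp_all add: free_basis_eq_single lact_alg_mod_pure TL_pure lact_single\<close>)

lemma left_coact_eq:
  assumes G: "s \<in> carrier G" "t \<in> carrier G" and \<rho>: "\<rho> \<in> carrier (\<Gamma> (s \<cdot> t))"
  shows "\<Delta>l s t \<rho> = fsum (A\<Gamma> s t) (\<lambda>i. TL s t i (\<Delta> s t (\<rho> i)))"
  unfolding free_left_coact_def Let_def
  using G \<rho> by (intro fin_supp_sum_cong[of K])
    (auto simp: bimodule_carrier free_module_mem_iff lact_alg_mod_unit comult_closed)

lemma left_coact_linear:
  assumes G: "s \<in> carrier G" "t \<in> carrier G"
  shows "linear (\<Gamma> (s \<cdot> t)) (A\<Gamma> s t) (\<Delta>l s t)"
  by (rule linear_map_cong[OF _ _ left_coact_eq[OF G]])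
    (use G in \<open>auto intro!: bimodule_lift_linear linear_map_comp[OF TL_linear comult_linear]\<close>)

lemma left_coact_closed [simp]:
  "\<lbrakk>s \<in> carrier G; t \<in> carrier G; \<rho> \<in> carrier (\<Gamma> (s \<cdot> t))\<rbrakk> \<Longrightarrow> \<Delta>l s t \<rho> \<in> carrier (A\<Gamma> s t)"
  using linear_map_closed[OF left_coact_linear] .

lemma left_coact_single:
  assumes G: "s \<in> carrier G" "t \<in> carrier G" and i: "i \<in> I" and a: "a \<in> carrier (A (s \<cdot> t))"
  shows "\<Delta>l s t (\<iota> (s \<cdot> t) i a) = TL s t i (\<Delta> s t a)"
  using G i a bimodule_lift_single[of "s \<cdot> t" "A\<Gamma> s t" "\<lambda>i x. TL s t i (\<Delta> s t x)" i a]
  by (simp add: left_coact_eq linear_map_comp[OF TL_linear comult_linear])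

lemma TL_tmult:
  assumes G: "s \<in> carrier G" "t \<in> carrier G" and XY: "X \<in> carrier (AA s t)" "Y \<in> carrier (AA s t)"
  shows "TL s t i (tmult s t X Y) = lactl s t X (TL s t i Y)"
proof (rule tensor_bilinear_eqI[of K "A s" "A t" "A s" "A t", OF _ _ _ _ _ _ _ _ _ XY])
  let ?T = "AA s t" and ?U = "A\<Gamma> s t"
  show "linear ?T ?U (\<lambda>X. TL s t i (tmult s t X Y))" if "Y \<in> carrier ?T" for Y
    using G that by (intro linear_map_comp[OF TL_linear bilinear_map_left[OF tmult_bilinear]])
  show "linear ?T ?U (\<lambda>Y. TL s t i (tmult s t X Y))" if "X \<in> carrier ?T" for X
    using G that by (intro linear_map_comp[OF TL_linear bilinear_map_right[OF tmult_bilinear]])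
  show "linear ?T ?U (\<lambda>X. lactl s t X (TL s t i Y))" if "Y \<in> carrier ?T" for Y
    using G that by (intro bilinear_map_left[OF lact_alg_mod_bilinear]) auto
  show "linear ?T ?U (\<lambda>Y. lactl s t X (TL s t i Y))" if "X \<in> carrier ?T" for X
    using G that by (intro linear_bilinear_right[OF lact_alg_mod_bilinear] TL_linear) auto
qed (use G in \<open>auto simp: tmult_pure TL_pure lact_alg_mod_pure lact_single\<close>)

lemma left_coact_lact:
  assumes G: "s \<in> carrier G" "t \<in> carrier G" and a: "a \<in> carrier (A (s \<cdot> t))"
    and \<rho>: "\<rho> \<in> carrier (\<Gamma> (s \<cdot> t))"
  shows "\<Delta>l s t (lact (\<Gamma> (s \<cdot> t)) a \<rho>) = lactl s t (\<Delta> s t a) (\<Delta>l s t \<rho>)"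
proof (rule bimodule_linear_eqI[OF _ _ _ _ _ \<rho>])
  show "linear (\<Gamma> (s \<cdot> t)) (A\<Gamma> s t) (\<lambda>\<rho>. \<Delta>l s t (lact (\<Gamma> (s \<cdot> t)) a \<rho>))"
    using G a by (intro linear_map_comp[OF left_coact_linear bilinear_map_right[OF lact_bilinear]]) auto
  show "linear (\<Gamma> (s \<cdot> t)) (A\<Gamma> s t) (\<lambda>\<rho>. lactl s t (\<Delta> s t a) (\<Delta>l s t \<rho>))"
    using G a
    by (intro linear_bilinear_right[OF lact_alg_mod_bilinear] left_coact_linear comult_closed) auto
qed (use G a in \<open>auto simp: lact_single left_coact_single comult_mult TL_tmult comult_closed\<close>)

lemma tensor_map_fc_finite:
  assumes G: "s \<in> carrier G" "t \<in> carrier G" and i: "i \<in> I" and Y: "Y \<in> carrier (AA s t)"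
  shows "finite {j \<in> I. Amap s t (\<lambda>x. x) (fc t i j) Y \<noteq> \<zero>\<^bsub>AA s t\<^esub>}"
    "finite {j \<in> I. Amap s t (fc s i j) (\<lambda>x. x) Y \<noteq> \<zero>\<^bsub>AA s t\<^esub>}"
    "finite {j \<in> I. Amap s t (\<lambda>x. x) (cf t i j) Y \<noteq> \<zero>\<^bsub>AA s t\<^esub>}"
  using G i Y fc_finite cf_finite
  by (auto intro!: tensor_map_finite_support fc_linear cf_linear linear_map_id)

text \<open>In words of elements: multiplying x \<otimes> x'\<omega> from the right by y \<otimes>
  y' multiplies x by y and lets y' act on x'\<omega>, so convolution with \<open>f\<close> appears
  in the second factor only.\<close>

lemma ract_alg_mod_TL:
  assumes G: "s \<in> carrier G" "t \<in> carrier G" and i: "i \<in> I"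
    and XY: "X \<in> carrier (AA s t)" "Y \<in> carrier (AA s t)"
  shows "fsum (A\<Gamma> s t) (\<lambda>j. TL s t j (tmult s t X (Amap s t (\<lambda>x. x) (fc t i j) Y))) =
    ractl s t (TL s t i X) Y"
proof -
  let ?T = "AA s t" and ?U = "A\<Gamma> s t"
  let ?c = "\<lambda>j. Amap s t (\<lambda>x. x) (fc t i j)"
  have c: "linear ?T ?T (?c j)" if "j \<in> I" for j
    using G i that by (intro tensor_map_linear linear_map_id fc_linear) auto
  note [simp] = linear_map_closed[OF c]
  have fin: "finite {j \<in> I. TL s t j (tmult s t X (?c j Y)) \<noteq> \<zero>\<^bsub>?U\<^esub>}"
    if "X \<in> carrier ?T" "Y \<in> carrier ?T" for X Y
    using G that linear_map_zero[OF _ _ linear_map_comp[OF TL_linear bilinear_map_right[OF tmult_bilinear]]]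
    by (intro finite_subset[OF _ tensor_map_fc_finite(1)[OF G i that(2)]]) auto
  show ?thesis
  proof (rule tensor_bilinear_eqI[of K "A s" "A t" "A s" "A t", OF _ _ _ _ _ _ _ _ _ XY])
    show "linear ?T ?U (\<lambda>X. fsum ?U (\<lambda>j. TL s t j (tmult s t X (?c j Y))))"
      if "Y \<in> carrier ?T" for Y
      using G fin that
      by (intro linear_map_fin_supp_sum_fun linear_map_comp[OF TL_linear bilinear_map_left[OF tmult_bilinear]])
        auto
    show "linear ?T ?U (\<lambda>Y. fsum ?U (\<lambda>j. TL s t j (tmult s t X (?c j Y))))"
      if "X \<in> carrier ?T" for X
      using G fin that
      by (intro linear_map_fin_supp_sum_fun
          linear_map_comp[OF TL_linear linear_bilinear_right[OF tmult_bilinear _ c]]) auto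
    show "linear ?T ?U (\<lambda>X. ractl s t (TL s t i X) Y)" if "Y \<in> carrier ?T" for Y
      using G that by (intro linear_bilinear_left[OF ract_alg_mod_bilinear] TL_linear) auto
    show "linear ?T ?U (\<lambda>Y. ractl s t (TL s t i X) Y)" if "X \<in> carrier ?T" for X
      using G that by (intro bilinear_map_right[OF ract_alg_mod_bilinear]) auto
    fix x x' y y'
    assume xy: "x \<in> carrier (A s)" "x' \<in> carrier (A t)" "y \<in> carrier (A s)" "y' \<in> carrier (A t)"
    let ?p = "pure s t"
    have "ractl s t (TL s t i (?p x x')) (?p y y') = pt (A s) (\<Gamma> t) (x \<otimes>\<^bsub>A s\<^esub> y) (rsum t i y' x')"
      using G i xy by (simp add: TL_pure ract_alg_mod_pure ract_single)
    also have "\<dots> = fsum ?U (\<lambda>j. pt (A s) (\<Gamma> t) (x \<otimes>\<^bsub>A s\<^esub> y) (\<iota> t j (x' \<otimes>\<^bsub>A t\<^esub> fc t i j y')))"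
      using G i xy rsum_finite
      by (intro linear_map_fin_supp_sum[OF _ _ bilinear_map_right[OF pure_tensor_bilinear]]) auto
    also have "\<dots> = fsum ?U (\<lambda>j. TL s t j (tmult s t (?p x x') (?c j (?p y y'))))"
      using G i xy
      by (intro fin_supp_sum_cong[of K]) (auto simp: tensor_map_pure tmult_pure linear_map_id fc_linear
          single_linear)
    finally show "fsum ?U (\<lambda>j. TL s t j (tmult s t (?p x x') (?c j (?p y y')))) =
        ractl s t (TL s t i (?p x x')) (?p y y')" by simp
  qed (use G in auto)
qed

text \<open>\<open>comult_fc\<close> moves the convolution with \<open>f\<close> into the second
  tensor factor of the coproduct of \<open>b\<close>, exactly where \<open>ract_alg_mod_TL\<close>
  expects it.\<close>

lemma left_coact_ract:
  assumes G: "s \<in> carrier G" "t \<in> carrier G" and b: "b \<in> carrier (A (s \<cdot> t))"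
    and \<rho>: "\<rho> \<in> carrier (\<Gamma> (s \<cdot> t))"
  shows "\<Delta>l s t (ract (\<Gamma> (s \<cdot> t)) \<rho> b) = ractl s t (\<Delta>l s t \<rho>) (\<Delta> s t b)"
proof (rule bimodule_linear_eqI[OF _ _ _ _ _ \<rho>])
  let ?U = "A\<Gamma> s t" and ?g = "s \<cdot> t"
  show "linear (\<Gamma> ?g) ?U (\<lambda>\<rho>. \<Delta>l s t (ract (\<Gamma> ?g) \<rho> b))"
    using G b by (intro linear_map_comp[OF left_coact_linear bilinear_map_left[OF ract_bilinear]]) auto
  show "linear (\<Gamma> ?g) ?U (\<lambda>\<rho>. ractl s t (\<Delta>l s t \<rho>) (\<Delta> s t b))"
    using G b
    by (intro linear_bilinear_left[OF ract_alg_mod_bilinear] left_coact_linear comult_closed) auto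
  fix i a assume i: "i \<in> I" and a: "a \<in> carrier (A ?g)"
  have "\<Delta>l s t (rsum ?g i b a) = fsum ?U (\<lambda>j. \<Delta>l s t (\<iota> ?g j (a \<otimes>\<^bsub>A ?g\<^esub> fc ?g i j b)))"
    using G i a b rsum_finite by (intro linear_map_fin_supp_sum[OF _ _ left_coact_linear]) auto
  also have "\<dots> = fsum ?U (\<lambda>j. TL s t j (tmult s t (\<Delta> s t a)
      (Amap s t (\<lambda>x. x) (fc t i j) (\<Delta> s t b))))"
  proof (rule fin_supp_sum_cong[of K])
    show eq: "\<Delta>l s t (\<iota> ?g j (a \<otimes>\<^bsub>A ?g\<^esub> fc ?g i j b)) = TL s t j (tmult s t (\<Delta> s t a)
        (Amap s t (\<lambda>x. x) (fc t i j) (\<Delta> s t b)))" if "j \<in> I" for j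
      using G i a b that by (simp add: left_coact_single comult_mult comult_fc)
    show "(\<lambda>j. TL s t j (tmult s t (\<Delta> s t a)
        (Amap s t (\<lambda>x. x) (fc t i j) (\<Delta> s t b)))) \<in> I \<rightarrow> carrier ?U"
      \<comment> \<open>Closure is read off from the other side of \<open>eq\<close>, where it is
        immediate.\<close>
      using G i a b by (auto simp: eq[symmetric])
  qed (use G in auto)
  also have "\<dots> = ractl s t (TL s t i (\<Delta> s t a)) (\<Delta> s t b)"
    using G i a b by (intro ract_alg_mod_TL) (auto simp: comult_closed)
  finally show "\<Delta>l s t (ract (\<Gamma> ?g) (\<iota> ?g i a) b) = ractl s t (\<Delta>l s t (\<iota> ?g i a)) (\<Delta> s t b)"
    using G i a b by (simp add: ract_single left_coact_single)
qed (use G in auto)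

text \<open>On \<open>\<iota> i a\<close> each side is
  \<open>id \<otimes> id \<otimes> \<iota> i\<close> applied to one of the two bracketings of the
  twofold coproduct of \<open>a\<close>, so coassociativity of \<Delta> finishes the proof.\<close>

lemma left_coact_coassoc:
  assumes G: "s \<in> carrier G" "t \<in> carrier G" "u \<in> carrier G"
    and \<rho>: "\<rho> \<in> carrier (\<Gamma> (s \<cdot> t \<cdot> u))"
  shows "assoc (A s) (A t) (\<Gamma> u) (tmap (A (s \<cdot> t)) (\<Gamma> u) (AA s t) (\<Gamma> u) (\<Delta> s t) (\<lambda>x. x)
        (\<Delta>l (s \<cdot> t) u \<rho>)) = tmap (A s) (\<Gamma> (t \<cdot> u)) (A s) (A\<Gamma> t u) (\<lambda>x. x)
      (\<Delta>l t u) (\<Delta>l s (t \<cdot> u) \<rho>)"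
proof (rule bimodule_linear_eqI[OF _ _ _ _ _ \<rho>])
  let ?ab = "s \<cdot> t" and ?bc = "t \<cdot> u" and ?abc = "s \<cdot> t \<cdot> u"
  let ?U = "tensor K (A s) (A\<Gamma> t u)"
  let ?as = "assoc (A s) (A t) (\<Gamma> u)"
  let ?as' = "assoc (A s) (A t) (A u)"
  let ?L = "tmap (A ?ab) (\<Gamma> u) (AA s t) (\<Gamma> u) (\<Delta> s t) (\<lambda>x. x)"
  let ?L' = "tmap (A ?ab) (A u) (AA s t) (A u) (\<Delta> s t) (\<lambda>x. x)"
  let ?R = "tmap (A s) (\<Gamma> ?bc) (A s) (A\<Gamma> t u) (\<lambda>x. x) (\<Delta>l t u)"
  let ?R' = "tmap (A s) (A ?bc) (A s) (AA t u) (\<lambda>x. x) (\<Delta> t u)"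
  let ?J = "\<lambda>i. tmap (A s) (AA t u) (A s) (A\<Gamma> t u) (\<lambda>x. x) (TL t u i)"
  \<comment> \<open>The two iterated coactions start from differently bracketed degrees; this
    identifies the components of A and \<Gamma> concerned.\<close>
  have m: "s \<cdot> ?bc = ?abc" using G by (simp add: G.m_assoc)
  have lin1: "linear (\<Gamma> ?abc) (A\<Gamma> ?ab u) (\<Delta>l ?ab u)"
    using G by (intro left_coact_linear) auto
  have lin2: "linear (\<Gamma> ?abc) (A\<Gamma> s ?bc) (\<Delta>l s ?bc)"
    using left_coact_linear[of s ?bc] G unfolding m by simp
  note lin = linear_intros lin1 lin2 comult_linear left_coact_linear TL_linear single_linear
  show "linear (\<Gamma> ?abc) ?U (\<lambda>\<rho>. ?as (?L (\<Delta>l ?ab u \<rho>)))"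
    using G by (intro lin) auto
  show "linear (\<Gamma> ?abc) ?U (\<lambda>\<rho>. ?R (\<Delta>l s ?bc \<rho>))"
    using G by (intro lin) auto
  fix i a assume i: "i \<in> I" and a: "a \<in> carrier (A ?abc)"
  have 1: "?as (?L (TL ?ab u i X)) = ?J i (?as' (?L' X))" if X: "X \<in> carrier (AA ?ab u)" for X
  proof (rule tensor_linear_eqI[OF _ _ _ _ _ X])
    show "linear (AA ?ab u) ?U (\<lambda>X. ?as (?L (TL ?ab u i X)))"
      using G by (intro lin) auto
    show "linear (AA ?ab u) ?U (\<lambda>X. ?J i (?as' (?L' X)))"
      using G by (intro lin) auto
    fix v w assume v: "v \<in> carrier (A ?ab)" and w: "w \<in> carrier (A u)"
    \<comment> \<open>Proved for every \<open>Z\<close>, because it is used at the coproduct of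
      \<open>v\<close>.\<close>
    have "?as (pt (AA s t) (\<Gamma> u) Z (\<iota> u i w)) = ?J i (?as' (pt (AA s t) (A u) Z w))"
      if Z: "Z \<in> carrier (AA s t)" for Z
    proof (rule tensor_linear_eqI[OF _ _ _ _ _ Z])
      show "linear (AA s t) ?U (\<lambda>Z. ?as (pt (AA s t) (\<Gamma> u) Z (\<iota> u i w)))"
        using G w by (intro lin) auto
      show "linear (AA s t) ?U (\<lambda>Z. ?J i (?as' (pt (AA s t) (A u) Z w)))"
        using G w by (intro lin) auto
    qed (use G w in \<open>auto simp: tensor_assoc_pure tensor_map_pure linear_map_id single_linear TL_linear\<close>)
    from this[of "\<Delta> s t v"]
    show "?as (?L (TL ?ab u i (pure ?ab u v w))) = ?J i (?as' (?L' (pure ?ab u v w)))"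
      using G v w by (simp add: TL_pure tensor_map_pure comult_linear linear_map_id comult_closed)
  qed (use G in auto)
  have 2: "?R (TL s ?bc i X) = ?J i (?R' X)" if X: "X \<in> carrier (AA s ?bc)" for X
  proof (rule tensor_linear_eqI[OF _ _ _ _ _ X])
    show "linear (AA s ?bc) ?U (\<lambda>X. ?R (TL s ?bc i X))"
      using G by (intro lin) auto
    show "linear (AA s ?bc) ?U (\<lambda>X. ?J i (?R' X))"
      using G by (intro lin) auto
  qed (use G i in \<open>auto simp: tensor_map_pure linear_map_id single_linear TL_linear comult_linear
      left_coact_linear left_coact_single comult_closed\<close>)
  have "\<Delta> s ?bc a \<in> carrier (AA s ?bc)"
    using G a comult_closed[of s ?bc a] by (simp add: m)
  moreover have "\<Delta> ?ab u a \<in> carrier (AA ?ab u)"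
    using G a comult_closed[of ?ab u a] by simp
  ultimately show "?as (?L (\<Delta>l ?ab u (\<iota> ?abc i a))) = ?R (\<Delta>l s ?bc (\<iota> ?abc i a))"
    using G i a 1 2 left_coact_single[of ?ab u i a] left_coact_single[of s ?bc i a] coassoc[of s t u a]
    by (simp add: m)
qed (use G in auto)

lemma counit_linear: "linear (A e) (ground K) \<epsilon>"
  using counit_algebra_map by (simp add: algebra_map_def)

lemma counit_closed: "a \<in> carrier (A e) \<Longrightarrow> \<epsilon> a \<in> carrier K"
  using linear_map_closed[OF counit_linear] by (simp add: ground_def)

text \<open>Contracting the first factor commutes with applying \<open>\<iota> i\<close> to the
  second one, which leaves the counit axiom of A.\<close>

lemma left_coact_counit:
  assumes s: "s \<in> carrier G" and \<rho>: "\<rho> \<in> carrier (\<Gamma> s)"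
  shows "fun_id (A e) (\<Gamma> s) \<epsilon> (\<Delta>l e s \<rho>) = \<rho>"
proof (rule bimodule_linear_eqI[OF _ _ _ _ _ \<rho>])
  have lin: "linear (\<Gamma> s) (A\<Gamma> e s) (\<Delta>l e s)"
    using left_coact_linear[of e s] s by simp
  show "linear (\<Gamma> s) (\<Gamma> s) (\<lambda>\<rho>. fun_id (A e) (\<Gamma> s) \<epsilon> (\<Delta>l e s \<rho>))"
    using s by (intro linear_fun_tensor_id lin counit_linear) auto
  fix i a assume i: "i \<in> I" and a: "a \<in> carrier (A s)"
  have X: "\<Delta> e s a \<in> carrier (AA e s)"
    using s a comult_closed[of e s a] by simp
  have "fun_id (A e) (\<Gamma> s) \<epsilon> (TL e s i (\<Delta> e s a)) = \<iota> s i (fun_id (A e) (A s) \<epsilon> (\<Delta> e s a))"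
  proof (rule tensor_linear_eqI[OF _ _ _ _ _ X])
    show "linear (AA e s) (\<Gamma> s) (\<lambda>X. fun_id (A e) (\<Gamma> s) \<epsilon> (TL e s i X))"
      using s by (intro linear_fun_tensor_id TL_linear counit_linear) auto
    show "linear (AA e s) (\<Gamma> s) (\<lambda>X. \<iota> s i (fun_id (A e) (A s) \<epsilon> X))"
      using s by (intro linear_map_comp[OF single_linear fun_tensor_id_linear] counit_linear) auto
    show "fun_id (A e) (\<Gamma> s) \<epsilon> (TL e s i (pure e s v w)) =
        \<iota> s i (fun_id (A e) (A s) \<epsilon> (pure e s v w))"
      if "v \<in> carrier (A e)" "w \<in> carrier (A s)" for v w
      using s that
      by (simp add: TL_pure fun_tensor_id_pure counit_linear counit_closed linear_map_smult[OF single_linear])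
  qed (use s in auto)
  then show "fun_id (A e) (\<Gamma> s) \<epsilon> (\<Delta>l e s (\<iota> s i a)) = \<iota> s i a"
    using s i a left_coact_single[of e s i a] by (simp add: counit_left)
qed (use s in \<open>auto intro: linear_map_id\<close>)

lemma free_left_covariant:
  "left_covariant_bimodule K G A \<Delta> \<epsilon> S \<Gamma> (\<Delta>l)"
  by (intro left_covariant_bimodule.intro left_covariant_bimodule_axioms.intro free_bimodule_graded
      left_coact_linear left_coact_lact left_coact_ract left_coact_coassoc left_coact_counit)

end

section \<open>The right coaction\<close>

locale bicovariant_family = functional_family K G A \<Delta> \<epsilon> S I f
  for K :: "'k ring" and G :: "'g monoid" and A :: "'g \<Rightarrow> ('k, 'a) module"
    and \<Delta> :: "'g \<Rightarrow> 'g \<Rightarrow> 'a \<Rightarrow> ('a \<times> 'a \<Rightarrow> 'k) set"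
    and \<epsilon> :: "'a \<Rightarrow> 'k" and S :: "'g \<Rightarrow> 'a \<Rightarrow> 'a"
    and I :: "'i set" and f :: "'i \<Rightarrow> 'i \<Rightarrow> 'g \<Rightarrow> 'a \<Rightarrow> 'k" +
  fixes R :: "'g \<Rightarrow> 'i \<Rightarrow> 'i \<Rightarrow> 'a"
  assumes R_closed: "\<lbrakk>i \<in> I; j \<in> I; s \<in> carrier G\<rbrakk> \<Longrightarrow> R s i j \<in> carrier (A s)"
    and R_finite: "\<lbrakk>i \<in> I; s \<in> carrier G\<rbrakk> \<Longrightarrow> finite {j \<in> I. R s j i \<noteq> \<zero>\<^bsub>A s\<^esub>}"
    and R_comult: "\<lbrakk>i \<in> I; j \<in> I; s \<in> carrier G; t \<in> carrier G\<rbrakk> \<Longrightarrow> \<Delta> s t (R (s \<cdot> t) j i) =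
        fsum (AA s t) (\<lambda>h. pure s t (R s j h) (R t h i))"
    and R_counit: "\<lbrakk>i \<in> I; j \<in> I\<rbrakk> \<Longrightarrow> \<epsilon> (R e j i) = (if j = i then \<one>\<^bsub>K\<^esub> else \<zero>\<^bsub>K\<^esub>)"
    and R_f: "\<lbrakk>j \<in> I; h \<in> I; s \<in> carrier G; a \<in> carrier (A s)\<rbrakk> \<Longrightarrow>
      fsum (A s) (\<lambda>i. R s i j \<otimes>\<^bsub>A s\<^esub> conv_fun K G A \<Delta> s a (f i h)) =
      fsum (A s) (\<lambda>i. fun_conv K G A \<Delta> s (f j i) a \<otimes>\<^bsub>A s\<^esub> R s h i)"
begin

abbreviation "\<Delta>r \<equiv> free_right_coact K G A \<Delta> I f R"

lemmas [simp] = R_closed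

lemma lact_mod_alg_bilinear:
  "\<lbrakk>s \<in> carrier G; t \<in> carrier G\<rbrakk> \<Longrightarrow> bilinear (AA s t) (\<Gamma>A s t) (\<Gamma>A s t) (lactr s t)"
  unfolding lact_mod_alg_def by (intro tensor_bilinear_bilinear A_mult_bilinear lact_bilinear) auto

lemma lact_mod_alg_pure:
  "\<lbrakk>s \<in> carrier G; t \<in> carrier G; a \<in> carrier (A s); b \<in> carrier (A t);
    x \<in> carrier (\<Gamma> s); b' \<in> carrier (A t)\<rbrakk> \<Longrightarrow> lactr s t (pure s t a b) (pt (\<Gamma> s) (A t) x b') =
      pt (\<Gamma> s) (A t) (lact (\<Gamma> s) a x) (b \<otimes>\<^bsub>A t\<^esub> b')"
  unfolding lact_mod_alg_def by (intro tensor_bilinear_pure A_mult_bilinear lact_bilinear) auto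

lemma ract_mod_alg_bilinear:
  "\<lbrakk>s \<in> carrier G; t \<in> carrier G\<rbrakk> \<Longrightarrow> bilinear (\<Gamma>A s t) (AA s t) (\<Gamma>A s t) (ractr s t)"
  unfolding ract_mod_alg_def by (intro tensor_bilinear_bilinear A_mult_bilinear ract_bilinear) auto

lemma ract_mod_alg_pure:
  "\<lbrakk>s \<in> carrier G; t \<in> carrier G; a \<in> carrier (A s); b \<in> carrier (A t);
    x \<in> carrier (\<Gamma> s); b' \<in> carrier (A t)\<rbrakk> \<Longrightarrow> ractr s t (pt (\<Gamma> s) (A t) x b') (pure s t a b) =
      pt (\<Gamma> s) (A t) (ract (\<Gamma> s) x a) (b' \<otimes>\<^bsub>A t\<^esub> b)"
  unfolding ract_mod_alg_def by (intro tensor_bilinear_pure A_mult_bilinear ract_bilinear) auto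

text \<open>The j-th summand of the right coaction is factored as \<open>TI\<close> after
  \<open>RR\<close>: multiplication by the entry of \<open>R\<close> takes place inside the algebra
  and the basis vector is attached afterwards. In the compatibility with the right action these two
  operations end up with different indices.\<close>

abbreviation "rmul t j i \<equiv> \<lambda>y. y \<otimes>\<^bsub>A t\<^esub> R t j i"
abbreviation "RR s t j i \<equiv> Amap s t (\<lambda>x. x) (rmul t j i)"
abbreviation "TI s t j \<equiv> tmap (A s) (A t) (\<Gamma> s) (A t) (\<iota> s j) (\<lambda>x. x)"
abbreviation "RS s t i X \<equiv> fsum (\<Gamma>A s t) (\<lambda>j. TI s t j (RR s t j i X))"

lemma rmul_linear:
  "\<lbrakk>t \<in> carrier G; i \<in> I; j \<in> I\<rbrakk> \<Longrightarrow> linear (A t) (A t) (rmul t j i)"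
  by (intro bilinear_map_left[OF A_mult_bilinear]) auto

lemma RR_linear:
  "\<lbrakk>s \<in> carrier G; t \<in> carrier G; i \<in> I; j \<in> I\<rbrakk> \<Longrightarrow> linear (AA s t) (AA s t) (RR s t j i)"
  by (intro tensor_map_linear rmul_linear linear_map_id) auto

lemma RR_pure:
  "\<lbrakk>s \<in> carrier G; t \<in> carrier G; i \<in> I; j \<in> I; x \<in> carrier (A s); y \<in> carrier (A t)\<rbrakk> \<Longrightarrow>
    RR s t j i (pure s t x y) = pure s t x (y \<otimes>\<^bsub>A t\<^esub> R t j i)"
  by (intro tensor_map_pure rmul_linear linear_map_id) auto

lemma RR_closed [simp]:
  "\<lbrakk>s \<in> carrier G; t \<in> carrier G; i \<in> I; j \<in> I; X \<in> carrier (AA s t)\<rbrakk> \<Longrightarrow>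
    RR s t j i X \<in> carrier (AA s t)"
  using linear_map_closed[OF RR_linear] .

lemma RR_zero:
  "\<lbrakk>s \<in> carrier G; t \<in> carrier G; i \<in> I; j \<in> I; X \<in> carrier (AA s t);
    R t j i = \<zero>\<^bsub>A t\<^esub>\<rbrakk> \<Longrightarrow> RR s t j i X = \<zero>\<^bsub>AA s t\<^esub>"
  by (rule tensor_map_zero[OF _ _ _ _ linear_map_id rmul_linear]) auto

lemma TI_linear:
  "\<lbrakk>s \<in> carrier G; t \<in> carrier G\<rbrakk> \<Longrightarrow> linear (AA s t) (\<Gamma>A s t) (TI s t j)"
  by (intro tensor_map_linear single_linear linear_map_id) auto

lemma TI_pure:
  "\<lbrakk>s \<in> carrier G; t \<in> carrier G; x \<in> carrier (A s); y \<in> carrier (A t)\<rbrakk> \<Longrightarrow>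
    TI s t j (pure s t x y) = pt (\<Gamma> s) (A t) (\<iota> s j x) y"
  by (intro tensor_map_pure single_linear linear_map_id) auto

lemma TI_closed [simp]:
  "\<lbrakk>s \<in> carrier G; t \<in> carrier G; X \<in> carrier (AA s t)\<rbrakk> \<Longrightarrow> TI s t j X \<in> carrier (\<Gamma>A s t)"
  using linear_map_closed[OF TI_linear] .

lemma TI_zero:
  "\<lbrakk>s \<in> carrier G; t \<in> carrier G\<rbrakk> \<Longrightarrow> TI s t j \<zero>\<^bsub>AA s t\<^esub> = \<zero>\<^bsub>\<Gamma>A s t\<^esub>"
  by (rule linear_map_zero[OF _ _ TI_linear]) auto

lemma TIRR_linear:
  "\<lbrakk>s \<in> carrier G; t \<in> carrier G; i \<in> I; j \<in> I\<rbrakk> \<Longrightarrow>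
    linear (AA s t) (\<Gamma>A s t) (\<lambda>X. TI s t j (RR s t j i X))"
  by (intro linear_map_comp[OF TI_linear RR_linear])

lemma TIRR_zero:
  assumes "s \<in> carrier G" "t \<in> carrier G" "i \<in> I" "j \<in> I" "X \<in> carrier (AA s t)"
    and "R t j i = \<zero>\<^bsub>A t\<^esub>"
  shows "TI s t j (RR s t j i X) = \<zero>\<^bsub>\<Gamma>A s t\<^esub>"
  by (subst RR_zero[OF assms], rule TI_zero[OF assms(1,2)])

text \<open>The finite bound is column i of \<open>R\<close>, the same for all tensors
  \<open>X\<close>.\<close>

lemma RS_finite:
  assumes "s \<in> carrier G" "t \<in> carrier G" "i \<in> I" "X \<in> carrier (AA s t)"
  shows "finite {j \<in> I. TI s t j (RR s t j i X) \<noteq> \<zero>\<^bsub>\<Gamma>A s t\<^esub>}"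
  by (rule finite_subset[OF _ R_finite[OF assms(3,2)]]) (use TIRR_zero[OF assms(1-3) _ assms(4)] in blast)

lemma RS_linear:
  "\<lbrakk>s \<in> carrier G; t \<in> carrier G; i \<in> I\<rbrakk> \<Longrightarrow> linear (AA s t) (\<Gamma>A s t) (\<lambda>X. RS s t i X)"
  using RS_finite by (intro linear_map_fin_supp_sum_fun TIRR_linear) auto

lemma RS_closed [simp]:
  "\<lbrakk>s \<in> carrier G; t \<in> carrier G; i \<in> I; X \<in> carrier (AA s t)\<rbrakk> \<Longrightarrow> RS s t i X \<in> carrier (\<Gamma>A s t)"
  using linear_map_closed[OF RS_linear] .

lemma linear_map_RS:
  assumes "s \<in> carrier G" "t \<in> carrier G" "i \<in> I" "X \<in> carrier (AA s t)" "module K W"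
    and "linear (\<Gamma>A s t) W g"
  shows "g (RS s t i X) = fin_supp_sum W I (\<lambda>j. g (TI s t j (RR s t j i X)))"
  using assms RS_finite by (intro linear_map_fin_supp_sum[OF _ _ assms(6)]) auto

lemma lact_mod_alg_R:
  assumes G: "s \<in> carrier G" "t \<in> carrier G" and ij: "i \<in> I" "j \<in> I"
    and X: "X \<in> carrier (AA s t)"
  shows "lactr s t X (pt (\<Gamma> s) (A t) (free_basis (A s) I j) (R t j i)) = TI s t j (RR s t j i X)"
  by (rule tensor_linear_eqI[OF _ _ bilinear_map_left[OF lact_mod_alg_bilinear] TIRR_linear _ X])
    (use G ij in \<open>simp_all add: free_basis_eq_single lact_mod_alg_pure TI_pure RR_pure lact_single\<close>)

lemma right_coact_eq:
  assumes G: "s \<in> carrier G" "t \<in> carrier G" and \<rho>: "\<rho> \<in> carrier (\<Gamma> (s \<cdot> t))"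
  shows "\<Delta>r s t \<rho> = fsum (\<Gamma>A s t) (\<lambda>i. RS s t i (\<Delta> s t (\<rho> i)))"
proof -
  have \<Delta>\<rho>: "\<Delta> s t (\<rho> i) \<in> carrier (AA s t)" if "i \<in> I" for i
    using G \<rho> that by (intro comult_closed) (auto simp: bimodule_carrier free_module_mem_iff)
  show ?thesis
    unfolding free_right_coact_def Let_def
    using G \<Delta>\<rho> by (intro fin_supp_sum_cong[of K]) (auto simp: lact_mod_alg_R)
qed

lemma right_coact_linear:
  assumes G: "s \<in> carrier G" "t \<in> carrier G"
  shows "linear (\<Gamma> (s \<cdot> t)) (\<Gamma>A s t) (\<Delta>r s t)"
proof (rule linear_map_cong[OF _ _ right_coact_eq[OF G]])
  show "linear (\<Gamma> (s \<cdot> t)) (\<Gamma>A s t) (\<lambda>\<rho>. fsum (\<Gamma>A s t) (\<lambda>i. RS s t i (\<Delta> s t (\<rho> i))))"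
    by (rule bimodule_lift_linear[OF _ _ linear_map_comp[OF RS_linear comult_linear]]) (use G in auto)
qed (use G in auto)

lemma right_coact_closed [simp]:
  "\<lbrakk>s \<in> carrier G; t \<in> carrier G; \<rho> \<in> carrier (\<Gamma> (s \<cdot> t))\<rbrakk> \<Longrightarrow> \<Delta>r s t \<rho> \<in> carrier (\<Gamma>A s t)"
  using linear_map_closed[OF right_coact_linear] .

lemma right_coact_single:
  assumes G: "s \<in> carrier G" "t \<in> carrier G" and i: "i \<in> I" and a: "a \<in> carrier (A (s \<cdot> t))"
  shows "\<Delta>r s t (\<iota> (s \<cdot> t) i a) = RS s t i (\<Delta> s t a)"
proof -
  have "fsum (\<Gamma>A s t) (\<lambda>j. RS s t j (\<Delta> s t (\<iota> (s \<cdot> t) i a j))) = RS s t i (\<Delta> s t a)"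
    by (rule bimodule_lift_single[where g = "\<lambda>i x. RS s t i (\<Delta> s t x)"])
      (use G i a linear_map_comp[OF RS_linear comult_linear] in auto)
  then show ?thesis using G a by (simp add: right_coact_eq)
qed

text \<open>Each summand is left linear by itself: \<open>\<iota> s j\<close> is left linear, and
  right multiplication by an entry of \<open>R\<close> commutes with left multiplication by
  associativity.\<close>

lemma RS_tmult:
  assumes G: "s \<in> carrier G" "t \<in> carrier G" and i: "i \<in> I"
    and XY: "X \<in> carrier (AA s t)" "Y \<in> carrier (AA s t)"
  shows "RS s t i (tmult s t X Y) = lactr s t X (RS s t i Y)"
proof -
  let ?T = "AA s t" and ?U = "\<Gamma>A s t"
  have eq: "TI s t j (RR s t j i (tmult s t X Y)) = lactr s t X (TI s t j (RR s t j i Y))" if j: "j \<in> I" for j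
  proof (rule tensor_bilinear_eqI[of K "A s" "A t" "A s" "A t", OF _ _ _ _ _ _ _ _ _ XY])
    show "linear ?T ?U (\<lambda>X. TI s t j (RR s t j i (tmult s t X Y)))" if "Y \<in> carrier ?T" for Y
      using G i j that by (intro linear_map_comp[OF TIRR_linear bilinear_map_left[OF tmult_bilinear]])
    show "linear ?T ?U (\<lambda>Y. TI s t j (RR s t j i (tmult s t X Y)))" if "X \<in> carrier ?T" for X
      using G i j that by (intro linear_map_comp[OF TIRR_linear bilinear_map_right[OF tmult_bilinear]])
    show "linear ?T ?U (\<lambda>X. lactr s t X (TI s t j (RR s t j i Y)))" if "Y \<in> carrier ?T" for Y
      using G i j that by (intro bilinear_map_left[OF lact_mod_alg_bilinear]) auto
    show "linear ?T ?U (\<lambda>Y. lactr s t X (TI s t j (RR s t j i Y)))" if "X \<in> carrier ?T" for X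
      using G i j that by (intro linear_bilinear_right[OF lact_mod_alg_bilinear] TIRR_linear) auto
  qed (use G i j in \<open>auto simp: tmult_pure TI_pure RR_pure lact_mod_alg_pure lact_single A_mult_assoc\<close>)
  have "lactr s t X (RS s t i Y) = fsum ?U (\<lambda>j. lactr s t X (TI s t j (RR s t j i Y)))"
    using G i XY by (intro linear_map_RS bilinear_map_right[OF lact_mod_alg_bilinear]) auto
  also have "\<dots> = RS s t i (tmult s t X Y)"
    using G i XY bilinear_map_closed[OF tmult_bilinear[OF G] XY]
    by (intro fin_supp_sum_cong[of K]) (auto simp: eq[symmetric])
  finally show ?thesis by simp
qed

lemma right_coact_lact:
  assumes G: "s \<in> carrier G" "t \<in> carrier G" and a: "a \<in> carrier (A (s \<cdot> t))"
    and \<rho>: "\<rho> \<in> carrier (\<Gamma> (s \<cdot> t))"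
  shows "\<Delta>r s t (lact (\<Gamma> (s \<cdot> t)) a \<rho>) = lactr s t (\<Delta> s t a) (\<Delta>r s t \<rho>)"
proof (rule bimodule_linear_eqI[OF _ _ _ _ _ \<rho>])
  show "linear (\<Gamma> (s \<cdot> t)) (\<Gamma>A s t) (\<lambda>\<rho>. \<Delta>r s t (lact (\<Gamma> (s \<cdot> t)) a \<rho>))"
    using G a by (intro linear_map_comp[OF right_coact_linear bilinear_map_right[OF lact_bilinear]]) auto
  show "linear (\<Gamma> (s \<cdot> t)) (\<Gamma>A s t) (\<lambda>\<rho>. lactr s t (\<Delta> s t a) (\<Delta>r s t \<rho>))"
    using G a
    by (intro linear_bilinear_right[OF lact_mod_alg_bilinear] right_coact_linear comult_closed) auto
qed (use G a in \<open>auto simp: lact_single right_coact_single comult_mult RS_tmult comult_closed\<close>)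

section \<open>Right action on the codomain of the right coaction, and the counit law\<close>

lemma ract_mod_alg_TI:
  assumes G: "s \<in> carrier G" "t \<in> carrier G" and i: "i \<in> I"
    and XY: "X \<in> carrier (AA s t)" "Y \<in> carrier (AA s t)"
  shows "fsum (\<Gamma>A s t) (\<lambda>j. TI s t j (tmult s t X (Amap s t (fc s i j) (\<lambda>x. x) Y))) =
    ractr s t (TI s t i X) Y"
proof -
  let ?T = "AA s t" and ?U = "\<Gamma>A s t"
  let ?c = "\<lambda>j. Amap s t (fc s i j) (\<lambda>x. x)"
  have c: "linear ?T ?T (?c j)" if "j \<in> I" for j
    using G i that by (intro tensor_map_linear linear_map_id fc_linear) auto
  note [simp] = linear_map_closed[OF c]
  have fin: "finite {j \<in> I. TI s t j (tmult s t X (?c j Y)) \<noteq> \<zero>\<^bsub>?U\<^esub>}"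
    if "X \<in> carrier ?T" "Y \<in> carrier ?T" for X Y
    using G that linear_map_zero[OF _ _ linear_map_comp[OF TI_linear bilinear_map_right[OF tmult_bilinear]]]
    by (intro finite_subset[OF _ tensor_map_fc_finite(2)[OF G i that(2)]]) auto
  show ?thesis
  proof (rule tensor_bilinear_eqI[of K "A s" "A t" "A s" "A t", OF _ _ _ _ _ _ _ _ _ XY])
    show "linear ?T ?U (\<lambda>X. fsum ?U (\<lambda>j. TI s t j (tmult s t X (?c j Y))))"
      if "Y \<in> carrier ?T" for Y
      using G fin that
      by (intro linear_map_fin_supp_sum_fun linear_map_comp[OF TI_linear bilinear_map_left[OF tmult_bilinear]])
        auto
    show "linear ?T ?U (\<lambda>Y. fsum ?U (\<lambda>j. TI s t j (tmult s t X (?c j Y))))"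
      if "X \<in> carrier ?T" for X
      using G fin that
      by (intro linear_map_fin_supp_sum_fun
          linear_map_comp[OF TI_linear linear_bilinear_right[OF tmult_bilinear _ c]]) auto
    show "linear ?T ?U (\<lambda>X. ractr s t (TI s t i X) Y)" if "Y \<in> carrier ?T" for Y
      using G that by (intro linear_bilinear_left[OF ract_mod_alg_bilinear] TI_linear) auto
    show "linear ?T ?U (\<lambda>Y. ractr s t (TI s t i X) Y)" if "X \<in> carrier ?T" for X
      using G that by (intro bilinear_map_right[OF ract_mod_alg_bilinear]) auto
    fix x x' y y'
    assume xy: "x \<in> carrier (A s)" "x' \<in> carrier (A t)" "y \<in> carrier (A s)" "y' \<in> carrier (A t)"
    let ?p = "pure s t"
    have "ractr s t (TI s t i (?p x x')) (?p y y') = pt (\<Gamma> s) (A t) (rsum s i y x) (x' \<otimes>\<^bsub>A t\<^esub> y')"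
      using G i xy by (simp add: TI_pure ract_mod_alg_pure ract_single)
    also have "\<dots> = fsum ?U (\<lambda>j. pt (\<Gamma> s) (A t) (\<iota> s j (x \<otimes>\<^bsub>A s\<^esub> fc s i j y)) (x' \<otimes>\<^bsub>A t\<^esub> y'))"
      using G i xy rsum_finite
      by (intro linear_map_fin_supp_sum[OF _ _ bilinear_map_left[OF pure_tensor_bilinear]]) auto
    also have "\<dots> = fsum ?U (\<lambda>j. TI s t j (tmult s t (?p x x') (?c j (?p y y'))))"
      using G i xy
      by (intro fin_supp_sum_cong[of K]) (auto simp: tensor_map_pure tmult_pure linear_map_id fc_linear
          single_linear)
    finally show "fsum ?U (\<lambda>j. TI s t j (tmult s t (?p x x') (?c j (?p y y')))) =
        ractr s t (TI s t i (?p x x')) (?p y y')" by simp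
  qed (use G in auto)
qed

lemma counit_mult: "\<lbrakk>a \<in> carrier (A e); b \<in> carrier (A e)\<rbrakk> \<Longrightarrow> \<epsilon> (a \<otimes>\<^bsub>A e\<^esub> b) = \<epsilon> a \<otimes>\<^bsub>K\<^esub> \<epsilon> b"
  using counit_algebra_map by (simp add: algebra_map_def ring_hom_def ground_def)

lemma right_coact_counit:
  assumes s: "s \<in> carrier G" and \<rho>: "\<rho> \<in> carrier (\<Gamma> s)"
  shows "id_fun (\<Gamma> s) (A e) \<epsilon> (\<Delta>r s e \<rho>) = \<rho>"
proof (rule bimodule_linear_eqI[OF _ _ _ _ _ \<rho>])
  interpret \<Gamma>: module K "\<Gamma> s" using s by simp
  have lin: "linear (\<Gamma> s) (\<Gamma>A s e) (\<Delta>r s e)"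
    using right_coact_linear[of s e] s by simp
  show "linear (\<Gamma> s) (\<Gamma> s) (\<lambda>\<rho>. id_fun (\<Gamma> s) (A e) \<epsilon> (\<Delta>r s e \<rho>))"
    using s by (intro linear_id_tensor_fun lin counit_linear) auto
  fix i a assume i: "i \<in> I" and a: "a \<in> carrier (A s)"
  have X: "\<Delta> s e a \<in> carrier (AA s e)"
    using s a comult_closed[of s e a] by simp
  \<comment> \<open>The counit is multiplicative, so the entry of \<open>R\<close> splits off as the
    scalar \<open>\<epsilon> (R e j i)\<close>. By \<open>R_counit\<close> the sum over j then
    collapses to j = i.\<close>
  have eq: "id_fun (\<Gamma> s) (A e) \<epsilon> (TI s e j (RR s e j i (\<Delta> s e a))) =
      \<epsilon> (R e j i) \<odot>\<^bsub>\<Gamma> s\<^esub> \<iota> s j (id_fun (A s) (A e) \<epsilon> (\<Delta> s e a))" if j: "j \<in> I" for j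
  proof (rule tensor_linear_eqI[OF _ _ _ _ _ X])
    show "linear (AA s e) (\<Gamma> s) (\<lambda>X. id_fun (\<Gamma> s) (A e) \<epsilon> (TI s e j (RR s e j i X)))"
      using s i j by (intro linear_id_tensor_fun TIRR_linear counit_linear) auto
    show "linear (AA s e) (\<Gamma> s) (\<lambda>X. \<epsilon> (R e j i) \<odot>\<^bsub>\<Gamma> s\<^esub> \<iota> s j (id_fun (A s) (A e) \<epsilon> X))"
      using s i j
      by (intro linear_map_smult_fun linear_map_comp[OF single_linear id_tensor_fun_linear]
          counit_linear counit_closed) auto
    show "id_fun (\<Gamma> s) (A e) \<epsilon> (TI s e j (RR s e j i (pure s e v w))) =
        \<epsilon> (R e j i) \<odot>\<^bsub>\<Gamma> s\<^esub> \<iota> s j (id_fun (A s) (A e) \<epsilon> (pure s e v w))"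
      if "v \<in> carrier (A s)" "w \<in> carrier (A e)" for v w
      using s i j that counit_closed[of w] counit_closed[of "R e j i"]
        K.m_comm[of "\<epsilon> w" "\<epsilon> (R e j i)"]
      by (simp add: TI_pure RR_pure id_tensor_fun_pure counit_linear counit_mult
          linear_map_smult[OF single_linear] \<Gamma>.smult_assoc1)
  qed (use s in auto)
  have "id_fun (\<Gamma> s) (A e) \<epsilon> (\<Delta>r s e (\<iota> s i a)) = id_fun (\<Gamma> s) (A e) \<epsilon> (RS s e i (\<Delta> s e a))"
    using s i a right_coact_single[of s e i a] by simp
  also have "\<dots> = fsum (\<Gamma> s) (\<lambda>j. id_fun (\<Gamma> s) (A e) \<epsilon> (TI s e j (RR s e j i (\<Delta> s e a))))"
    using s i X by (intro linear_map_RS id_tensor_fun_linear counit_linear) auto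
  also have "\<dots> = id_fun (\<Gamma> s) (A e) \<epsilon> (TI s e i (RR s e i i (\<Delta> s e a)))"
    using s i a by (intro fin_supp_sum_delta[of K]) (auto simp: eq R_counit counit_right)
  also have "\<dots> = \<iota> s i a"
    using s i a by (simp add: eq R_counit counit_right)
  finally show "id_fun (\<Gamma> s) (A e) \<epsilon> (\<Delta>r s e (\<iota> s i a)) = \<iota> s i a" .
qed (use s in \<open>auto intro: linear_map_id\<close>)

text \<open>The relation between \<open>f\<close> and \<open>R\<close> enters only here.\<close>

lemma RS_tmult_fc:
  assumes G: "s \<in> carrier G" "t \<in> carrier G" and i: "i \<in> I"
    and XY: "X \<in> carrier (AA s t)" "Y \<in> carrier (AA s t)"
  shows "fsum (\<Gamma>A s t) (\<lambda>j. RS s t j (tmult s t X (Amap s t (\<lambda>x. x) (fc t i j) Y))) =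
    fsum (\<Gamma>A s t) (\<lambda>k. fsum (\<Gamma>A s t) (\<lambda>h. TI s t h (tmult s t (RR s t k i X)
        (Amap s t (\<lambda>x. x) (cf t k h) Y))))"
proof -
  let ?T = "AA s t" and ?U = "\<Gamma>A s t"
  let ?c = "\<lambda>j. Amap s t (\<lambda>x. x) (fc t i j)"
  let ?d = "\<lambda>k h. Amap s t (\<lambda>x. x) (cf t k h)"
  let ?P = "\<lambda>k h X Y. TI s t h (tmult s t (RR s t k i X) (?d k h Y))"
  have mods: "module K ?T" "module K ?U" using G by auto
  note tm = tmult_bilinear[OF G]
  have c: "linear ?T ?T (?c j)" if "j \<in> I" for j
    using G i that by (intro tensor_map_linear linear_map_id fc_linear) auto
  have d: "linear ?T ?T (?d k h)" if "k \<in> I" "h \<in> I" for k h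
    using G that by (intro tensor_map_linear linear_map_id cf_linear) auto
  note [simp] = linear_map_closed[OF c] linear_map_closed[OF d] bilinear_map_closed[OF tm]
  have finL: "finite {j \<in> I. RS s t j (tmult s t X (?c j Y)) \<noteq> \<zero>\<^bsub>?U\<^esub>}"
    if "X \<in> carrier ?T" "Y \<in> carrier ?T" for X Y
    by (rule finite_subset[OF _ tensor_map_fc_finite(1)[OF G i that(2)]])
      (use G that linear_map_zero[OF mods linear_map_comp[OF RS_linear bilinear_map_right[OF tm]]] in auto)
  have PX: "linear ?T ?U (\<lambda>X. ?P k h X Y)" if "k \<in> I" "h \<in> I" "Y \<in> carrier ?T" for k h Y
    by (rule linear_map_comp[OF TI_linear linear_bilinear_left[OF tm _ RR_linear]])
      (use G i that in auto)
  have PY: "linear ?T ?U (\<lambda>Y. ?P k h X Y)" if "k \<in> I" "h \<in> I" "X \<in> carrier ?T" for k h X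
    by (rule linear_map_comp[OF TI_linear linear_bilinear_right[OF tm _ d]])
      (use G i that in auto)
  note [simp] = linear_map_closed[OF PX]
  have finP: "finite {h \<in> I. ?P k h X Y \<noteq> \<zero>\<^bsub>?U\<^esub>}"
    if "k \<in> I" "X \<in> carrier ?T" "Y \<in> carrier ?T" for k X Y
    by (rule finite_subset[OF _ tensor_map_fc_finite(3)[OF G that(1) that(3)]])
      (use G i that linear_map_zero[OF mods linear_map_comp[OF TI_linear bilinear_map_right[OF tm]]] in auto)
  have P0: "?P k h X Y = \<zero>\<^bsub>?U\<^esub>"
    if "k \<in> I" "h \<in> I" "X \<in> carrier ?T" "Y \<in> carrier ?T" "R t k i = \<zero>\<^bsub>A t\<^esub>" for k h X Y
    by (subst RR_zero[OF G i that(1,3,5)])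
      (use G that linear_map_zero[OF mods linear_map_comp[OF TI_linear bilinear_map_left[OF tm]]] in auto)
  \<comment> \<open>The outer index k is bounded by column i of \<open>R\<close>, whatever
    \<open>X\<close> and \<open>Y\<close> are; the inner index h is bounded only for each k, by
    \<open>finP\<close>.\<close>
  have finP': "finite {k \<in> I. fsum ?U (\<lambda>h. ?P k h X Y) \<noteq> \<zero>\<^bsub>?U\<^esub>}"
    if X: "X \<in> carrier ?T" and Y: "Y \<in> carrier ?T" for X Y
  proof (rule finite_subset[OF _ R_finite[OF i G(2)]])
    have "fsum ?U (\<lambda>h. ?P k h X Y) = \<zero>\<^bsub>?U\<^esub>" if "k \<in> I" "R t k i = \<zero>\<^bsub>A t\<^esub>" for k
      by (rule fin_supp_sum_zero[OF mods(2) P0]) (use X Y that in auto)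
    then show "{k \<in> I. fsum ?U (\<lambda>h. ?P k h X Y) \<noteq> \<zero>\<^bsub>?U\<^esub>} \<subseteq> {k \<in> I. R t k i \<noteq> \<zero>\<^bsub>A t\<^esub>}"
      by blast
  qed
  show ?thesis
  proof (rule tensor_bilinear_eqI[of K "A s" "A t" "A s" "A t", OF _ _ _ _ _ _ _ _ _ XY])
    show "linear ?T ?U (\<lambda>X. fsum ?U (\<lambda>j. RS s t j (tmult s t X (?c j Y))))"
      if "Y \<in> carrier ?T" for Y
      by (rule linear_map_fin_supp_sum_fun[OF mods linear_map_comp[OF RS_linear bilinear_map_left[OF tm]]])
        (use G finL that in auto)
    show "linear ?T ?U (\<lambda>Y. fsum ?U (\<lambda>j. RS s t j (tmult s t X (?c j Y))))"
      if "X \<in> carrier ?T" for X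
      by (rule linear_map_fin_supp_sum_fun[OF mods linear_map_comp[OF RS_linear linear_bilinear_right[OF tm _ c]]])
        (use G finL that in auto)
    show "linear ?T ?U (\<lambda>X. fsum ?U (\<lambda>k. fsum ?U (\<lambda>h. ?P k h X Y)))" if Y: "Y \<in> carrier ?T" for Y
      by (intro linear_map_fin_supp_sum_fun[OF mods] PX Y finP finP')
    show "linear ?T ?U (\<lambda>Y. fsum ?U (\<lambda>k. fsum ?U (\<lambda>h. ?P k h X Y)))" if X: "X \<in> carrier ?T" for X
      by (intro linear_map_fin_supp_sum_fun[OF mods] PY X finP finP')
    fix x x' y y'
    assume xy: "x \<in> carrier (A s)" "x' \<in> carrier (A t)" "y \<in> carrier (A s)" "y' \<in> carrier (A t)"
    let ?p = "pure s t"
    \<comment> \<open>After associativity has moved \<open>x'\<close> to the left, the terms of both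
      double sums differ only in the entry \<open>z\<close>, in which \<open>?q h\<close> is linear;
      so \<open>R_f\<close> can be applied inside it.\<close>
    let ?q = "\<lambda>h z. pt (\<Gamma> s) (A t) (\<iota> s h (x \<otimes>\<^bsub>A s\<^esub> y)) (x' \<otimes>\<^bsub>A t\<^esub> z)"
    \<comment> \<open>Two interchanges call for two rectangles: j is bounded by \<open>f\<close> and
      then h by \<open>R\<close>; k is bounded by \<open>R\<close> and then h by
      \<open>f\<close>.\<close>
    let ?B = "{j \<in> I. fc t i j y' \<noteq> \<zero>\<^bsub>A t\<^esub>}" and ?C = "{k \<in> I. R t k i \<noteq> \<zero>\<^bsub>A t\<^esub>}"
    let ?B' = "\<Union>j\<in>?B. {h \<in> I. R t h j \<noteq> \<zero>\<^bsub>A t\<^esub>}"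
    let ?C' = "\<Union>k\<in>?C. {h \<in> I. cf t k h y' \<noteq> \<zero>\<^bsub>A t\<^esub>}"
    have fin: "finite ?B" "finite ?B'" "finite ?C" "finite ?C'"
      using G i xy fc_finite cf_finite R_finite by auto
    have q: "linear (A t) ?U (?q h)" for h
      using G xy by (intro pure_tensor_linear_right bilinear_map_right[OF A_mult_bilinear]) auto
    have q0: "?q h \<zero>\<^bsub>A t\<^esub> = \<zero>\<^bsub>?U\<^esub>" for h
      using G by (intro linear_map_zero[OF _ mods(2) q]) auto
    note qc = linear_map_closed[OF q]
    have z1: "fc t i j y' \<otimes>\<^bsub>A t\<^esub> R t h j = \<zero>\<^bsub>A t\<^esub>" if "j \<in> I" "h \<in> I" "j \<notin> ?B \<or> h \<notin> ?B'" for j h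
      using G i xy that by (cases "fc t i j y' = \<zero>\<^bsub>A t\<^esub>") auto
    have z2: "R t k i \<otimes>\<^bsub>A t\<^esub> cf t k h y' = \<zero>\<^bsub>A t\<^esub>" if "h \<in> I" "k \<in> I" "h \<notin> ?C' \<or> k \<notin> ?C" for h k
      using G i xy that by (cases "R t k i = \<zero>\<^bsub>A t\<^esub>") auto
    have "fsum ?U (\<lambda>j. RS s t j (tmult s t (?p x x') (?c j (?p y y')))) =
        fsum ?U (\<lambda>j. fsum ?U (\<lambda>h. ?q h (fc t i j y' \<otimes>\<^bsub>A t\<^esub> R t h j)))"
    proof (rule fin_supp_sum_cong[OF mods(2)])
      show "RS s t j (tmult s t (?p x x') (?c j (?p y y'))) =
          fsum ?U (\<lambda>h. ?q h (fc t i j y' \<otimes>\<^bsub>A t\<^esub> R t h j))" if j: "j \<in> I" for j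
        using G i xy j by (intro fin_supp_sum_cong[OF mods(2)])
          (auto simp: tensor_map_pure linear_map_id fc_linear tmult_pure rmul_linear single_linear A_mult_assoc)
    qed (use G i xy in \<open>auto intro!: fin_supp_sum_closed[of K] qc\<close>)
    \<comment> \<open>\<open>R_f\<close> is a sum over j for fixed h, so h has to become the outer
      index before the relation can be used; a second interchange restores the order.\<close>
    also have "\<dots> = fsum ?U (\<lambda>h. fsum ?U (\<lambda>j. ?q h (fc t i j y' \<otimes>\<^bsub>A t\<^esub> R t h j)))"
    proof (rule fin_supp_sum_swap[OF mods(2) _ fin(1,2)])
      show "?q h (fc t i j y' \<otimes>\<^bsub>A t\<^esub> R t h j) = \<zero>\<^bsub>?U\<^esub>" if "j \<in> I" "h \<in> I" "j \<notin> ?B \<or> h \<notin> ?B'" for j h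
        by (simp only: z1[OF that] q0)
    qed (use G i xy in \<open>auto intro!: qc\<close>)
    also have "\<dots> = fsum ?U (\<lambda>h. fsum ?U (\<lambda>k. ?q h (R t k i \<otimes>\<^bsub>A t\<^esub> cf t k h y')))"
    proof (rule fin_supp_sum_cong[OF mods(2)])
      fix h assume h: "h \<in> I"
      have "fsum ?U (\<lambda>j. ?q h (fc t i j y' \<otimes>\<^bsub>A t\<^esub> R t h j)) =
          ?q h (fsum (A t) (\<lambda>j. fc t i j y' \<otimes>\<^bsub>A t\<^esub> R t h j))"
        by (rule linear_map_fin_supp_sum[OF _ mods(2) q, symmetric])
          (use G i xy h in \<open>auto intro!: finite_subset[OF _ fin(1)]\<close>)
      also have "\<dots> = ?q h (fsum (A t) (\<lambda>k. R t k i \<otimes>\<^bsub>A t\<^esub> cf t k h y'))"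
        using R_f[OF i h G(2) xy(4)] by simp
      also have "\<dots> = fsum ?U (\<lambda>k. ?q h (R t k i \<otimes>\<^bsub>A t\<^esub> cf t k h y'))"
        by (rule linear_map_fin_supp_sum[OF _ mods(2) q])
          (use G i xy h in \<open>auto intro!: finite_subset[OF _ fin(3)]\<close>)
      finally show "fsum ?U (\<lambda>j. ?q h (fc t i j y' \<otimes>\<^bsub>A t\<^esub> R t h j)) =
          fsum ?U (\<lambda>k. ?q h (R t k i \<otimes>\<^bsub>A t\<^esub> cf t k h y'))" .
    qed (use G i xy in \<open>auto intro!: fin_supp_sum_closed[of K] qc\<close>)
    also have "\<dots> = fsum ?U (\<lambda>k. fsum ?U (\<lambda>h. ?q h (R t k i \<otimes>\<^bsub>A t\<^esub> cf t k h y')))"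
    proof (rule fin_supp_sum_swap[OF mods(2) _ fin(4,3)])
      show "?q h (R t k i \<otimes>\<^bsub>A t\<^esub> cf t k h y') = \<zero>\<^bsub>?U\<^esub>" if "h \<in> I" "k \<in> I" "h \<notin> ?C' \<or> k \<notin> ?C" for h k
        by (simp only: z2[OF that] q0)
    qed (use G i xy in \<open>auto intro!: qc\<close>)
    also have "\<dots> = fsum ?U (\<lambda>k. fsum ?U (\<lambda>h. ?P k h (?p x x') (?p y y')))"
    proof (rule fin_supp_sum_cong[OF mods(2)])
      show "fsum ?U (\<lambda>h. ?q h (R t k i \<otimes>\<^bsub>A t\<^esub> cf t k h y')) =
          fsum ?U (\<lambda>h. ?P k h (?p x x') (?p y y'))" if k: "k \<in> I" for k
        using G i xy k by (intro fin_supp_sum_cong[OF mods(2)])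
          (auto simp: tensor_map_pure linear_map_id cf_linear tmult_pure rmul_linear single_linear A_mult_assoc)
    qed (use G i xy in \<open>auto intro!: fin_supp_sum_closed[of K]\<close>)
    finally show "fsum ?U (\<lambda>j. RS s t j (tmult s t (?p x x') (?c j (?p y y')))) =
        fsum ?U (\<lambda>k. fsum ?U (\<lambda>h. ?P k h (?p x x') (?p y y')))" .
  qed (use G in auto)
qed

text \<open>The convolution delivered by \<open>comult_fc\<close> sits in the second factor to the
  left of the entry of \<open>R\<close>, while the right action on \<Gamma> \<otimes> A demands it
  in the first factor. \<open>RS_tmult_fc\<close> carries it past \<open>R\<close>, and
  \<open>comult_cf_fc\<close> carries it across the tensor sign.\<close>

lemma right_coact_ract:
  assumes G: "s \<in> carrier G" "t \<in> carrier G" and b: "b \<in> carrier (A (s \<cdot> t))"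
    and \<rho>: "\<rho> \<in> carrier (\<Gamma> (s \<cdot> t))"
  shows "\<Delta>r s t (ract (\<Gamma> (s \<cdot> t)) \<rho> b) = ractr s t (\<Delta>r s t \<rho>) (\<Delta> s t b)"
proof (rule bimodule_linear_eqI[OF _ _ _ _ _ \<rho>])
  let ?U = "\<Gamma>A s t" and ?g = "s \<cdot> t"
  let ?T = "AA s t"
  let ?c = "\<lambda>i j. Amap s t (\<lambda>x. x) (fc t i j)"
  have mods: "module K ?T" "module K ?U" using G by auto
  show "linear (\<Gamma> ?g) ?U (\<lambda>\<rho>. \<Delta>r s t (ract (\<Gamma> ?g) \<rho> b))"
    using G b by (intro linear_map_comp[OF right_coact_linear bilinear_map_left[OF ract_bilinear]]) auto
  show "linear (\<Gamma> ?g) ?U (\<lambda>\<rho>. ractr s t (\<Delta>r s t \<rho>) (\<Delta> s t b))"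
    using G b
    by (intro linear_bilinear_left[OF ract_mod_alg_bilinear] right_coact_linear comult_closed) auto
  fix i a assume i: "i \<in> I" and a: "a \<in> carrier (A ?g)"
  have X: "\<Delta> s t a \<in> carrier ?T" and Y: "\<Delta> s t b \<in> carrier ?T"
    using G a b by (auto intro: comult_closed)
  have "\<Delta>r s t (rsum ?g i b a) = fsum ?U (\<lambda>j. \<Delta>r s t (\<iota> ?g j (a \<otimes>\<^bsub>A ?g\<^esub> fc ?g i j b)))"
    using G i a b rsum_finite by (intro linear_map_fin_supp_sum[OF _ _ right_coact_linear]) auto
  also have "\<dots> = fsum ?U (\<lambda>j. RS s t j (tmult s t (\<Delta> s t a) (?c i j (\<Delta> s t b))))"
  proof (rule fin_supp_sum_cong[OF mods(2)])
    show eq: "\<Delta>r s t (\<iota> ?g j (a \<otimes>\<^bsub>A ?g\<^esub> fc ?g i j b)) =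
        RS s t j (tmult s t (\<Delta> s t a) (?c i j (\<Delta> s t b)))" if "j \<in> I" for j
      using G i a b that by (simp add: right_coact_single comult_mult comult_fc)
    show "(\<lambda>j. RS s t j (tmult s t (\<Delta> s t a) (?c i j (\<Delta> s t b)))) \<in> I \<rightarrow> carrier ?U"
      using G i a b by (auto simp: eq[symmetric])
  qed
  also have "\<dots> = fsum ?U (\<lambda>k. fsum ?U (\<lambda>h. TI s t h (tmult s t
      (RR s t k i (\<Delta> s t a)) (Amap s t (\<lambda>x. x) (cf t k h) (\<Delta> s t b)))))"
    by (rule RS_tmult_fc[OF G i X Y])
  also have "\<dots> = fsum ?U (\<lambda>k. ractr s t (TI s t k (RR s t k i (\<Delta> s t a))) (\<Delta> s t b))"
  proof (rule fin_supp_sum_cong[OF mods(2)])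
    fix k assume k: "k \<in> I"
    have c: "linear ?T ?T (Amap s t (fc s k h) (\<lambda>x. x))" if "h \<in> I" for h
      using G k that by (intro tensor_map_linear linear_map_id fc_linear) auto
    \<comment> \<open>The change of factor is available for coproducts rather than arbitrary
      tensors. It is therefore made here, at the coproduct of \<open>b\<close>, and not as part of a
      reduction to pure tensors.\<close>
    have "fsum ?U (\<lambda>h. TI s t h (tmult s t (RR s t k i (\<Delta> s t a))
          (Amap s t (\<lambda>x. x) (cf t k h) (\<Delta> s t b)))) =
        fsum ?U (\<lambda>h. TI s t h (tmult s t (RR s t k i (\<Delta> s t a))
          (Amap s t (fc s k h) (\<lambda>x. x) (\<Delta> s t b))))"
    proof (rule fin_supp_sum_cong[OF mods(2)])
      show "(\<lambda>h. TI s t h (tmult s t (RR s t k i (\<Delta> s t a))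
          (Amap s t (fc s k h) (\<lambda>x. x) (\<Delta> s t b)))) \<in> I \<rightarrow> carrier ?U"
        using G i k X Y linear_map_closed[OF c] bilinear_map_closed[OF tmult_bilinear[OF G]] by auto
    qed (use G k b in \<open>simp add: comult_cf_fc\<close>)
    also have "\<dots> = ractr s t (TI s t k (RR s t k i (\<Delta> s t a))) (\<Delta> s t b)"
      using G i k X Y by (intro ract_mod_alg_TI) auto
    finally show "fsum ?U (\<lambda>h. TI s t h (tmult s t (RR s t k i (\<Delta> s t a))
          (Amap s t (\<lambda>x. x) (cf t k h) (\<Delta> s t b)))) =
        ractr s t (TI s t k (RR s t k i (\<Delta> s t a))) (\<Delta> s t b)" .
  qed (use G i X Y bilinear_map_closed[OF ract_mod_alg_bilinear[OF G]] in auto)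
  also have "\<dots> = ractr s t (RS s t i (\<Delta> s t a)) (\<Delta> s t b)"
    using G i X Y by (intro linear_map_RS[symmetric] bilinear_map_left[OF ract_mod_alg_bilinear]) auto
  finally show "\<Delta>r s t (ract (\<Gamma> ?g) (\<iota> ?g i a) b) = ractr s t (\<Delta>r s t (\<iota> ?g i a)) (\<Delta> s t b)"
    using G i a b by (simp add: ract_single right_coact_single)
qed (use G in auto)

section \<open>Coassociativity of the right coaction\<close>

abbreviation "MR t u i j h \<equiv> Amap t u (rmul t j h) (rmul u h i)"

lemma MR_linear:
  "\<lbrakk>t \<in> carrier G; u \<in> carrier G; i \<in> I; j \<in> I; h \<in> I\<rbrakk> \<Longrightarrow> linear (AA t u) (AA t u) (MR t u i j h)"
  by (intro tensor_map_linear rmul_linear) auto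

lemma MR_closed [simp]:
  "\<lbrakk>t \<in> carrier G; u \<in> carrier G; i \<in> I; j \<in> I; h \<in> I; X \<in> carrier (AA t u)\<rbrakk> \<Longrightarrow>
    MR t u i j h X \<in> carrier (AA t u)"
  using linear_map_closed[OF MR_linear] .

lemma MR_zero:
  assumes "t \<in> carrier G" "u \<in> carrier G" "i \<in> I" "j \<in> I" "h \<in> I" "X \<in> carrier (AA t u)"
    and "R t j h = \<zero>\<^bsub>A t\<^esub> \<or> R u h i = \<zero>\<^bsub>A u\<^esub>"
  shows "MR t u i j h X = \<zero>\<^bsub>AA t u\<^esub>"
  by (rule tensor_map_zero[OF _ _ _ _ rmul_linear rmul_linear]) (use assms in auto)

text \<open>The coproduct is multiplicative, and \<open>MR\<close> with index h is right
  multiplication by the h-th summand in the coproduct of the entry of \<open>R\<close>.\<close>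

lemma comult_mult_R:
  assumes G: "t \<in> carrier G" "u \<in> carrier G" and ij: "i \<in> I" "j \<in> I"
    and y: "y \<in> carrier (A (t \<cdot> u))"
  shows "\<Delta> t u (y \<otimes>\<^bsub>A (t \<cdot> u)\<^esub> R (t \<cdot> u) j i) = fsum (AA t u) (\<lambda>h. MR t u i j h (\<Delta> t u y))"
proof -
  let ?T = "AA t u" and ?p = "pure t u"
  have T: "module K ?T" using G by simp
  have Y: "\<Delta> t u y \<in> carrier ?T" using G y by (rule comult_closed)
  have p0: "?p r \<zero>\<^bsub>A u\<^esub> = \<zero>\<^bsub>?T\<^esub>" if "r \<in> carrier (A t)" for r
    using G that by (intro linear_map_zero[OF _ _ bilinear_map_right[OF pure_tensor_bilinear]]) auto
  have fin: "finite {h \<in> I. ?p (R t j h) (R u h i) \<noteq> \<zero>\<^bsub>?T\<^esub>}"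
    by (rule finite_subset[OF _ R_finite[OF ij(1) G(2)]]) (use G ij p0 in auto)
  have MR: "tmult t u Z (?p (R t j h) (R u h i)) = MR t u i j h Z"
    if "Z \<in> carrier ?T" "h \<in> I" for Z h
    by (rule tensor_linear_eqI[OF _ _ bilinear_map_left[OF tmult_bilinear] MR_linear _ that(1)])
      (use G ij that in \<open>auto simp: tmult_pure tensor_map_pure rmul_linear\<close>)
  have "\<Delta> t u (y \<otimes>\<^bsub>A (t \<cdot> u)\<^esub> R (t \<cdot> u) j i) =
      tmult t u (\<Delta> t u y) (fsum ?T (\<lambda>h. ?p (R t j h) (R u h i)))"
    using G ij y by (simp add: comult_mult R_comult)
  also have "\<dots> = fsum ?T (\<lambda>h. tmult t u (\<Delta> t u y) (?p (R t j h) (R u h i)))"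
    by (rule linear_map_fin_supp_sum[OF T T bilinear_map_right[OF tmult_bilinear]]) (use G Y fin in auto)
  also have "\<dots> = fsum ?T (\<lambda>h. MR t u i j h (\<Delta> t u y))"
    by (rule fin_supp_sum_cong[OF T]) (use G ij Y in \<open>auto simp: MR\<close>)
  finally show ?thesis .
qed

text \<open>On \<open>\<iota> i a\<close> both sides expand into the sum over j and h of
  \<open>\<iota> s j \<otimes> (\<cdot> R t j h) \<otimes> (\<cdot> R u h i)\<close>, applied to the
  twofold coproduct of \<open>a\<close>. On the left j comes first and h arises from the coproduct
  of an entry of \<open>R\<close>; on the right the first coaction produces h and the second one j.
  The two sums thus appear in opposite orders.\<close>

lemma right_coact_coassoc:
  assumes G: "s \<in> carrier G" "t \<in> carrier G" "u \<in> carrier G"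
    and \<rho>: "\<rho> \<in> carrier (\<Gamma> (s \<cdot> t \<cdot> u))"
  shows "tmap (\<Gamma> s) (A (t \<cdot> u)) (\<Gamma> s) (AA t u) (\<lambda>x. x) (\<Delta> t u) (\<Delta>r s (t \<cdot> u) \<rho>) =
    assoc (\<Gamma> s) (A t) (A u) (tmap (\<Gamma> (s \<cdot> t)) (A u) (\<Gamma>A s t) (A u) (\<Delta>r s t) (\<lambda>x. x)
        (\<Delta>r (s \<cdot> t) u \<rho>))"
proof (rule bimodule_linear_eqI[OF _ _ _ _ _ \<rho>])
  let ?ab = "s \<cdot> t" and ?bc = "t \<cdot> u" and ?abc = "s \<cdot> t \<cdot> u"
  let ?T = "tensor K (A s) (AA t u)"
  let ?U = "tensor K (\<Gamma> s) (AA t u)"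
  let ?as = "assoc (\<Gamma> s) (A t) (A u)"
  let ?as' = "assoc (A s) (A t) (A u)"
  let ?L = "tmap (\<Gamma> s) (A ?bc) (\<Gamma> s) (AA t u) (\<lambda>x. x) (\<Delta> t u)"
  let ?L' = "tmap (A s) (A ?bc) (A s) (AA t u) (\<lambda>x. x) (\<Delta> t u)"
  let ?R = "tmap (\<Gamma> ?ab) (A u) (\<Gamma>A s t) (A u) (\<Delta>r s t) (\<lambda>x. x)"
  let ?R' = "tmap (A ?ab) (A u) (AA s t) (A u) (\<Delta> s t) (\<lambda>x. x)"
  let ?Q = "\<lambda>i j h. tmap (A s) (AA t u) (\<Gamma> s) (AA t u) (\<iota> s j) (MR t u i j h)"
  have m: "s \<cdot> ?bc = ?abc" using G by (simp add: G.m_assoc)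
  have mods: "module K ?T" "module K ?U" using G by auto
  have lin1: "linear (\<Gamma> ?abc) (\<Gamma>A s ?bc) (\<Delta>r s ?bc)"
    using right_coact_linear[of s ?bc] G unfolding m by simp
  have lin2: "linear (\<Gamma> ?abc) (\<Gamma>A ?ab u) (\<Delta>r ?ab u)"
    using G by (intro right_coact_linear) auto
  note lin = linear_intros lin1 lin2 comult_linear right_coact_linear TI_linear TIRR_linear single_linear
    MR_linear
  show "linear (\<Gamma> ?abc) ?U (\<lambda>\<rho>. ?L (\<Delta>r s ?bc \<rho>))"
    using G by (intro lin) auto
  show "linear (\<Gamma> ?abc) ?U (\<lambda>\<rho>. ?as (?R (\<Delta>r ?ab u \<rho>)))"
    using G by (intro lin) auto
  fix i a assume i: "i \<in> I" and a: "a \<in> carrier (A ?abc)"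
  have Q: "linear ?T ?U (?Q i j h)" if "j \<in> I" "h \<in> I" for j h
    using G i that by (intro tensor_map_linear MR_linear single_linear) auto
  have Q0: "?Q i j h W = \<zero>\<^bsub>?U\<^esub>"
    if "j \<in> I" "h \<in> I" "W \<in> carrier ?T" "R t j h = \<zero>\<^bsub>A t\<^esub> \<or> R u h i = \<zero>\<^bsub>A u\<^esub>" for j h W
    by (rule tensor_map_zero[OF _ _ _ _ single_linear MR_linear])
      (use G i that MR_zero[OF G(2,3) i that(1,2) _ that(4)] in auto)
  have finQh: "finite {h \<in> I. ?Q i j h W \<noteq> \<zero>\<^bsub>?U\<^esub>}" if "j \<in> I" "W \<in> carrier ?T" for j W
    by (rule finite_subset[OF _ R_finite[OF i G(3)]]) (use Q0[OF that(1) _ that(2)] in blast)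
  have finQj: "finite {j \<in> I. ?Q i j h W \<noteq> \<zero>\<^bsub>?U\<^esub>}" if "h \<in> I" "W \<in> carrier ?T" for h W
    by (rule finite_subset[OF _ R_finite[OF that(1) G(2)]]) (use Q0[OF _ that(1,2)] in blast)
  note Qc = linear_map_closed[OF Q]

  have 1: "?L (TI s ?bc j (RR s ?bc j i X)) = fsum ?U (\<lambda>h. ?Q i j h (?L' X))"
    if X: "X \<in> carrier (AA s ?bc)" and j: "j \<in> I" for X j
  proof (rule tensor_linear_eqI[OF _ _ _ _ _ X])
    have L': "linear (AA s ?bc) ?T ?L'" using G by (intro lin tensor_map_linear) auto
    show "linear (AA s ?bc) ?U (\<lambda>X. ?L (TI s ?bc j (RR s ?bc j i X)))"
      using G i j by (intro lin) auto
    show "linear (AA s ?bc) ?U (\<lambda>X. fsum ?U (\<lambda>h. ?Q i j h (?L' X)))"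
      by (rule linear_map_fin_supp_sum_fun[OF _ mods(2) linear_map_comp[OF Q L']])
        (use G j finQh[OF j linear_map_closed[OF L']] in auto)
    fix x y assume x: "x \<in> carrier (A s)" and y: "y \<in> carrier (A ?bc)"
    note Y = comult_closed[OF G(2,3) y]
    have "?L (TI s ?bc j (RR s ?bc j i (pure s ?bc x y))) = pt (\<Gamma> s) (AA t u) (\<iota> s j x)
          (fsum (AA t u) (\<lambda>h. MR t u i j h (\<Delta> t u y)))"
      using G i j x y by (simp add: RR_pure TI_pure tensor_map_pure linear_map_id comult_linear comult_mult_R)
    also have "\<dots> = fsum ?U (\<lambda>h. pt (\<Gamma> s) (AA t u) (\<iota> s j x) (MR t u i j h (\<Delta> t u y)))"
    proof (rule linear_map_fin_supp_sum[OF _ mods(2) bilinear_map_right[OF pure_tensor_bilinear]])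
      show "finite {h \<in> I. MR t u i j h (\<Delta> t u y) \<noteq> \<zero>\<^bsub>AA t u\<^esub>}"
        by (rule finite_subset[OF _ R_finite[OF i G(3)]]) (use MR_zero[OF G(2,3) i j _ Y] in blast)
    qed (use G i j x Y in auto)
    also have "\<dots> = fsum ?U (\<lambda>h. ?Q i j h (?L' (pure s ?bc x y)))"
      by (rule fin_supp_sum_cong[OF mods(2)])
        (use G i j x y Y in \<open>auto simp: tensor_map_pure linear_map_id comult_linear single_linear MR_linear\<close>)
    finally show "?L (TI s ?bc j (RR s ?bc j i (pure s ?bc x y))) =
        fsum ?U (\<lambda>h. ?Q i j h (?L' (pure s ?bc x y)))" .
  qed (use G in auto)

  have 2: "?as (?R (TI ?ab u h (RR ?ab u h i X))) = fsum ?U (\<lambda>j. ?Q i j h (?as' (?R' X)))"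
    if X: "X \<in> carrier (AA ?ab u)" and h: "h \<in> I" for X h
  proof (rule tensor_linear_eqI[OF _ _ _ _ _ X])
    have R': "linear (AA ?ab u) ?T (\<lambda>X. ?as' (?R' X))" using G by (intro lin) auto
    show "linear (AA ?ab u) ?U (\<lambda>X. ?as (?R (TI ?ab u h (RR ?ab u h i X))))"
      using G i h by (intro lin) auto
    show "linear (AA ?ab u) ?U (\<lambda>X. fsum ?U (\<lambda>j. ?Q i j h (?as' (?R' X))))"
      by (rule linear_map_fin_supp_sum_fun[OF _ mods(2) linear_map_comp[OF Q R']])
        (use G h finQj[OF h linear_map_closed[OF R']] in auto)
    fix x y assume x: "x \<in> carrier (A ?ab)" and y: "y \<in> carrier (A u)"
    note X = comult_closed[OF G(1,2) x]
    let ?y = "y \<otimes>\<^bsub>A u\<^esub> R u h i"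
    \<comment> \<open>Stated for arbitrary \<open>Z\<close> since it is used at the coproduct of
      \<open>x\<close>, once the coaction on the left factor has been expanded over j.\<close>
    have inner: "?as (pt (\<Gamma>A s t) (A u) (TI s t j (RR s t j h Z)) ?y) =
        ?Q i j h (?as' (pt (AA s t) (A u) Z y))"
      if j: "j \<in> I" and Z: "Z \<in> carrier (AA s t)" for j Z
    proof (rule tensor_linear_eqI[OF _ _ _ _ _ Z])
      show "linear (AA s t) ?U (\<lambda>Z. ?as (pt (\<Gamma>A s t) (A u) (TI s t j (RR s t j h Z)) ?y))"
        using G i h j y by (intro lin) auto
      show "linear (AA s t) ?U (\<lambda>Z. ?Q i j h (?as' (pt (AA s t) (A u) Z y)))"
        using G i h j y by (intro lin) auto
    qed (use G i h j y in \<open>auto simp: RR_pure TI_pure tensor_assoc_pure tensor_map_pure single_linear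
        MR_linear rmul_linear\<close>)
    have "?as (?R (TI ?ab u h (RR ?ab u h i (pure ?ab u x y)))) =
        ?as (pt (\<Gamma>A s t) (A u) (RS s t h (\<Delta> s t x)) ?y)"
      using G i h x y
      by (simp add: RR_pure TI_pure tensor_map_pure linear_map_id right_coact_linear right_coact_single)
    also have "\<dots> = fsum ?U (\<lambda>j. ?as (pt (\<Gamma>A s t) (A u) (TI s t j (RR s t j h (\<Delta> s t x))) ?y))"
      by (rule linear_map_RS[where g = "\<lambda>Z. ?as (pt (\<Gamma>A s t) (A u) Z ?y)"])
        (use G i h X y in \<open>auto intro!: linear_intros\<close>)
    also have "\<dots> = fsum ?U (\<lambda>j. ?Q i j h (?as' (?R' (pure ?ab u x y))))"
    proof (rule fin_supp_sum_cong[OF mods(2)])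
      show "(\<lambda>j. ?Q i j h (?as' (?R' (pure ?ab u x y)))) \<in> I \<rightarrow> carrier ?U"
        using G h Qc linear_map_closed[OF R'] by auto
    qed (use G x y X inner in \<open>auto simp: tensor_map_pure linear_map_id comult_linear\<close>)
    finally show "?as (?R (TI ?ab u h (RR ?ab u h i (pure ?ab u x y)))) =
        fsum ?U (\<lambda>j. ?Q i j h (?as' (?R' (pure ?ab u x y))))" .
  qed (use G in auto)

  have Xl: "\<Delta> s ?bc a \<in> carrier (AA s ?bc)"
    using G a comult_closed[of s ?bc a] by (simp add: m)
  have Xr: "\<Delta> ?ab u a \<in> carrier (AA ?ab u)"
    using G a comult_closed[of ?ab u a] by simp
  \<comment> \<open>Coassociativity of \<Delta> makes \<open>W\<close> the common argument of both
    double sums, so that only the order of summation is left to settle.\<close>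
  define W where "W = ?L' (\<Delta> s ?bc a)"
  have W': "W = ?as' (?R' (\<Delta> ?ab u a))"
    using coassoc[OF G a] by (simp add: W_def)
  have W: "W \<in> carrier ?T"
    unfolding W_def by (rule linear_map_closed[OF tensor_map_linear Xl]) (use G in \<open>auto intro: lin\<close>)
  \<comment> \<open>The chain has to begin with h: the fixed index i bounds h through
    \<open>R u h i\<close>, and each such h bounds j through \<open>R t j h\<close>.\<close>
  let ?H = "{h \<in> I. R u h i \<noteq> \<zero>\<^bsub>A u\<^esub>}"
  let ?J = "\<Union>h\<in>?H. {j \<in> I. R t j h \<noteq> \<zero>\<^bsub>A t\<^esub>}"
  have fin: "finite ?H" "finite ?J" using R_finite G i by auto
  have "?L (\<Delta>r s ?bc (\<iota> ?abc i a)) = ?L (RS s ?bc i (\<Delta> s ?bc a))"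
    using right_coact_single[of s ?bc i a] G i a by (simp add: m)
  also have "\<dots> = fsum ?U (\<lambda>j. ?L (TI s ?bc j (RR s ?bc j i (\<Delta> s ?bc a))))"
    using G i Xl by (intro linear_map_RS tensor_map_linear linear_map_id comult_linear) auto
  also have "\<dots> = fsum ?U (\<lambda>j. fsum ?U (\<lambda>h. ?Q i j h W))"
    by (rule fin_supp_sum_cong[OF mods(2)])
      (use 1[OF Xl] Qc W in \<open>auto simp: W_def intro!: fin_supp_sum_closed[OF mods(2)]\<close>)
  also have "\<dots> = fsum ?U (\<lambda>h. fsum ?U (\<lambda>j. ?Q i j h W))"
  proof (rule fin_supp_sum_swap[OF mods(2) _ fin(2,1)])
    show "?Q i j h W = \<zero>\<^bsub>?U\<^esub>" if "j \<in> I" "h \<in> I" "j \<notin> ?J \<or> h \<notin> ?H" for j h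
      using that by (intro Q0[OF _ _ W]) auto
  qed (use Qc W in auto)
  also have "\<dots> = fsum ?U (\<lambda>h. ?as (?R (TI ?ab u h (RR ?ab u h i (\<Delta> ?ab u a)))))"
    by (rule fin_supp_sum_cong[OF mods(2), symmetric])
      (use 2[OF Xr] Qc W in \<open>auto simp: W' intro!: fin_supp_sum_closed[OF mods(2)]\<close>)
  also have "\<dots> = ?as (?R (RS ?ab u i (\<Delta> ?ab u a)))"
    by (rule linear_map_RS[where g = "\<lambda>Z. ?as (?R Z)", symmetric])
      (use G i Xr in \<open>auto intro!: linear_intros right_coact_linear\<close>)
  also have "\<dots> = ?as (?R (\<Delta>r ?ab u (\<iota> ?abc i a)))"
    using right_coact_single[of ?ab u i a] G i a by simp
  finally show "?L (\<Delta>r s ?bc (\<iota> ?abc i a)) = ?as (?R (\<Delta>r ?ab u (\<iota> ?abc i a)))" .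
qed (use G in auto)

text \<open>On \<open>\<iota> i a\<close> both sides are the sum over j of
  \<open>id \<otimes> \<iota> t j \<otimes> (\<cdot> R u j i)\<close> applied to the twofold
  coproduct of \<open>a\<close>. The left coaction adds no index, so a single sum occurs on each
  side and coassociativity of \<Delta> matches the summands.\<close>

lemma coact_compat:
  assumes G: "s \<in> carrier G" "t \<in> carrier G" "u \<in> carrier G"
    and \<rho>: "\<rho> \<in> carrier (\<Gamma> (s \<cdot> t \<cdot> u))"
  shows "assoc (A s) (\<Gamma> t) (A u) (tmap (\<Gamma> (s \<cdot> t)) (A u) (A\<Gamma> s t) (A u) (\<Delta>l s t) (\<lambda>x. x)
        (\<Delta>r (s \<cdot> t) u \<rho>)) = tmap (A s) (\<Gamma> (t \<cdot> u)) (A s) (\<Gamma>A t u) (\<lambda>x. x)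
      (\<Delta>r t u) (\<Delta>l s (t \<cdot> u) \<rho>)"
proof (rule bimodule_linear_eqI[OF _ _ _ _ _ \<rho>])
  let ?ab = "s \<cdot> t" and ?bc = "t \<cdot> u" and ?abc = "s \<cdot> t \<cdot> u"
  let ?T = "tensor K (A s) (AA t u)"
  let ?U = "tensor K (A s) (\<Gamma>A t u)"
  let ?as = "assoc (A s) (\<Gamma> t) (A u)"
  let ?as' = "assoc (A s) (A t) (A u)"
  let ?L = "tmap (\<Gamma> ?ab) (A u) (A\<Gamma> s t) (A u) (\<Delta>l s t) (\<lambda>x. x)"
  let ?L' = "tmap (A ?ab) (A u) (AA s t) (A u) (\<Delta> s t) (\<lambda>x. x)"
  let ?R = "tmap (A s) (\<Gamma> ?bc) (A s) (\<Gamma>A t u) (\<lambda>x. x) (\<Delta>r t u)"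
  let ?R' = "tmap (A s) (A ?bc) (A s) (AA t u) (\<lambda>x. x) (\<Delta> t u)"
  let ?V = "\<lambda>i j. tmap (A s) (AA t u) (A s) (\<Gamma>A t u) (\<lambda>x. x) (\<lambda>Z. TI t u j (RR t u j i Z))"
  have m: "s \<cdot> ?bc = ?abc" using G by (simp add: G.m_assoc)
  have mods: "module K ?T" "module K ?U" using G by auto
  have lin1: "linear (\<Gamma> ?abc) (\<Gamma>A ?ab u) (\<Delta>r ?ab u)"
    using G by (intro right_coact_linear) auto
  have lin2: "linear (\<Gamma> ?abc) (A\<Gamma> s ?bc) (\<Delta>l s ?bc)"
    using left_coact_linear[of s ?bc] G unfolding m by simp
  note lin = linear_intros lin1 lin2 comult_linear right_coact_linear left_coact_linear TL_linear
    TI_linear TIRR_linear single_linear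
  show "linear (\<Gamma> ?abc) ?U (\<lambda>\<rho>. ?as (?L (\<Delta>r ?ab u \<rho>)))"
    using G by (intro lin) auto
  show "linear (\<Gamma> ?abc) ?U (\<lambda>\<rho>. ?R (\<Delta>l s ?bc \<rho>))"
    using G by (intro lin) auto
  fix i a assume i: "i \<in> I" and a: "a \<in> carrier (A ?abc)"
  have V: "linear ?T ?U (?V i j)" if "j \<in> I" for j
    using G i that by (intro tensor_map_linear TIRR_linear linear_map_id) auto
  have V0: "?V i j W = \<zero>\<^bsub>?U\<^esub>" if "j \<in> I" "W \<in> carrier ?T" "R u j i = \<zero>\<^bsub>A u\<^esub>" for j W
    by (rule tensor_map_zero[OF _ _ _ _ linear_map_id TIRR_linear])
      (use G i that TIRR_zero[OF G(2,3) i that(1) _ that(3)] in auto)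
  have finV: "finite {j \<in> I. ?V i j W \<noteq> \<zero>\<^bsub>?U\<^esub>}" if "W \<in> carrier ?T" for W
    by (rule finite_subset[OF _ R_finite[OF i G(3)]]) (use V0[OF _ that] in blast)

  have 1: "?as (?L (TI ?ab u j (RR ?ab u j i X))) = ?V i j (?as' (?L' X))"
    if X: "X \<in> carrier (AA ?ab u)" and j: "j \<in> I" for X j
  proof (rule tensor_linear_eqI[OF _ _ _ _ _ X])
    show "linear (AA ?ab u) ?U (\<lambda>X. ?as (?L (TI ?ab u j (RR ?ab u j i X))))"
      using G i j by (intro lin) auto
    show "linear (AA ?ab u) ?U (\<lambda>X. ?V i j (?as' (?L' X)))"
      using G i j by (intro lin) auto
    fix x y assume x: "x \<in> carrier (A ?ab)" and y: "y \<in> carrier (A u)"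
    let ?y = "y \<otimes>\<^bsub>A u\<^esub> R u j i"
    have "?as (pt (A\<Gamma> s t) (A u) (TL s t j Z) ?y) = ?V i j (?as' (pt (AA s t) (A u) Z y))"
      if Z: "Z \<in> carrier (AA s t)" for Z
    proof (rule tensor_linear_eqI[OF _ _ _ _ _ Z])
      show "linear (AA s t) ?U (\<lambda>Z. ?as (pt (A\<Gamma> s t) (A u) (TL s t j Z) ?y))"
        using G i j y by (intro lin) auto
      show "linear (AA s t) ?U (\<lambda>Z. ?V i j (?as' (pt (AA s t) (A u) Z y)))"
        using G i j y by (intro lin) auto
    qed (use G i j y in \<open>auto simp: TL_pure tensor_assoc_pure tensor_map_pure linear_map_id TIRR_linear
        RR_pure TI_pure rmul_linear single_linear\<close>)
    from this[OF comult_closed[OF G(1,2) x]]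
    show "?as (?L (TI ?ab u j (RR ?ab u j i (pure ?ab u x y)))) =
        ?V i j (?as' (?L' (pure ?ab u x y)))"
      using G i j x y comult_closed[OF G(1,2) x]
      by (simp add: RR_pure TI_pure tensor_map_pure linear_map_id left_coact_linear left_coact_single
          comult_linear)
  qed (use G in auto)

  have 2: "?R (TL s ?bc i X) = fsum ?U (\<lambda>j. ?V i j (?R' X))" if X: "X \<in> carrier (AA s ?bc)" for X
  proof (rule tensor_linear_eqI[OF _ _ _ _ _ X])
    have R': "linear (AA s ?bc) ?T ?R'"
      using G by (intro tensor_map_linear linear_map_id comult_linear) auto
    show "linear (AA s ?bc) ?U (\<lambda>X. ?R (TL s ?bc i X))"
      using G by (intro lin) auto
    show "linear (AA s ?bc) ?U (\<lambda>X. fsum ?U (\<lambda>j. ?V i j (?R' X)))"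
      by (rule linear_map_fin_supp_sum_fun[OF _ mods(2) linear_map_comp[OF V R']])
        (use G finV[OF linear_map_closed[OF R']] in auto)
    fix x y assume x: "x \<in> carrier (A s)" and y: "y \<in> carrier (A ?bc)"
    note Y = comult_closed[OF G(2,3) y]
    have "?R (TL s ?bc i (pure s ?bc x y)) = pt (A s) (\<Gamma>A t u) x (RS t u i (\<Delta> t u y))"
      using G i x y by (simp add: TL_pure tensor_map_pure linear_map_id right_coact_linear right_coact_single)
    also have "\<dots> = fsum ?U (\<lambda>j. pt (A s) (\<Gamma>A t u) x (TI t u j (RR t u j i (\<Delta> t u y))))"
      using G i x Y by (intro linear_map_RS bilinear_map_right[OF pure_tensor_bilinear]) auto
    also have "\<dots> = fsum ?U (\<lambda>j. ?V i j (?R' (pure s ?bc x y)))"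
      by (rule fin_supp_sum_cong[OF mods(2)])
        (use G i x y Y in \<open>auto simp: tensor_map_pure[of K "A s"] linear_map_id comult_linear TIRR_linear\<close>)
    finally show "?R (TL s ?bc i (pure s ?bc x y)) =
        fsum ?U (\<lambda>j. ?V i j (?R' (pure s ?bc x y)))" .
  qed (use G in auto)

  have Xr: "\<Delta> s ?bc a \<in> carrier (AA s ?bc)"
    using G a comult_closed[of s ?bc a] by (simp add: m)
  have Xl: "\<Delta> ?ab u a \<in> carrier (AA ?ab u)"
    using G a comult_closed[of ?ab u a] by simp
  have "?as (?L (\<Delta>r ?ab u (\<iota> ?abc i a))) = ?as (?L (RS ?ab u i (\<Delta> ?ab u a)))"
    using right_coact_single[of ?ab u i a] G i a by simp
  also have "\<dots> = fsum ?U (\<lambda>j. ?as (?L (TI ?ab u j (RR ?ab u j i (\<Delta> ?ab u a)))))"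
    by (rule linear_map_RS[where g = "\<lambda>Z. ?as (?L Z)"])
      (use G i Xl in \<open>auto intro!: linear_intros left_coact_linear\<close>)
  also have "\<dots> = fsum ?U (\<lambda>j. ?V i j (?R' (\<Delta> s ?bc a)))"
  proof (rule fin_supp_sum_cong[OF mods(2)])
    have "?R' (\<Delta> s ?bc a) \<in> carrier ?T"
      by (rule linear_map_closed[OF tensor_map_linear Xr]) (use G in \<open>auto intro: lin\<close>)
    then show "(\<lambda>j. ?V i j (?R' (\<Delta> s ?bc a))) \<in> I \<rightarrow> carrier ?U"
      using linear_map_closed[OF V] by auto
  qed (use 1[OF Xl] coassoc[OF G a] in simp)
  also have "\<dots> = ?R (TL s ?bc i (\<Delta> s ?bc a))"
    using 2[OF Xr] by simp
  also have "\<dots> = ?R (\<Delta>l s ?bc (\<iota> ?abc i a))"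
    using left_coact_single[of s ?bc i a] G i a by (simp add: m)
  finally show "?as (?L (\<Delta>r ?ab u (\<iota> ?abc i a))) = ?R (\<Delta>l s ?bc (\<iota> ?abc i a))" .
qed (use G in auto)

lemma free_bicovariant:
  "bicovariant_bimodule K G A \<Delta> \<epsilon> S \<Gamma> (\<Delta>l) (\<Delta>r)"
  by (intro bicovariant_bimodule.intro bicovariant_bimodule_axioms.intro free_left_covariant
      right_covariant_bimodule.intro right_covariant_bimodule_axioms.intro free_bimodule_graded
      right_coact_linear right_coact_lact right_coact_ract right_coact_coassoc right_coact_counit
      coact_compat)

end

theorem theorem3p6:
  fixes K :: "'k ring" and G :: "'g monoid" and A :: "'g \<Rightarrow> ('k, 'a) module"
    and \<Delta> :: "'g \<Rightarrow> 'g \<Rightarrow> 'a \<Rightarrow> ('a \<times> 'a \<Rightarrow> 'k) set"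
    and \<epsilon> :: "'a \<Rightarrow> 'k" and S :: "'g \<Rightarrow> 'a \<Rightarrow> 'a"
    and I :: "'i set"
    and f :: "'i \<Rightarrow> 'i \<Rightarrow> 'g \<Rightarrow> 'a \<Rightarrow> 'k"
    and R :: "'g \<Rightarrow> 'i \<Rightarrow> 'i \<Rightarrow> 'a"
  assumes hopf: "hopf_group_coalgebra K G A \<Delta> \<epsilon> S"
    and f_linear: "\<And>i j \<alpha>. \<lbrakk>i \<in> I; j \<in> I; \<alpha> \<in> carrier G\<rbrakk> \<Longrightarrow>
      linear_map K (A \<alpha>) (ground K) (f i j \<alpha>)"
    and f_finite: "\<And>i \<alpha> b. \<lbrakk>i \<in> I; \<alpha> \<in> carrier G; b \<in> carrier (A \<alpha>)\<rbrakk> \<Longrightarrow>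
      finite {j \<in> I. f i j \<alpha> b \<noteq> \<zero>\<^bsub>K\<^esub>}"
    and f_mult: "\<And>i j \<alpha> a b.
      \<lbrakk>i \<in> I; j \<in> I; \<alpha> \<in> carrier G; a \<in> carrier (A \<alpha>); b \<in> carrier (A \<alpha>)\<rbrakk> \<Longrightarrow>
      f i j \<alpha> (a \<otimes>\<^bsub>A \<alpha>\<^esub> b) = fin_supp_sum K I (\<lambda>k. f i k \<alpha> a \<otimes>\<^bsub>K\<^esub> f k j \<alpha> b)"
    and f_one: "\<And>i j \<alpha>. \<lbrakk>i \<in> I; j \<in> I; \<alpha> \<in> carrier G\<rbrakk> \<Longrightarrow>
      f i j \<alpha> \<one>\<^bsub>A \<alpha>\<^esub> = (if i = j then \<one>\<^bsub>K\<^esub> else \<zero>\<^bsub>K\<^esub>)"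
    and R_closed: "\<And>i j \<alpha>. \<lbrakk>i \<in> I; j \<in> I; \<alpha> \<in> carrier G\<rbrakk> \<Longrightarrow> R \<alpha> i j \<in> carrier (A \<alpha>)"
    and R_finite: "\<And>i \<alpha>. \<lbrakk>i \<in> I; \<alpha> \<in> carrier G\<rbrakk> \<Longrightarrow>
      finite {j \<in> I. R \<alpha> j i \<noteq> \<zero>\<^bsub>A \<alpha>\<^esub>}"
    and R_comult: "\<And>i j \<alpha> \<beta>. \<lbrakk>i \<in> I; j \<in> I; \<alpha> \<in> carrier G; \<beta> \<in> carrier G\<rbrakk> \<Longrightarrow>
      \<Delta> \<alpha> \<beta> (R (\<alpha> \<otimes>\<^bsub>G\<^esub> \<beta>) j i) =
        fin_supp_sum (tensor K (A \<alpha>) (A \<beta>)) I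
          (\<lambda>h. pure_tensor K (A \<alpha>) (A \<beta>) (R \<alpha> j h) (R \<beta> h i))"
    and R_counit: "\<And>i j. \<lbrakk>i \<in> I; j \<in> I\<rbrakk> \<Longrightarrow>
      \<epsilon> (R \<one>\<^bsub>G\<^esub> j i) = (if j = i then \<one>\<^bsub>K\<^esub> else \<zero>\<^bsub>K\<^esub>)"
    and R_f: "\<And>j h \<alpha> a. \<lbrakk>j \<in> I; h \<in> I; \<alpha> \<in> carrier G; a \<in> carrier (A \<alpha>)\<rbrakk> \<Longrightarrow>
      fin_supp_sum (A \<alpha>) I (\<lambda>i. R \<alpha> i j \<otimes>\<^bsub>A \<alpha>\<^esub> conv_fun K G A \<Delta> \<alpha> a (f i h)) =
      fin_supp_sum (A \<alpha>) I (\<lambda>i. fun_conv K G A \<Delta> \<alpha> (f j i) a \<otimes>\<^bsub>A \<alpha>\<^esub> R \<alpha> h i)"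
  shows "bicovariant_bimodule K G A \<Delta> \<epsilon> S
    (free_bimodule K G A \<Delta> I f)
    (free_left_coact K G A \<Delta> I f)
    (free_right_coact K G A \<Delta> I f R)"
proof -
  interpret hopf_group_coalgebra K G A \<Delta> \<epsilon> S by (fact hopf)
  interpret functional_family K G A \<Delta> \<epsilon> S I f
    by unfold_locales (fact f_linear f_finite f_mult f_one)+
  interpret bicovariant_family K G A \<Delta> \<epsilon> S I f R
    by unfold_locales (fact R_closed R_finite R_comult R_counit R_f)+
  show ?thesis by (rule free_bicovariant)
qed

end
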